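(* Let $G$ be a finite group, $p$ a prime, and $\mathcal C$ a collection of $p$-subgroups of $G$ (closed under conjugation) that is closed under taking $p$-overgroups. Then for every $\mathbb Z_{(p)}\overline{\mathcal F}_{\mathcal C}(G)$-module $M$ there is an isomorphism $$H^*(\overline{\mathcal F}_{\mathcal C}(G);M)\cong H^*(\mathcal O_{\mathcal C}(G);\mathrm{Res}_{pr}M)$$ induced by the projection functor $pr:\mathcal O_{\mathcal C}(G)\to\overline{\mathcal F}_{\mathcal C}(G)$.
   Context: Closed under taking $p$-overgroups: if $P\in\mathcal C$ and $P\le Q$ with $Q$ a $p$-subgroup of $G$, then $Q\in\mathcal C$. For subgroups $H,K$ write $N_G(H,K)=\{g\in G:gHg^{-1}\le K\}$. The orbit category $\mathcal O_{\mathcal C}(G)$ has objects $H\in\mathcal C$ and morphisms $H\to K$ the $G$-maps $G/H\to G/K$, identified with $K\backslash N_G(H,K)$ (the coset $Kg$ corresponds to $xH\mapsto xg^{-1}K$). The fusion orbit category $\overline{\mathcal F}_{\mathcal C}(G)$ has objects $H\in\mathcal C$ and morphisms $H\to K$ given by $K\backslash N_G(H,K)/C_G(H)$. The functor $pr$ is the identity on objects and sends $Kg$ to $KgC_G(H)$; $\mathrm{Res}_{pr}M=M\circ pr$. For a small category $\mathbf C$ and a commutative ring $R$, an $R\mathbf C$-module is a contravariant functor $\mathbf C\to R\text{-Mod}$, and $H^n(\mathbf C;M)=\mathrm{Ext}^n_{R\mathbf C}(\underline R,M)$ with $\underline R$ the constant functor. *)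

theory Defs
  imports Complex_Main "HOL-Algebra.Module" "HOL-Algebra.AbelCoset"
    "HOL-Computational_Algebra.Primes"
begin

section \<open>Small categories and functors\<close>

text \<open>Hom-sets of different pairs of objects may overlap, so everything that depends on
  the source or the target of a morphism takes the objects as explicit arguments.\<close>

record ('o, 'm) cat =
  Ob :: "'o set"
  Hom :: "'o \<Rightarrow> 'o \<Rightarrow> 'm set"
  Idn :: "'o \<Rightarrow> 'm"
  Cmp :: "'m \<Rightarrow> 'm \<Rightarrow> 'm"  \<comment> \<open>\<open>Cmp C g f\<close> is \<open>g\<close> after \<open>f\<close>\<close>

definition category :: "('o, 'm) cat \<Rightarrow> bool" where
  "category C \<longleftrightarrow>
     (\<forall>x\<in>Ob C. Idn C x \<in> Hom C x x) \<and>
     (\<forall>x\<in>Ob C. \<forall>y\<in>Ob C. \<forall>z\<in>Ob C. \<forall>f\<in>Hom C x y. \<forall>g\<in>Hom C y z. Cmp C g f \<in> Hom C x z) \<and>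
     (\<forall>x\<in>Ob C. \<forall>y\<in>Ob C. \<forall>f\<in>Hom C x y. Cmp C f (Idn C x) = f \<and> Cmp C (Idn C y) f = f) \<and>
     (\<forall>w\<in>Ob C. \<forall>x\<in>Ob C. \<forall>y\<in>Ob C. \<forall>z\<in>Ob C.
        \<forall>f\<in>Hom C w x. \<forall>g\<in>Hom C x y. \<forall>h\<in>Hom C y z.
          Cmp C h (Cmp C g f) = Cmp C (Cmp C h g) f)"

record ('o, 'm, 'p, 'n) cat_functor =
  fun_ob :: "'o \<Rightarrow> 'p"
  fun_mor :: "'o \<Rightarrow> 'o \<Rightarrow> 'm \<Rightarrow> 'n"

definition is_functor ::
    "('o, 'm) cat \<Rightarrow> ('p, 'n) cat \<Rightarrow> ('o, 'm, 'p, 'n) cat_functor \<Rightarrow> bool" where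
  "is_functor C D F \<longleftrightarrow>
     (\<forall>x\<in>Ob C. fun_ob F x \<in> Ob D \<and> fun_mor F x x (Idn C x) = Idn D (fun_ob F x)) \<and>
     (\<forall>x\<in>Ob C. \<forall>y\<in>Ob C. \<forall>f\<in>Hom C x y.
        fun_mor F x y f \<in> Hom D (fun_ob F x) (fun_ob F y)) \<and>
     (\<forall>x\<in>Ob C. \<forall>y\<in>Ob C. \<forall>z\<in>Ob C. \<forall>f\<in>Hom C x y. \<forall>g\<in>Hom C y z.
        fun_mor F x z (Cmp C g f) = Cmp D (fun_mor F y z g) (fun_mor F x y f))"


section \<open>Linear maps, quotient modules, cohomology of cochain complexes\<close>

definition lin_maps ::
    "'r ring \<Rightarrow> ('r, 'a) module \<Rightarrow> ('r, 'b) module \<Rightarrow> ('a \<Rightarrow> 'b) set" where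
  "lin_maps R M N =
     {h. h \<in> carrier M \<rightarrow> carrier N \<and>
         (\<forall>x\<in>carrier M. \<forall>y\<in>carrier M. h (x \<oplus>\<^bsub>M\<^esub> y) = h x \<oplus>\<^bsub>N\<^esub> h y) \<and>
         (\<forall>r\<in>carrier R. \<forall>x\<in>carrier M. h (r \<odot>\<^bsub>M\<^esub> x) = r \<odot>\<^bsub>N\<^esub> h x)}"

definition lin_isos ::
    "'r ring \<Rightarrow> ('r, 'a) module \<Rightarrow> ('r, 'b) module \<Rightarrow> ('a \<Rightarrow> 'b) set" where
  "lin_isos R M N = {h \<in> lin_maps R M N. bij_betw h (carrier M) (carrier N)}"

text \<open>The quotient of a module by a submodule, consisting of additive cosets.  Scalars act by
  \<open>r (B + x) = B + r x\<close>; adding \<open>B\<close> to the set \<open>{r y | y \<in> U}\<close> makes the result a full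
  coset of \<open>B\<close>.  Only the module structure matters, so the ring multiplication and unit
  that the library's record type provides for are left unspecified, here and below.\<close>

definition quot_module :: "('r, 'a) module \<Rightarrow> 'a set \<Rightarrow> ('r, 'a set) module" where
  "quot_module M B =
     \<lparr>carrier = a_rcosets\<^bsub>M\<^esub> B, monoid.mult = undefined, one = undefined, zero = B,
      add = (\<lambda>U V. set_add M U V),
      smult = (\<lambda>r U. set_add M B ((\<lambda>x. r \<odot>\<^bsub>M\<^esub> x) ` U))\<rparr>"

definition cocycles :: "(nat \<Rightarrow> ('r, 'a) module) \<Rightarrow> (nat \<Rightarrow> 'a \<Rightarrow> 'a) \<Rightarrow> nat \<Rightarrow> 'a set" where
  "cocycles K \<delta> n = a_kernel (K n) (K (Suc n)) (\<delta> n)"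

definition coboundaries :: "(nat \<Rightarrow> ('r, 'a) module) \<Rightarrow> (nat \<Rightarrow> 'a \<Rightarrow> 'a) \<Rightarrow> nat \<Rightarrow> 'a set" where
  "coboundaries K \<delta> n = (case n of 0 \<Rightarrow> {\<zero>\<^bsub>K 0\<^esub>} | Suc m \<Rightarrow> \<delta> m ` carrier (K m))"

definition cohomology ::
    "(nat \<Rightarrow> ('r, 'a) module) \<Rightarrow> (nat \<Rightarrow> 'a \<Rightarrow> 'a) \<Rightarrow> nat \<Rightarrow> ('r, 'a set) module" where
  "cohomology K \<delta> n = quot_module ((K n)\<lparr>carrier := cocycles K \<delta> n\<rparr>) (coboundaries K \<delta> n)"

text \<open>The map on \<open>n\<close>-th cohomology induced by a cochain map into \<open>(K, \<delta>)\<close> whose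
  component in degree \<open>n\<close> is \<open>h\<close>; it sends the class of \<open>z\<close> to the class of \<open>h z\<close>.\<close>

definition cohomology_map ::
    "(nat \<Rightarrow> ('r, 'b) module) \<Rightarrow> (nat \<Rightarrow> 'b \<Rightarrow> 'b) \<Rightarrow> nat \<Rightarrow> ('a \<Rightarrow> 'b) \<Rightarrow> 'a set \<Rightarrow> 'b set" where
  "cohomology_map K \<delta> n h U = set_add (K n) (coboundaries K \<delta> n) (h ` U)"


section \<open>Modules over a category\<close>

text \<open>\<open>mod_map M x y f\<close> is the map \<open>M y \<rightarrow> M x\<close> induced by \<open>f : x \<rightarrow> y\<close>.\<close>

record ('o, 'm, 'r, 'a) cat_module =
  mod_at :: "'o \<Rightarrow> ('r, 'a) module"
  mod_map :: "'o \<Rightarrow> 'o \<Rightarrow> 'm \<Rightarrow> 'a \<Rightarrow> 'a"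

definition is_cat_module ::
    "'r ring \<Rightarrow> ('o, 'm) cat \<Rightarrow> ('o, 'm, 'r, 'a) cat_module \<Rightarrow> bool" where
  "is_cat_module R C M \<longleftrightarrow>
     (\<forall>x\<in>Ob C. module R (mod_at M x)) \<and>
     (\<forall>x\<in>Ob C. \<forall>y\<in>Ob C. \<forall>f\<in>Hom C x y.
        mod_map M x y f \<in> lin_maps R (mod_at M y) (mod_at M x)) \<and>
     (\<forall>x\<in>Ob C. \<forall>a\<in>carrier (mod_at M x). mod_map M x x (Idn C x) a = a) \<and>
     (\<forall>x\<in>Ob C. \<forall>y\<in>Ob C. \<forall>z\<in>Ob C. \<forall>f\<in>Hom C x y. \<forall>g\<in>Hom C y z.
        \<forall>a\<in>carrier (mod_at M z).
          mod_map M x z (Cmp C g f) a = mod_map M x y f (mod_map M y z g a))"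

definition const_module :: "'r ring \<Rightarrow> ('o, 'm, 'r, 'r) cat_module" where
  "const_module R =
     \<lparr>mod_at = (\<lambda>_. \<lparr>carrier = carrier R, monoid.mult = monoid.mult R, one = one R, zero = zero R,
                       add = add R, smult = monoid.mult R\<rparr>),
      mod_map = (\<lambda>_ _ _ a. a)\<rparr>"

definition res_module ::
    "('o, 'm, 'p, 'n) cat_functor \<Rightarrow> ('p, 'n, 'r, 'a) cat_module \<Rightarrow> ('o, 'm, 'r, 'a) cat_module"
  where
  "res_module F M =
     \<lparr>mod_at = (\<lambda>x. mod_at M (fun_ob F x)),
      mod_map = (\<lambda>x y f. mod_map M (fun_ob F x) (fun_ob F y) (fun_mor F x y f))\<rparr>"

definition nat_trans ::
    "'r ring \<Rightarrow> ('o, 'm) cat \<Rightarrow> ('o, 'm, 'r, 'a) cat_module \<Rightarrow> ('o, 'm, 'r, 'b) cat_module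
       \<Rightarrow> ('o \<Rightarrow> 'a \<Rightarrow> 'b) set" where
  "nat_trans R C M N =
     {\<eta>. (\<forall>x\<in>Ob C. \<eta> x \<in> lin_maps R (mod_at M x) (mod_at N x)) \<and>
         (\<forall>x\<in>Ob C. \<forall>y\<in>Ob C. \<forall>f\<in>Hom C x y. \<forall>a\<in>carrier (mod_at M y).
            \<eta> x (mod_map M x y f a) = mod_map N x y f (\<eta> y a))}"

text \<open>The module of morphisms \<open>M \<rightarrow> N\<close>.  Its elements are required to be \<open>undefined\<close>
  outside the objects of \<open>C\<close> and outside the carriers of \<open>M\<close>, so that equality in HOL is
  equality of natural transformations.\<close>

definition hom_module ::
    "'r ring \<Rightarrow> ('o, 'm) cat \<Rightarrow> ('o, 'm, 'r, 'a) cat_module \<Rightarrow> ('o, 'm, 'r, 'b) cat_module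
       \<Rightarrow> ('r, 'o \<Rightarrow> 'a \<Rightarrow> 'b) module" where
  "hom_module R C M N =
     \<lparr>carrier = {\<eta> \<in> nat_trans R C M N.
                   \<eta> \<in> (\<Pi>\<^sub>E x\<in>Ob C. extensional (carrier (mod_at M x)))},
      monoid.mult = undefined, one = undefined,
      zero = (\<lambda>x\<in>Ob C. \<lambda>a\<in>carrier (mod_at M x). \<zero>\<^bsub>mod_at N x\<^esub>),
      add = (\<lambda>\<eta> \<theta>. \<lambda>x\<in>Ob C. \<lambda>a\<in>carrier (mod_at M x). \<eta> x a \<oplus>\<^bsub>mod_at N x\<^esub> \<theta> x a),
      smult = (\<lambda>r \<eta>. \<lambda>x\<in>Ob C. \<lambda>a\<in>carrier (mod_at M x). r \<odot>\<^bsub>mod_at N x\<^esub> \<eta> x a)\<rparr>"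

text \<open>Epimorphisms of modules over a category are the objectwise surjective morphisms.\<close>

definition is_epi ::
    "'r ring \<Rightarrow> ('o, 'm) cat \<Rightarrow> ('o, 'm, 'r, 'a) cat_module \<Rightarrow> ('o, 'm, 'r, 'b) cat_module
       \<Rightarrow> ('o \<Rightarrow> 'a \<Rightarrow> 'b) \<Rightarrow> bool" where
  "is_epi R C M N e \<longleftrightarrow>
     e \<in> nat_trans R C M N \<and>
     (\<forall>x\<in>Ob C. e x ` carrier (mod_at M x) = carrier (mod_at N x))"

text \<open>Projectivity is the lifting property against epimorphisms \<open>e : A \<rightarrow> B\<close>.  A definition
  in HOL cannot quantify over the type of the elements of \<open>A\<close> and \<open>B\<close>, so these types are fixed,
  large enough for the property to be the unrestricted one.  The elements of \<open>B\<close>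
  have the type of those of \<open>P\<close>, so that \<open>B = P\<close> is allowed.  The elements of \<open>A\<close> are
  functions on triples \<open>(y, f, a)\<close> with values in \<open>R\<close>, so that \<open>A\<close> can be the free module
  on the elements of \<open>P\<close>: its value at \<open>x\<close> consists of the finitely supported functions on
  the triples with \<open>f : x \<rightarrow> y\<close> and \<open>a\<close> in \<open>P y\<close>.  Lifting the identity of \<open>P\<close> through the
  canonical epimorphism from this free module shows that \<open>P\<close> is a direct summand of it, and so has
  the lifting property against every epimorphism between modules on any types.\<close>

definition projective ::
    "'r ring \<Rightarrow> ('o, 'm) cat \<Rightarrow> ('o, 'm, 'r, 'a) cat_module \<Rightarrow> bool" where
  "projective R C P \<longleftrightarrow>
     is_cat_module R C P \<and>
     (\<forall>(A :: ('o, 'm, 'r, 'o \<times> 'm \<times> 'a \<Rightarrow> 'r) cat_module) (B :: ('o, 'm, 'r, 'a) cat_module) e h.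
        is_cat_module R C A \<and> is_cat_module R C B \<and> is_epi R C A B e \<and> h \<in> nat_trans R C P B
        \<longrightarrow> (\<exists>k\<in>nat_trans R C P A. \<forall>x\<in>Ob C. \<forall>a\<in>carrier (mod_at P x). e x (k x a) = h x a))"


section \<open>Projective resolutions and Ext\<close>

text \<open>\<open>diff P n\<close> is the differential from degree \<open>n + 1\<close> to degree \<open>n\<close>, and \<open>aug P\<close>
  the augmentation from degree \<open>0\<close> to the resolved module.\<close>

record ('o, 'm, 'r, 'a, 'b) resolution =
  trm :: "nat \<Rightarrow> ('o, 'm, 'r, 'a) cat_module"
  diff :: "nat \<Rightarrow> 'o \<Rightarrow> 'a \<Rightarrow> 'a"
  aug :: "'o \<Rightarrow> 'a \<Rightarrow> 'b"

definition projective_resolution ::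
    "'r ring \<Rightarrow> ('o, 'm) cat \<Rightarrow> ('o, 'm, 'r, 'b) cat_module
       \<Rightarrow> ('o, 'm, 'r, 'a, 'b) resolution \<Rightarrow> bool" where
  "projective_resolution R C N P \<longleftrightarrow>
     (\<forall>n. projective R C (trm P n)) \<and>
     (\<forall>n. diff P n \<in> nat_trans R C (trm P (Suc n)) (trm P n)) \<and>
     is_epi R C (trm P 0) N (aug P) \<and>
     (\<forall>x\<in>Ob C. diff P 0 x ` carrier (mod_at (trm P 1) x)
        = a_kernel (mod_at (trm P 0) x) (mod_at N x) (aug P x)) \<and>
     (\<forall>n. \<forall>x\<in>Ob C. diff P (Suc n) x ` carrier (mod_at (trm P (Suc (Suc n))) x)
        = a_kernel (mod_at (trm P (Suc n)) x) (mod_at (trm P n) x) (diff P n x))"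

text \<open>The cochain complex \<open>Hom(P, M)\<close>, whose differential is precomposition with that of \<open>P\<close>.\<close>

definition hom_complex ::
    "'r ring \<Rightarrow> ('o, 'm) cat \<Rightarrow> ('o, 'm, 'r, 'a, 'b) resolution \<Rightarrow> ('o, 'm, 'r, 'c) cat_module
       \<Rightarrow> nat \<Rightarrow> ('r, 'o \<Rightarrow> 'a \<Rightarrow> 'c) module" where
  "hom_complex R C P M n = hom_module R C (trm P n) M"

definition hom_diff ::
    "('o, 'm) cat \<Rightarrow> ('o, 'm, 'r, 'a, 'b) resolution
       \<Rightarrow> nat \<Rightarrow> ('o \<Rightarrow> 'a \<Rightarrow> 'c) \<Rightarrow> ('o \<Rightarrow> 'a \<Rightarrow> 'c)" where
  "hom_diff C P n \<eta> =
     (\<lambda>x\<in>Ob C. \<lambda>a\<in>carrier (mod_at (trm P (Suc n)) x). \<eta> x (diff P n x a))"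

text \<open>The \<open>n\<close>-th Ext module with coefficients in \<open>M\<close>, computed from a projective resolution
  \<open>P\<close>.  The \<open>n\<close>-th cohomology of \<open>C\<close> with coefficients in \<open>M\<close> is the case where \<open>P\<close> resolves
  the constant module.\<close>

definition Ext ::
    "'r ring \<Rightarrow> ('o, 'm) cat \<Rightarrow> ('o, 'm, 'r, 'a, 'b) resolution \<Rightarrow> ('o, 'm, 'r, 'c) cat_module
       \<Rightarrow> nat \<Rightarrow> ('r, ('o \<Rightarrow> 'a \<Rightarrow> 'c) set) module" where
  "Ext R C P M n = cohomology (hom_complex R C P M) (hom_diff C P) n"

text \<open>Let \<open>F : C \<rightarrow> D\<close> be a functor, and let \<open>P\<close> over \<open>D\<close> and \<open>Q\<close> over \<open>C\<close> be projective
  resolutions of the constant modules.  Restriction is exact, so \<open>Res\<^sub>F P\<close> is a resolution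
  of \<open>Res\<^sub>F R = R\<close>, and there is a chain map \<open>\<phi> : Q \<rightarrow> Res\<^sub>F P\<close> over the identity of
  \<open>R\<close>, unique up to chain homotopy.  The map on cohomology induced by \<open>F\<close> is induced by the
  composite of \<open>Hom\<^sub>D(P, M) \<rightarrow> Hom\<^sub>C(Res\<^sub>F P, Res\<^sub>F M) \<rightarrow> Hom\<^sub>C(Q, Res\<^sub>F M)\<close>,
  restriction followed by precomposition with \<open>\<phi>\<close>.\<close>

definition comparison_map ::
    "'r ring \<Rightarrow> ('o, 'm) cat \<Rightarrow> ('o, 'm, 'p, 'n) cat_functor
       \<Rightarrow> ('p, 'n, 'r, 'a, 'd) resolution \<Rightarrow> ('o, 'm, 'r, 'b, 'd) resolution
       \<Rightarrow> (nat \<Rightarrow> 'o \<Rightarrow> 'b \<Rightarrow> 'a) \<Rightarrow> bool" where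
  "comparison_map R C F P Q \<phi> \<longleftrightarrow>
     (\<forall>n. \<phi> n \<in> nat_trans R C (trm Q n) (res_module F (trm P n))) \<and>
     (\<forall>x\<in>Ob C. \<forall>a\<in>carrier (mod_at (trm Q 0) x). aug P (fun_ob F x) (\<phi> 0 x a) = aug Q x a) \<and>
     (\<forall>n. \<forall>x\<in>Ob C. \<forall>a\<in>carrier (mod_at (trm Q (Suc n)) x).
        diff P n (fun_ob F x) (\<phi> (Suc n) x a) = \<phi> n x (diff Q n x a))"

definition pull ::
    "('o, 'm) cat \<Rightarrow> ('o, 'm, 'p, 'n) cat_functor \<Rightarrow> ('o, 'm, 'r, 'b, 'd) resolution
       \<Rightarrow> (nat \<Rightarrow> 'o \<Rightarrow> 'b \<Rightarrow> 'a) \<Rightarrow> nat \<Rightarrow> ('p \<Rightarrow> 'a \<Rightarrow> 'c) \<Rightarrow> ('o \<Rightarrow> 'b \<Rightarrow> 'c)" where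
  "pull C F Q \<phi> n \<eta> =
     (\<lambda>x\<in>Ob C. \<lambda>a\<in>carrier (mod_at (trm Q n) x). \<eta> (fun_ob F x) (\<phi> n x a))"

definition induced_map ::
    "'r ring \<Rightarrow> ('o, 'm) cat \<Rightarrow> ('o, 'm, 'p, 'n) cat_functor \<Rightarrow> ('o, 'm, 'r, 'b, 'd) resolution
       \<Rightarrow> (nat \<Rightarrow> 'o \<Rightarrow> 'b \<Rightarrow> 'a) \<Rightarrow> ('p, 'n, 'r, 'c) cat_module
       \<Rightarrow> nat \<Rightarrow> ('p \<Rightarrow> 'a \<Rightarrow> 'c) set \<Rightarrow> ('o \<Rightarrow> 'b \<Rightarrow> 'c) set" where
  "induced_map R C F Q \<phi> M n =
     cohomology_map (hom_complex R C Q (res_module F M)) (hom_diff C Q) n (pull C F Q \<phi> n)"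


section \<open>Collections of subgroups, orbit categories and fusion orbit categories\<close>

definition localization_at :: "nat \<Rightarrow> rat ring" where
  "localization_at p =
     \<lparr>carrier = {of_int a / of_int b | a b. \<not> int p dvd b},
      monoid.mult = (*), one = 1, zero = 0, add = (+)\<rparr>"

definition p_subgroup :: "nat \<Rightarrow> ('g, 'z) monoid_scheme \<Rightarrow> 'g set \<Rightarrow> bool" where
  "p_subgroup p G H \<longleftrightarrow> subgroup H G \<and> (\<exists>k. card H = p ^ k)"

definition p_collection :: "nat \<Rightarrow> ('g, 'z) monoid_scheme \<Rightarrow> 'g set set \<Rightarrow> bool" where
  "p_collection p G \<C> \<longleftrightarrow>
     (\<forall>H\<in>\<C>. p_subgroup p G H) \<and>
     (\<forall>H\<in>\<C>. \<forall>g\<in>carrier G. g <#\<^bsub>G\<^esub> H #>\<^bsub>G\<^esub> inv\<^bsub>G\<^esub> g \<in> \<C>)"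

definition closed_under_p_overgroups ::
    "nat \<Rightarrow> ('g, 'z) monoid_scheme \<Rightarrow> 'g set set \<Rightarrow> bool" where
  "closed_under_p_overgroups p G \<C> \<longleftrightarrow>
     (\<forall>P\<in>\<C>. \<forall>Q. p_subgroup p G Q \<and> P \<subseteq> Q \<longrightarrow> Q \<in> \<C>)"

definition centralizer :: "('g, 'z) monoid_scheme \<Rightarrow> 'g set \<Rightarrow> 'g set" where
  "centralizer G H = {g \<in> carrier G. \<forall>h\<in>H. g \<otimes>\<^bsub>G\<^esub> h = h \<otimes>\<^bsub>G\<^esub> g}"

definition transporter :: "('g, 'z) monoid_scheme \<Rightarrow> 'g set \<Rightarrow> 'g set \<Rightarrow> 'g set" where
  "transporter G H K = {g \<in> carrier G. g <#\<^bsub>G\<^esub> H #>\<^bsub>G\<^esub> inv\<^bsub>G\<^esub> g \<subseteq> K}"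

text \<open>A morphism \<open>H \<rightarrow> K\<close> is a coset \<open>K g\<close>, respectively a double coset \<open>K g C(H)\<close>, with \<open>g\<close> in
  the transporter.  The composite of \<open>L h\<close> after \<open>K g\<close> is \<open>L h g\<close>; as \<open>h K \<subseteq> L h\<close>, it is the
  product of sets \<open>(L h) (K g)\<close>.  Likewise the composite \<open>L h g C(H)\<close> of double cosets is
  the product of sets \<open>(L h C(K)) (K g C(H))\<close>, as moreover \<open>C(K) g \<subseteq> g C(H)\<close>.\<close>

definition orbit_category :: "('g, 'z) monoid_scheme \<Rightarrow> 'g set set \<Rightarrow> ('g set, 'g set) cat" where
  "orbit_category G \<C> =
     \<lparr>Ob = \<C>,
      Hom = (\<lambda>H K. {K #>\<^bsub>G\<^esub> g | g. g \<in> transporter G H K}),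
      Idn = (\<lambda>H. H),
      Cmp = (\<lambda>V U. V <#>\<^bsub>G\<^esub> U)\<rparr>"

definition fusion_orbit_category ::
    "('g, 'z) monoid_scheme \<Rightarrow> 'g set set \<Rightarrow> ('g set, 'g set) cat" where
  "fusion_orbit_category G \<C> =
     \<lparr>Ob = \<C>,
      Hom = (\<lambda>H K. {(K #>\<^bsub>G\<^esub> g) <#>\<^bsub>G\<^esub> centralizer G H | g. g \<in> transporter G H K}),
      Idn = (\<lambda>H. H <#>\<^bsub>G\<^esub> centralizer G H),
      Cmp = (\<lambda>V U. V <#>\<^bsub>G\<^esub> U)\<rparr>"

definition pr :: "('g, 'z) monoid_scheme \<Rightarrow> ('g set, 'g set, 'g set, 'g set) cat_functor" where
  "pr G = \<lparr>fun_ob = (\<lambda>H. H), fun_mor = (\<lambda>H K U. U <#>\<^bsub>G\<^esub> centralizer G H)\<rparr>"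


section \<open>The orbit categories are categories, and the projection is a functor\<close>

context group begin

lemma transporterD:
  assumes "g \<in> transporter G H K" "x \<in> H" "H \<subseteq> carrier G"
  shows "g \<in> carrier G" "g \<otimes> x \<otimes> inv g \<in> K"
  using assms unfolding transporter_def l_coset_def r_coset_def by auto

lemma transporter_one: "H \<subseteq> carrier G \<Longrightarrow> \<one> \<in> transporter G H H"
  unfolding transporter_def l_coset_def r_coset_def by auto

lemma transporter_mult:
  assumes "g \<in> transporter G H K" "h \<in> transporter G K L" "H \<subseteq> carrier G" "K \<subseteq> carrier G"
  shows "h \<otimes> g \<in> transporter G H L"
proof -
  have c: "g \<in> carrier G" "h \<in> carrier G" using assms unfolding transporter_def by auto
  have "h \<otimes> g \<otimes> x \<otimes> inv (h \<otimes> g) \<in> L" if "x \<in> H" for x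
  proof -
    have x: "x \<in> carrier G" using that assms by auto
    have "h \<otimes> (g \<otimes> x \<otimes> inv g) \<otimes> inv h \<in> L"
      using transporterD[OF assms(2) transporterD(2)[OF assms(1) that assms(3)] assms(4)] by simp
    then show ?thesis using c x by (simp add: m_assoc inv_mult_group)
  qed
  then show ?thesis using c unfolding transporter_def l_coset_def r_coset_def by auto
qed

lemma orbit_comp:
  assumes "subgroup H G" "subgroup K G" "subgroup L G" "g \<in> transporter G H K" "h \<in> transporter G K L"
  shows "(L #> h) <#> (K #> g) = L #> (h \<otimes> g)"
proof -
  have c: "g \<in> carrier G" "h \<in> carrier G" using assms unfolding transporter_def by auto
  have K: "K \<subseteq> carrier G" and L: "L \<subseteq> carrier G" using assms subgroup.subset by auto
  show ?thesis
  proof (intro equalityI subsetI)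
    fix u assume "u \<in> (L #> h) <#> (K #> g)"
    then obtain l k where u: "l \<in> L" "k \<in> K" "u = (l \<otimes> h) \<otimes> (k \<otimes> g)"
      unfolding set_mult_def r_coset_def by auto
    have kc: "k \<in> carrier G" "l \<in> carrier G" using u K L by auto
    have "h \<otimes> k \<otimes> inv h \<in> L" using transporterD(2)[OF assms(5) u(2) K] .
    then have "l \<otimes> (h \<otimes> k \<otimes> inv h) \<in> L" using u assms subgroup.m_closed by metis
    moreover have "u = (l \<otimes> (h \<otimes> k \<otimes> inv h)) \<otimes> (h \<otimes> g)"
      using u c kc by (simp add: m_assoc inv_solve_left' flip: m_assoc[of "inv h" h])
    ultimately show "u \<in> L #> (h \<otimes> g)" unfolding r_coset_def by auto
  next
    fix u assume "u \<in> L #> (h \<otimes> g)"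
    then obtain l where l: "l \<in> L" "u = l \<otimes> (h \<otimes> g)" unfolding r_coset_def by auto
    have "u = (l \<otimes> h) \<otimes> (\<one> \<otimes> g)" using l c L by (auto simp: m_assoc)
    moreover have "\<one> \<in> K" using assms subgroup.one_closed by auto
    ultimately show "u \<in> (L #> h) <#> (K #> g)" using l
      unfolding set_mult_def r_coset_def by blast
  qed
qed

lemma centralizer_subset: "centralizer G H \<subseteq> carrier G" unfolding centralizer_def by auto

lemma subgroup_centralizer: assumes "H \<subseteq> carrier G" shows "subgroup (centralizer G H) G"
proof
  show "centralizer G H \<subseteq> carrier G" by (rule centralizer_subset)
  show "\<one> \<in> centralizer G H" using assms unfolding centralizer_def by auto
next
  fix x y assume xy: "x \<in> centralizer G H" "y \<in> centralizer G H"
  then have c: "x \<in> carrier G" "y \<in> carrier G" unfolding centralizer_def by auto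
  have "(x \<otimes> y) \<otimes> h = h \<otimes> (x \<otimes> y)" if "h \<in> H" for h
  proof -
    have h: "h \<in> carrier G" "x \<otimes> h = h \<otimes> x" "y \<otimes> h = h \<otimes> y" using that assms xy unfolding centralizer_def by auto
    then show ?thesis using c by (metis m_assoc)
  qed
  then show "x \<otimes> y \<in> centralizer G H" using c unfolding centralizer_def by auto
next
  fix x assume x: "x \<in> centralizer G H"
  then have c: "x \<in> carrier G" unfolding centralizer_def by auto
  have "inv x \<otimes> h = h \<otimes> inv x" if "h \<in> H" for h
  proof -
    have h: "h \<in> carrier G" "x \<otimes> h = h \<otimes> x" using that assms x unfolding centralizer_def by auto
    then show ?thesis using c by (metis inv_closed inv_solve_left inv_solve_right' m_assoc m_closed)
  qed
  then show "inv x \<in> centralizer G H" using c unfolding centralizer_def by auto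
qed

lemma centralizer_conj:
  assumes "H \<subseteq> carrier G" "K \<subseteq> carrier G" "g \<in> transporter G H K" "c \<in> centralizer G K"
  shows "inv g \<otimes> c \<otimes> g \<in> centralizer G H"
proof -
  have g: "g \<in> carrier G" and c: "c \<in> carrier G" using assms unfolding transporter_def centralizer_def by auto
  have "inv g \<otimes> c \<otimes> g \<otimes> h = h \<otimes> (inv g \<otimes> c \<otimes> g)" if h: "h \<in> H" for h
  proof -
    have hc: "h \<in> carrier G" using h assms by auto
    have "g \<otimes> h \<otimes> inv g \<in> K" using transporterD(2)[OF assms(3) h assms(1)] .
    then have e: "c \<otimes> (g \<otimes> h \<otimes> inv g) = (g \<otimes> h \<otimes> inv g) \<otimes> c"
      using assms(4) unfolding centralizer_def by auto
    have "inv g \<otimes> c \<otimes> g \<otimes> h = inv g \<otimes> (c \<otimes> (g \<otimes> h \<otimes> inv g)) \<otimes> g"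
      using g c hc by (simp add: m_assoc)
    also have "\<dots> = inv g \<otimes> ((g \<otimes> h \<otimes> inv g) \<otimes> c) \<otimes> g" using e by simp
    also have "\<dots> = h \<otimes> (inv g \<otimes> c \<otimes> g)" 
      using g c hc by (simp add: m_assoc flip: m_assoc[of "inv g" g])
    finally show ?thesis .
  qed
  then show ?thesis using g c unfolding centralizer_def by auto
qed

lemma centralizer_absorb:
  assumes "H \<subseteq> carrier G" "subgroup K G" "g \<in> transporter G H K"
  shows "centralizer G K <#> ((K #> g) <#> centralizer G H) = (K #> g) <#> centralizer G H"
proof -
  have K: "K \<subseteq> carrier G" using assms subgroup.subset by auto
  have g: "g \<in> carrier G" using assms unfolding transporter_def by auto
  show ?thesis
  proof (intro equalityI subsetI)
    fix u assume "u \<in> centralizer G K <#> ((K #> g) <#> centralizer G H)"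
    then obtain c k d where u: "c \<in> centralizer G K" "k \<in> K" "d \<in> centralizer G H"
      "u = c \<otimes> ((k \<otimes> g) \<otimes> d)"
      unfolding set_mult_def r_coset_def by auto
    have cc: "c \<in> carrier G" "k \<in> carrier G" "d \<in> carrier G" using u K centralizer_subset by blast+
    have ck: "c \<otimes> k = k \<otimes> c" using u unfolding centralizer_def by auto
    have i: "inv g \<otimes> c \<otimes> g \<otimes> d \<in> centralizer G H"
      using centralizer_conj[OF assms(1) K assms(3) u(1)] u(3) subgroup_centralizer[OF assms(1)]
      by (metis subgroup.m_closed)
    have "u = (c \<otimes> k) \<otimes> g \<otimes> d" using u cc g by (simp add: m_assoc)
    also have "\<dots> = (k \<otimes> g) \<otimes> (inv g \<otimes> c \<otimes> g \<otimes> d)"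
      unfolding ck using cc g by (simp add: m_assoc flip: m_assoc[of g "inv g"])
    finally show "u \<in> (K #> g) <#> centralizer G H" using i u
      unfolding set_mult_def r_coset_def by blast
  next
    fix u assume u: "u \<in> (K #> g) <#> centralizer G H"
    then have "u \<in> carrier G" using K g centralizer_subset unfolding set_mult_def r_coset_def
      by (auto dest!: subsetD) 
    then have "u = \<one> \<otimes> u" by simp
    then show "u \<in> centralizer G K <#> ((K #> g) <#> centralizer G H)"
      using u subgroup.one_closed[OF subgroup_centralizer[OF K]]
      unfolding set_mult_def by blast
  qed
qed

lemma fusion_comp:
  assumes "subgroup H G" "subgroup K G" "subgroup L G" "g \<in> transporter G H K" "h \<in> transporter G K L"
  shows "((L #> h) <#> centralizer G K) <#> ((K #> g) <#> centralizer G H)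
    = (L #> (h \<otimes> g)) <#> centralizer G H"
proof -
  have s: "H \<subseteq> carrier G" "K \<subseteq> carrier G" "L \<subseteq> carrier G" using assms subgroup.subset by auto
  have c: "g \<in> carrier G" "h \<in> carrier G" using assms unfolding transporter_def by auto
  have r: "L #> h \<subseteq> carrier G" "K #> g \<subseteq> carrier G" using s c r_coset_subset_G by auto
  have "((L #> h) <#> centralizer G K) <#> ((K #> g) <#> centralizer G H)
     = (L #> h) <#> (centralizer G K <#> ((K #> g) <#> centralizer G H))"
    using r centralizer_subset by (simp add: set_mult_assoc set_mult_closed)
  also have "\<dots> = ((L #> h) <#> (K #> g)) <#> centralizer G H"
    using r centralizer_subset centralizer_absorb[OF s(1) assms(2,4)] by (simp add: set_mult_assoc)
  finally show ?thesis using orbit_comp[OF assms] by simp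
qed

lemma
  assumes sub: "\<And>H. H \<in> \<C> \<Longrightarrow> subgroup H G"
  shows category_orbit_category: "category (orbit_category G \<C>)"
    and category_fusion_orbit_category: "category (fusion_orbit_category G \<C>)"
    and is_functor_pr: "is_functor (orbit_category G \<C>) (fusion_orbit_category G \<C>) (pr G)"
proof -
  have sc: "\<And>H. H \<in> \<C> \<Longrightarrow> H \<subseteq> carrier G" using sub subgroup.subset by auto
  have one: "H #> \<one> = H" "\<one> \<in> transporter G H H" if "H \<in> \<C>" for H
    using that sc coset_mult_one transporter_one by auto
  have tc: "g \<in> carrier G" if "g \<in> transporter G H K" for g H K using that unfolding transporter_def by auto
  note oc = orbit_comp[OF sub sub sub] and fc = fusion_comp[OF sub sub sub] and tm = transporter_mult
  have io: "(K #> g) <#> H = K #> g" "K <#> (K #> g) = K #> g"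
    if "H \<in> \<C>" "K \<in> \<C>" "g \<in> transporter G H K" for H K g
    using oc[of H H K \<one> g] oc[of H K K g \<one>] one that tc by auto
  have iF: "((K #> g) <#> centralizer G H) <#> (H <#> centralizer G H) = (K #> g) <#> centralizer G H"
     "(K <#> centralizer G K) <#> ((K #> g) <#> centralizer G H) = (K #> g) <#> centralizer G H"
    if "H \<in> \<C>" "K \<in> \<C>" "g \<in> transporter G H K" for H K g
    using fc[of H H K \<one> g] fc[of H K K g \<one>] one that tc by auto
  have car: "(K #> g) \<subseteq> carrier G" "(K #> g) <#> centralizer G H \<subseteq> carrier G"
    if "K \<in> \<C>" "g \<in> transporter G H K" for H K g
    using that sc tc r_coset_subset_G set_mult_closed centralizer_subset by metis+
  show "category (orbit_category G \<C>)"
    unfolding category_def orbit_category_def cat.simps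
  proof (intro conjI ballI)
    fix H K L f g assume a: "H \<in> \<C>" "K \<in> \<C>" "L \<in> \<C>"
      "f \<in> {K #> g |g. g \<in> transporter G H K}" "g \<in> {L #> g |g. g \<in> transporter G K L}"
    then show "g <#> f \<in> {L #> g |g. g \<in> transporter G H L}"
      using oc tm sc by (smt (verit, ccfv_SIG) mem_Collect_eq)
next
    fix x assume "x \<in> \<C>" then show "x \<in> {x #> g |g. g \<in> transporter G x x}" using one by (auto; metis)
  next
    fix H K f assume a: "H \<in> \<C>" "K \<in> \<C>" "f \<in> {K #> g |g. g \<in> transporter G H K}"
    show "f <#> H = f" using io(1)[OF a(1,2)] a(3) by blast
    show "K <#> f = f" using io(2)[OF a(1,2)] a(3) by blast
  next
    fix H K L N f g h assume a: "H \<in> \<C>" "K \<in> \<C>" "L \<in> \<C>" "N \<in> \<C>" "f \<in> {K #> g |g. g \<in> transporter G H K}" "g \<in> {L #> g |g. g \<in> transporter G K L}" "h \<in> {N #> g |g. g \<in> transporter G L N}"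
    have "f \<subseteq> carrier G" "g \<subseteq> carrier G" "h \<subseteq> carrier G"
      using car a by blast+
    then show "h <#> (g <#> f) = h <#> g <#> f" by (simp add: set_mult_assoc)
  qed
  show "category (fusion_orbit_category G \<C>)"
    unfolding category_def fusion_orbit_category_def cat.simps
  proof (intro conjI ballI)
    fix H K L f g assume a: "H \<in> \<C>" "K \<in> \<C>" "L \<in> \<C>"
      "f \<in> {(K #> g) <#> centralizer G H |g. g \<in> transporter G H K}"
      "g \<in> {(L #> g) <#> centralizer G K |g. g \<in> transporter G K L}"
    then show "g <#> f \<in> {(L #> g) <#> centralizer G H |g. g \<in> transporter G H L}"
      using fc tm sc by (smt (verit, ccfv_SIG) mem_Collect_eq)
next
    fix x assume "x \<in> \<C>" then show "x <#> centralizer G x \<in> {(x #> g) <#> centralizer G x |g. g \<in> transporter G x x}" using one by (auto; metis)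
  next
    fix H K f assume a: "H \<in> \<C>" "K \<in> \<C>" "f \<in> {(K #> g) <#> centralizer G H |g. g \<in> transporter G H K}"
    show "f <#> (H <#> centralizer G H) = f" using iF(1)[OF a(1,2)] a(3) by blast
    show "(K <#> centralizer G K) <#> f = f" using iF(2)[OF a(1,2)] a(3) by blast
  next
    fix H K L N f g h assume a: "H \<in> \<C>" "K \<in> \<C>" "L \<in> \<C>" "N \<in> \<C>" "f \<in> {(K #> g) <#> centralizer G H |g. g \<in> transporter G H K}" "g \<in> {(L #> g) <#> centralizer G K |g. g \<in> transporter G K L}" "h \<in> {(N #> g) <#> centralizer G L |g. g \<in> transporter G L N}"
    have "f \<subseteq> carrier G" "g \<subseteq> carrier G" "h \<subseteq> carrier G"
      using car a by blast+
    then show "h <#> (g <#> f) = h <#> g <#> f" by (simp add: set_mult_assoc)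
  qed
  show "is_functor (orbit_category G \<C>) (fusion_orbit_category G \<C>) (pr G)"
    unfolding is_functor_def fusion_orbit_category_def orbit_category_def pr_def cat.simps cat_functor.simps
  proof (intro conjI ballI)
    fix H K L f g assume a: "H \<in> \<C>" "K \<in> \<C>" "L \<in> \<C>"
      "f \<in> {K #> g |g. g \<in> transporter G H K}" "g \<in> {L #> g |g. g \<in> transporter G K L}"
    then show "g <#> f <#> centralizer G H = g <#> centralizer G K <#> (f <#> centralizer G H)"
      using oc fc by auto
  qed auto
qed

end

lemma cring_localization_at: "cring (localization_at p)" if "prime p"
proof -
  have p1: "\<not> int p dvd 1" using that by (auto dest: prime_gt_1_nat)
  have d: "\<not> int p dvd b * d" if "\<not> int p dvd b" "\<not> int p dvd d" for b d
    using that \<open>prime p\<close> by (metis prime_dvd_mult_iff prime_nat_int_transfer)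
  show ?thesis
  proof (rule cringI)
    show "abelian_group (localization_at p)"
    proof (rule abelian_groupI)
      fix x y assume "x \<in> carrier (localization_at p)" "y \<in> carrier (localization_at p)"
      then obtain a b c e where *: "x = of_int a / of_int b" "y = of_int c / of_int e"
        "\<not> int p dvd b" "\<not> int p dvd e" unfolding localization_at_def by auto
      then have "b \<noteq> 0" "e \<noteq> 0" by auto
      then have "x + y = of_int (a*e + c*b) / of_int (b*e)" using * by (simp add: field_simps)
      then show "x \<oplus>\<^bsub>localization_at p\<^esub> y \<in> carrier (localization_at p)"
        using d[OF *(3,4)] unfolding localization_at_def by (auto simp del: of_int_add of_int_mult)
    next
      show "\<zero>\<^bsub>localization_at p\<^esub> \<in> carrier (localization_at p)"
        using p1 unfolding localization_at_def partial_object.simps monoid.simps ring.simps mem_Collect_eq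
        by (intro exI[of _ 0] exI[of _ 1]) simp
    next
      fix x assume "x \<in> carrier (localization_at p)"
      then obtain a b where *: "x = of_int a / of_int b" "\<not> int p dvd b" unfolding localization_at_def by auto
      then have "- x = of_int (-a) / of_int b" by simp
      with * have "-x \<in> carrier (localization_at p)" unfolding localization_at_def by (auto simp del: of_int_minus)
      then show "\<exists>y\<in>carrier (localization_at p). y \<oplus>\<^bsub>localization_at p\<^esub> x = \<zero>\<^bsub>localization_at p\<^esub>"
        by (rule bexI[rotated]) (simp add: localization_at_def)
    qed (auto simp: localization_at_def)
  next
    show "comm_monoid (localization_at p)"
    proof (rule comm_monoidI)
      fix x y assume "x \<in> carrier (localization_at p)" "y \<in> carrier (localization_at p)"
      then obtain a b c e where *: "x = of_int a / of_int b" "y = of_int c / of_int e"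
        "\<not> int p dvd b" "\<not> int p dvd e" unfolding localization_at_def by auto
      then have "x * y = of_int (a*c) / of_int (b*e)" by simp
      then show "x \<otimes>\<^bsub>localization_at p\<^esub> y \<in> carrier (localization_at p)"
        using d[OF *(3,4)] unfolding localization_at_def by (auto simp del: of_int_mult)
    next
      show "\<one>\<^bsub>localization_at p\<^esub> \<in> carrier (localization_at p)"
        using p1 unfolding localization_at_def partial_object.simps monoid.simps ring.simps mem_Collect_eq
        by (intro exI[of _ 1]) simp
    qed (auto simp: localization_at_def)
  qed (auto simp: localization_at_def algebra_simps)
qed

end

theory Submission
  imports Defs "HOL-Algebra.Sylow"
begin

text \<open>The left Kan extension along \<open>pr\<close> sends a module \<open>N\<close> over the orbit category to the
  module \<open>H \<mapsto> N(H)\<^sub>C\<close> of coinvariants under \<open>C = C\<^sub>G(H)\<close>, so the theorem follows once the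
  coinvariants of a projective resolution \<open>Q\<close> of the constant module are still exact.  Let \<open>S\<close> be a
  Sylow \<open>p\<close>-subgroup of \<open>C\<close>.  Then \<open>K = HS\<close> is a \<open>p\<close>-overgroup of \<open>H\<close>, and all groups
  between \<open>H\<close> and \<open>K\<close> belong to the collection.  They form a category with morphisms from \<open>K\<close> and
  terminal object \<open>K\<close>, to which representable functors restrict as sums of representable ones.
  Hence \<open>Q\<close> restricts to a projective resolution of the constant module, which is itself
  projective because of the terminal object, so the restriction has a natural contracting homotopy.
  At \<open>H\<close> it is \<open>S\<close>-equivariant, and averaging it over \<open>S\<close>-cosets in \<open>C\<close>, whose number is
  invertible, shows that the coinvariants are exact.\<close>

section \<open>Linear maps and free modules\<close>

text \<open>\<open>projective\<close> tests lifting on modules of fixed types, whereas Lan Q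
  consists of cosets. Therefore lifts start only from the given P and Q:
  \<open>projective_lift\<close> converts projectivity into a section of a free cover, and lifts
  directly from restrictions along functors whose pulled back representables decompose. Instead of
  an equivalence between projective resolutions there is \<psi> : P -> Lan Q with one homotopy out
  of P and one out of Q; the latter suffices because maps Lan Q -> M are the same as maps Q -> Res
  M.

  Coinvariants are right exact and C acts trivially on constants, so only positive degrees are at
  stake. Averaging over all of C would divide by |C|, which p may divide. The p-part S is treated by
  naturality instead: S lies in K, so its elements give endomorphisms of H in the category of
  intermediate groups. All intermediate groups serve as objects, not just H and K, because a double
  coset X \<gamma> K contributes the functor represented by the intersection of K with \<gamma>^-1 X
  \<gamma>.\<close>

lemma lin_mapsI:
  assumes "\<And>x. x \<in> carrier M \<Longrightarrow> h x \<in> carrier N"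
    and "\<And>x y. x \<in> carrier M \<Longrightarrow> y \<in> carrier M \<Longrightarrow> h (x \<oplus>\<^bsub>M\<^esub> y) = h x \<oplus>\<^bsub>N\<^esub> h y"
    and "\<And>r x. r \<in> carrier R \<Longrightarrow> x \<in> carrier M \<Longrightarrow> h (r \<odot>\<^bsub>M\<^esub> x) = r \<odot>\<^bsub>N\<^esub> h x"
  shows "h \<in> lin_maps R M N"
  using assms by (auto simp: lin_maps_def)

lemma lin_maps_closed: "h \<in> lin_maps R M N \<Longrightarrow> x \<in> carrier M \<Longrightarrow> h x \<in> carrier N"
  and lin_maps_add: "h \<in> lin_maps R M N \<Longrightarrow> x \<in> carrier M \<Longrightarrow> y \<in> carrier M \<Longrightarrow>
    h (x \<oplus>\<^bsub>M\<^esub> y) = h x \<oplus>\<^bsub>N\<^esub> h y"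
  and lin_maps_smult: "h \<in> lin_maps R M N \<Longrightarrow> r \<in> carrier R \<Longrightarrow> x \<in> carrier M \<Longrightarrow>
    h (r \<odot>\<^bsub>M\<^esub> x) = r \<odot>\<^bsub>N\<^esub> h x"
  by (auto simp: lin_maps_def)

lemma module_ag: "module R M \<Longrightarrow> abelian_group M"
  by (simp add: module_def)

lemma module_cring: "module R M \<Longrightarrow> cring R"
  by (simp add: module_def)

lemma lin_maps_zero:
  assumes "module R M" "module R N" "h \<in> lin_maps R M N"
  shows "h \<zero>\<^bsub>M\<^esub> = \<zero>\<^bsub>N\<^esub>"
proof -
  interpret M: module R M by fact
  interpret N: module R N by fact
  have "h (\<zero>\<^bsub>R\<^esub> \<odot>\<^bsub>M\<^esub> \<zero>\<^bsub>M\<^esub>) = \<zero>\<^bsub>R\<^esub> \<odot>\<^bsub>N\<^esub> h \<zero>\<^bsub>M\<^esub>"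
    by (rule lin_maps_smult[OF assms(3)]) auto
  then show ?thesis using lin_maps_closed[OF assms(3) M.M.zero_closed] by simp
qed

lemma (in module) smult_minus_one: "x \<in> carrier M \<Longrightarrow> (\<ominus> \<one>) \<odot>\<^bsub>M\<^esub> x = \<ominus>\<^bsub>M\<^esub> x"
  by (simp add: smult_l_minus)

lemma lin_maps_uminus:
  assumes "module R M" "module R N" "h \<in> lin_maps R M N" "x \<in> carrier M"
  shows "h (\<ominus>\<^bsub>M\<^esub> x) = \<ominus>\<^bsub>N\<^esub> h x"
proof -
  interpret M: module R M by fact
  interpret N: module R N by fact
  show ?thesis
    using lin_maps_smult[OF assms(3) _ assms(4), of "\<ominus>\<^bsub>R\<^esub> \<one>\<^bsub>R\<^esub>"] assms lin_maps_closed[OF assms(3,4)]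
    by (simp add: M.smult_minus_one N.smult_minus_one)
qed

lemma lin_maps_diff:
  assumes "module R M" "module R N" "h \<in> lin_maps R M N" "x \<in> carrier M" "y \<in> carrier M"
  shows "h (x \<ominus>\<^bsub>M\<^esub> y) = h x \<ominus>\<^bsub>N\<^esub> h y"
proof -
  interpret M: module R M by fact
  interpret N: module R N by fact
  show ?thesis
    using assms by (simp add: a_minus_def lin_maps_add lin_maps_uminus)
qed

lemma lin_maps_comp:
  "h \<in> lin_maps R M N \<Longrightarrow> k \<in> lin_maps R N L \<Longrightarrow> (\<lambda>x. k (h x)) \<in> lin_maps R M L"
  by (auto simp: lin_maps_def Pi_iff)

lemma lin_maps_id: "(\<lambda>x. x) \<in> lin_maps R M M"
  by (auto simp: lin_maps_def)

lemma (in abelian_group) minus_eq_zero_iff: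
  assumes "x \<in> carrier G" "y \<in> carrier G"
  shows "x \<ominus> y = \<zero> \<longleftrightarrow> x = y"
  using assms by (metis a_assoc a_inv_closed a_minus_def l_neg l_zero r_neg r_zero)

lemma (in module) minus_add_minus:
  assumes "a \<in> carrier M" "b \<in> carrier M" "c \<in> carrier M" "d \<in> carrier M"
  shows "(a \<oplus>\<^bsub>M\<^esub> b) \<ominus>\<^bsub>M\<^esub> (c \<oplus>\<^bsub>M\<^esub> d) = (a \<ominus>\<^bsub>M\<^esub> c) \<oplus>\<^bsub>M\<^esub> (b \<ominus>\<^bsub>M\<^esub> d)"
  using assms by (simp add: a_minus_def M.minus_add M.a_ac)

lemma (in module) smult_diff:
  assumes "r \<in> carrier R" "a \<in> carrier M" "b \<in> carrier M"
  shows "r \<odot>\<^bsub>M\<^esub> (a \<ominus>\<^bsub>M\<^esub> b) = r \<odot>\<^bsub>M\<^esub> a \<ominus>\<^bsub>M\<^esub> r \<odot>\<^bsub>M\<^esub> b"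
  using assms by (simp add: a_minus_def smult_r_distr smult_r_minus)

lemma lin_maps_minus:
  assumes "module R N" "h \<in> lin_maps R M N" "k \<in> lin_maps R M N"
  shows "(\<lambda>x. h x \<ominus>\<^bsub>N\<^esub> k x) \<in> lin_maps R M N"
proof -
  interpret N: module R N by fact
  show ?thesis
    using assms(2,3)
    by (intro lin_mapsI)
      (auto simp: lin_maps_closed lin_maps_add lin_maps_smult N.minus_add_minus N.smult_diff)
qed

lemma lin_maps_finsum:
  assumes "module R M" "module R N" "h \<in> lin_maps R M N" "finite A" "f \<in> A \<rightarrow> carrier M"
  shows "h (\<Oplus>\<^bsub>M\<^esub>t\<in>A. f t) = (\<Oplus>\<^bsub>N\<^esub>t\<in>A. h (f t))"
proof -
  interpret M: module R M by fact
  interpret N: module R N by fact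
  note c = lin_maps_closed[OF assms(3)]
  show ?thesis using assms(4,5)
  proof (induction A rule: finite_induct)
    case empty
    then show ?case using lin_maps_zero[OF assms(1-3)] by simp
  next
    case (insert x A)
    then show ?case using lin_maps_add[OF assms(3)] c
      by (simp add: Pi_iff)
  qed
qed

text \<open>Finitely supported functions on the whole type that vanish off T, rather than functions
  on T: modules for different T then share a type, and for triples (y, f, a) it is the type of the
  test modules in \<open>projective\<close>.\<close>

definition free_module :: "'r ring \<Rightarrow> 't set \<Rightarrow> ('r, 't \<Rightarrow> 'r) module" where
  "free_module R T =
     \<lparr>carrier = {c. (\<forall>t. c t \<in> carrier R) \<and> finite {t. c t \<noteq> \<zero>\<^bsub>R\<^esub>} \<and> {t. c t \<noteq> \<zero>\<^bsub>R\<^esub>} \<subseteq> T},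
      monoid.mult = undefined, one = undefined, zero = (\<lambda>t. \<zero>\<^bsub>R\<^esub>),
      add = (\<lambda>c d t. c t \<oplus>\<^bsub>R\<^esub> d t), smult = (\<lambda>r c t. r \<otimes>\<^bsub>R\<^esub> c t)\<rparr>"

definition basis_vec :: "'r ring \<Rightarrow> 't \<Rightarrow> 't \<Rightarrow> 'r" where
  "basis_vec R t = (\<lambda>u. if u = t then \<one>\<^bsub>R\<^esub> else \<zero>\<^bsub>R\<^esub>)"

text \<open>The linear extension of t \<mapsto> v t. Summing over the support keeps the sum finite
  on \<open>free_module\<close> even for infinite T.\<close>

definition lincomb :: "'r ring \<Rightarrow> ('r, 'a) module \<Rightarrow> ('t \<Rightarrow> 'a) \<Rightarrow> ('t \<Rightarrow> 'r) \<Rightarrow> 'a" where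
  "lincomb R M v c = (\<Oplus>\<^bsub>M\<^esub>t\<in>{t. c t \<noteq> \<zero>\<^bsub>R\<^esub>}. c t \<odot>\<^bsub>M\<^esub> v t)"

lemma module_free_module:
  assumes "cring R"
  shows "module R (free_module R T)"
proof -
  interpret R: cring R by fact
  have fin: "finite {t. c t \<oplus>\<^bsub>R\<^esub> d t \<noteq> \<zero>\<^bsub>R\<^esub>}" "{t. c t \<oplus>\<^bsub>R\<^esub> d t \<noteq> \<zero>\<^bsub>R\<^esub>} \<subseteq> T"
    if "c \<in> carrier (free_module R T)" "d \<in> carrier (free_module R T)" for c d
  proof -
    have s: "{t. c t \<oplus>\<^bsub>R\<^esub> d t \<noteq> \<zero>\<^bsub>R\<^esub>} \<subseteq> {t. c t \<noteq> \<zero>\<^bsub>R\<^esub>} \<union> {t. d t \<noteq> \<zero>\<^bsub>R\<^esub>}" by auto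
    with that show "finite {t. c t \<oplus>\<^bsub>R\<^esub> d t \<noteq> \<zero>\<^bsub>R\<^esub>}"
      by (auto simp: free_module_def intro: finite_subset)
    show "{t. c t \<oplus>\<^bsub>R\<^esub> d t \<noteq> \<zero>\<^bsub>R\<^esub>} \<subseteq> T"
    proof -
      have "{t. c t \<noteq> \<zero>\<^bsub>R\<^esub>} \<subseteq> T" "{t. d t \<noteq> \<zero>\<^bsub>R\<^esub>} \<subseteq> T"
        using that by (simp_all add: free_module_def)
      then show ?thesis using s by blast
    qed
  qed
  have fin2: "finite {t. r \<otimes>\<^bsub>R\<^esub> c t \<noteq> \<zero>\<^bsub>R\<^esub>}" "{t. r \<otimes>\<^bsub>R\<^esub> c t \<noteq> \<zero>\<^bsub>R\<^esub>} \<subseteq> T"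
    if "r \<in> carrier R" "c \<in> carrier (free_module R T)" for r c
  proof -
    have s: "{t. r \<otimes>\<^bsub>R\<^esub> c t \<noteq> \<zero>\<^bsub>R\<^esub>} \<subseteq> {t. c t \<noteq> \<zero>\<^bsub>R\<^esub>}" using that by auto
    with that show "finite {t. r \<otimes>\<^bsub>R\<^esub> c t \<noteq> \<zero>\<^bsub>R\<^esub>}"
      by (auto simp: free_module_def intro: finite_subset)
    show "{t. r \<otimes>\<^bsub>R\<^esub> c t \<noteq> \<zero>\<^bsub>R\<^esub>} \<subseteq> T"
    proof -
      have "{t. c t \<noteq> \<zero>\<^bsub>R\<^esub>} \<subseteq> T" using that by (simp add: free_module_def)
      then show ?thesis using s by blast
    qed
  qed
  show ?thesis
  proof (rule moduleI)
    show "abelian_group (free_module R T)"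
    proof (rule abelian_groupI)
      fix c d assume "c \<in> carrier (free_module R T)" "d \<in> carrier (free_module R T)"
      then show "c \<oplus>\<^bsub>free_module R T\<^esub> d \<in> carrier (free_module R T)"
        using fin[of c d] by (auto simp: free_module_def)
    next
      fix c assume c: "c \<in> carrier (free_module R T)"
      then have "(\<lambda>t. \<ominus>\<^bsub>R\<^esub> c t) \<in> carrier (free_module R T)"
        by (auto simp: free_module_def)
      then show "\<exists>d\<in>carrier (free_module R T). d \<oplus>\<^bsub>free_module R T\<^esub> c = \<zero>\<^bsub>free_module R T\<^esub>"
        by (rule bexI[rotated]) (use c in \<open>auto simp: free_module_def R.l_neg\<close>)
    qed (auto simp: free_module_def R.a_ac)
  next
    fix r c assume "r \<in> carrier R" "c \<in> carrier (free_module R T)"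
    then show "r \<odot>\<^bsub>free_module R T\<^esub> c \<in> carrier (free_module R T)"
      using fin2[of r c] by (auto simp: free_module_def)
  qed (auto simp: free_module_def assms R.l_distr R.r_distr R.m_assoc)
qed

lemma basis_vec_closed: "cring R \<Longrightarrow> t \<in> T \<Longrightarrow> basis_vec R t \<in> carrier (free_module R T)"
  by (auto simp: free_module_def basis_vec_def cring_def ring.ring_simprules)

text \<open>Induction over a finite set containing the support: an element splits into a multiple of
  one basis vector and an element with that coordinate set to zero.\<close>

lemma free_module_lin_ext:
  assumes "module R M" "h \<in> lin_maps R (free_module R T) M" "k \<in> lin_maps R (free_module R T) M"
    and "\<And>t. t \<in> T \<Longrightarrow> h (basis_vec R t) = k (basis_vec R t)"
    and "c \<in> carrier (free_module R T)"
  shows "h c = k c"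
proof -
  interpret M: module R M by fact
  have cr: "cring R" by (rule module_cring[OF assms(1)])
  note F = module_free_module[OF cr, of T]
  have "h c = k c"
    if "finite S" "S \<subseteq> T" "c \<in> carrier (free_module R T)" "{t. c t \<noteq> \<zero>\<^bsub>R\<^esub>} \<subseteq> S" for S c
    using that
  proof (induction S arbitrary: c rule: finite_induct)
    case empty
    then have "c = \<zero>\<^bsub>free_module R T\<^esub>" by (auto simp: free_module_def)
    then show ?case
      using lin_maps_zero[OF F assms(1,2)] lin_maps_zero[OF F assms(1,3)] by simp
  next
    case (insert t S)
    define d where "d = c(t := \<zero>\<^bsub>R\<^esub>)"
    have sub: "{t. d t \<noteq> \<zero>\<^bsub>R\<^esub>} \<subseteq> {t. c t \<noteq> \<zero>\<^bsub>R\<^esub>}" by (auto simp: d_def)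
    have d: "d \<in> carrier (free_module R T)"
      using insert.prems finite_subset[OF sub] sub by (auto simp: free_module_def d_def)
    have ds: "{t. d t \<noteq> \<zero>\<^bsub>R\<^esub>} \<subseteq> S" using insert.prems by (auto simp: d_def)
    have ct: "c t \<in> carrier R" using insert.prems by (auto simp: free_module_def)
    have b: "basis_vec R t \<in> carrier (free_module R T)"
      using insert.prems by (intro basis_vec_closed cr) auto
    have bc: "c t \<odot>\<^bsub>free_module R T\<^esub> basis_vec R t \<in> carrier (free_module R T)"
      by (rule module.smult_closed[OF F ct b])
    have e: "c = d \<oplus>\<^bsub>free_module R T\<^esub> (c t \<odot>\<^bsub>free_module R T\<^esub> basis_vec R t)"
      using insert.prems by (auto simp: free_module_def d_def basis_vec_def fun_eq_iff)
    have "h d = k d" using insert ds d by auto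
    then show ?case
      using lin_maps_add[OF assms(2) d bc] lin_maps_add[OF assms(3) d bc]
        lin_maps_smult[OF assms(2) ct b] lin_maps_smult[OF assms(3) ct b] assms(4)[of t] insert.prems e
      by simp
  qed
  from this[OF _ _ assms(5) order_refl] show ?thesis
    using assms(5) by (auto simp: free_module_def)
qed

text \<open>Allows vectors with different supports to be summed over one common finite set, which is
  how \<open>lincomb_lin\<close> compares c, d and c + d.\<close>

lemma lincomb_superset:
  assumes "module R M" "\<And>t. c t \<in> carrier R" "v \<in> S \<rightarrow> carrier M" "finite S" "{t. c t \<noteq> \<zero>\<^bsub>R\<^esub>} \<subseteq> S"
  shows "lincomb R M v c = (\<Oplus>\<^bsub>M\<^esub>t\<in>S. c t \<odot>\<^bsub>M\<^esub> v t)"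
proof -
  interpret M: module R M by fact
  show ?thesis unfolding lincomb_def
    using assms by (intro M.add.finprod_mono_neutral_cong_left) (auto simp: Pi_iff)
qed

lemma lincomb_basis_vec:
  assumes "module R M" "v t \<in> carrier M"
  shows "lincomb R M v (basis_vec R t) = v t"
proof -
  interpret M: module R M by fact
  show ?thesis
    using assms by (subst lincomb_superset[of _ _ _ _ "{t}"]) (auto simp: basis_vec_def Pi_iff)
qed

lemma lincomb_lin:
  assumes "module R M" "v \<in> T \<rightarrow> carrier M"
  shows "lincomb R M v \<in> lin_maps R (free_module R T) M"
proof -
  interpret M: module R M by fact
  interpret F: module R "free_module R T" using module_free_module M.R.is_cring by blast
  show ?thesis
  proof (rule lin_mapsI)
    fix c assume "c \<in> carrier (free_module R T)"
    then show "lincomb R M v c \<in> carrier M"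
      using assms unfolding lincomb_def by (auto simp: free_module_def intro!: M.finsum_closed)
  next
    fix c d assume c: "c \<in> carrier (free_module R T)" and d: "d \<in> carrier (free_module R T)"
    define S where "S = {t. c t \<noteq> \<zero>\<^bsub>R\<^esub>} \<union> {t. d t \<noteq> \<zero>\<^bsub>R\<^esub>}"
    have S: "finite S" "S \<subseteq> T" "\<And>t. c t \<in> carrier R" "\<And>t. d t \<in> carrier R"
      using c d by (auto simp: S_def free_module_def)
    have v: "v \<in> S \<rightarrow> carrier M" using assms S by auto
    have "lincomb R M v c = (\<Oplus>\<^bsub>M\<^esub>t\<in>S. c t \<odot>\<^bsub>M\<^esub> v t)"
      "lincomb R M v d = (\<Oplus>\<^bsub>M\<^esub>t\<in>S. d t \<odot>\<^bsub>M\<^esub> v t)"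
      "lincomb R M v (c \<oplus>\<^bsub>free_module R T\<^esub> d) = (\<Oplus>\<^bsub>M\<^esub>t\<in>S. (c t \<oplus>\<^bsub>R\<^esub> d t) \<odot>\<^bsub>M\<^esub> v t)"
      using S v by (subst lincomb_superset[OF assms(1), of _ _ S]; auto simp: S_def free_module_def)+
    moreover have "(\<Oplus>\<^bsub>M\<^esub>t\<in>S. (c t \<oplus>\<^bsub>R\<^esub> d t) \<odot>\<^bsub>M\<^esub> v t)
        = (\<Oplus>\<^bsub>M\<^esub>t\<in>S. c t \<odot>\<^bsub>M\<^esub> v t \<oplus>\<^bsub>M\<^esub> d t \<odot>\<^bsub>M\<^esub> v t)"
      using S v by (intro M.finsum_cong') (auto simp: M.smult_l_distr Pi_iff)
    ultimately show "lincomb R M v (c \<oplus>\<^bsub>free_module R T\<^esub> d) = lincomb R M v c \<oplus>\<^bsub>M\<^esub> lincomb R M v d"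
      using S v by (auto simp: Pi_iff intro!: M.finsum_addf)
  next
    fix r c assume r: "r \<in> carrier R" and c: "c \<in> carrier (free_module R T)"
    define S where "S = {t. c t \<noteq> \<zero>\<^bsub>R\<^esub>}"
    have S: "finite S" "S \<subseteq> T" "\<And>t. c t \<in> carrier R"
      using c by (auto simp: S_def free_module_def)
    have v: "v \<in> S \<rightarrow> carrier M" using assms S by auto
    have "lincomb R M v c = (\<Oplus>\<^bsub>M\<^esub>t\<in>S. c t \<odot>\<^bsub>M\<^esub> v t)" by (simp add: lincomb_def S_def)
    moreover have "lincomb R M v (r \<odot>\<^bsub>free_module R T\<^esub> c) = (\<Oplus>\<^bsub>M\<^esub>t\<in>S. (r \<otimes>\<^bsub>R\<^esub> c t) \<odot>\<^bsub>M\<^esub> v t)"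
      using S v r by (subst lincomb_superset[OF assms(1), of _ _ S]) (auto simp: S_def free_module_def)
    moreover have "(\<Oplus>\<^bsub>M\<^esub>t\<in>S. (r \<otimes>\<^bsub>R\<^esub> c t) \<odot>\<^bsub>M\<^esub> v t) = (\<Oplus>\<^bsub>M\<^esub>t\<in>S. r \<odot>\<^bsub>M\<^esub> (c t \<odot>\<^bsub>M\<^esub> v t))"
      using S v r by (intro M.finsum_cong') (auto simp: M.smult_assoc1 Pi_iff)
    ultimately show "lincomb R M v (r \<odot>\<^bsub>free_module R T\<^esub> c) = r \<odot>\<^bsub>M\<^esub> lincomb R M v c"
      using S v r by (simp add: M.finsum_smult_ldistr Pi_iff)
  qed
qed

section \<open>Quotient modules\<close>

definition quot_proj :: "('r, 'a) module \<Rightarrow> 'a set \<Rightarrow> 'a \<Rightarrow> 'a set" where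
  "quot_proj M B x = B +>\<^bsub>M\<^esub> x"

locale module_quotient = module R M for R :: "'r ring" and M :: "('r, 'a) module" +
  fixes B assumes B: "submodule B R M"
begin

lemma abelian_subgroup_submodule: "abelian_subgroup B M"
proof -
  have "additive_subgroup B M" using B by (simp add: additive_subgroup_def submodule_def)
  then show ?thesis by (intro abelian_subgroupI3 M.abelian_group_axioms)
qed

lemma quot_carrier: "carrier (quot_module M B) = quot_proj M B ` carrier M"
  by (auto simp: quot_module_def quot_proj_def A_RCOSETS_def')

lemma quot_proj_eq_iff:
  assumes "x \<in> carrier M" "y \<in> carrier M"
  shows "quot_proj M B x = quot_proj M B y \<longleftrightarrow> x \<ominus>\<^bsub>M\<^esub> y \<in> B"
proof -
  interpret B: abelian_subgroup B M by (rule abelian_subgroup_submodule)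
  have "x \<ominus>\<^bsub>M\<^esub> y \<in> B \<longleftrightarrow> x \<in> B +>\<^bsub>M\<^esub> y"
    using B.a_rcos_module[OF assms(2,1)] by (simp add: a_minus_def)
  then show ?thesis
    using B.a_rcos_self[OF assms(1)] M.a_repr_independence[OF _ assms(2) B.a_subgroup]
    unfolding quot_proj_def by metis
qed

lemma quot_proj_add:
  assumes "x \<in> carrier M" "y \<in> carrier M"
  shows "quot_proj M B (x \<oplus>\<^bsub>M\<^esub> y) = quot_proj M B x \<oplus>\<^bsub>quot_module M B\<^esub> quot_proj M B y"
proof -
  interpret B: abelian_subgroup B M by (rule abelian_subgroup_submodule)
  show ?thesis using assms by (simp add: quot_proj_def quot_module_def B.a_rcos_sum)
qed

text \<open>The products r y with y in B + x need not fill a coset; the summand B in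
  \<open>smult\<close> of \<open>quot_module\<close> completes it. One inclusion takes y = x, the
  other absorbs r c into B for c in B.\<close>

lemma quot_proj_smult:
  assumes "r \<in> carrier R" "x \<in> carrier M"
  shows "quot_proj M B (r \<odot>\<^bsub>M\<^esub> x) = r \<odot>\<^bsub>quot_module M B\<^esub> quot_proj M B x"
proof -
  interpret B: abelian_subgroup B M by (rule abelian_subgroup_submodule)
  note E = submoduleE[OF B]
  show ?thesis
  proof (intro equalityI subsetI)
    fix u assume "u \<in> quot_proj M B (r \<odot>\<^bsub>M\<^esub> x)"
    then obtain b where b: "b \<in> B" "u = b \<oplus>\<^bsub>M\<^esub> r \<odot>\<^bsub>M\<^esub> x"
      by (auto simp: quot_proj_def a_r_coset_def')
    have "x = \<zero>\<^bsub>M\<^esub> \<oplus>\<^bsub>M\<^esub> x" "\<zero>\<^bsub>M\<^esub> \<in> B" using assms B.zero_closed by auto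
    then have "x \<in> quot_proj M B x" unfolding quot_proj_def a_r_coset_def' by blast
    with b show "u \<in> r \<odot>\<^bsub>quot_module M B\<^esub> quot_proj M B x"
      by (auto simp: quot_module_def set_add_def')
  next
    fix u assume "u \<in> r \<odot>\<^bsub>quot_module M B\<^esub> quot_proj M B x"
    then obtain b c where b: "b \<in> B" "c \<in> B" "u = b \<oplus>\<^bsub>M\<^esub> r \<odot>\<^bsub>M\<^esub> (c \<oplus>\<^bsub>M\<^esub> x)"
      by (auto simp: quot_module_def set_add_def' quot_proj_def a_r_coset_def')
    then have "u = (b \<oplus>\<^bsub>M\<^esub> r \<odot>\<^bsub>M\<^esub> c) \<oplus>\<^bsub>M\<^esub> r \<odot>\<^bsub>M\<^esub> x"
      using E(1) assms by (auto simp: smult_r_distr M.a_assoc subset_iff)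
    moreover have "b \<oplus>\<^bsub>M\<^esub> r \<odot>\<^bsub>M\<^esub> c \<in> B" using b assms E by auto
    ultimately show "u \<in> quot_proj M B (r \<odot>\<^bsub>M\<^esub> x)"
      by (auto simp: quot_proj_def a_r_coset_def')
  qed
qed

lemma quot_zero: "\<zero>\<^bsub>quot_module M B\<^esub> = quot_proj M B \<zero>\<^bsub>M\<^esub>"
proof -
  interpret B: abelian_subgroup B M by (rule abelian_subgroup_submodule)
  show ?thesis using submoduleE(1)[OF B] by (simp add: quot_module_def quot_proj_def)
qed

lemma quot_proj_zero_iff: "x \<in> carrier M \<Longrightarrow> quot_proj M B x = \<zero>\<^bsub>quot_module M B\<^esub> \<longleftrightarrow> x \<in> B"
  using quot_proj_eq_iff[of x "\<zero>\<^bsub>M\<^esub>"] M.zero_closed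
  by (metis quot_zero a_minus_def M.r_neg M.l_zero M.r_zero M.a_inv_closed)

lemma quot_proj_lin: "quot_proj M B \<in> lin_maps R M (quot_module M B)"
  by (rule lin_mapsI) (auto simp: quot_carrier quot_proj_add quot_proj_smult)

lemma module_quot_module: "module R (quot_module M B)"
proof (rule moduleI)
  show "abelian_group (quot_module M B)"
  proof (rule abelian_groupI)
    fix U assume "U \<in> carrier (quot_module M B)"
    then obtain x where "x \<in> carrier M" "U = quot_proj M B x" by (auto simp: quot_carrier)
    then have "quot_proj M B (\<ominus>\<^bsub>M\<^esub> x) \<oplus>\<^bsub>quot_module M B\<^esub> U = \<zero>\<^bsub>quot_module M B\<^esub>"
      by (simp add: quot_zero M.l_neg flip: quot_proj_add)
    then show "\<exists>V\<in>carrier (quot_module M B). V \<oplus>\<^bsub>quot_module M B\<^esub> U = \<zero>\<^bsub>quot_module M B\<^esub>"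
      using \<open>x \<in> carrier M\<close> by (auto simp: quot_carrier)
  qed (auto simp: quot_carrier quot_zero M.a_ac simp flip: quot_proj_add)
qed (auto simp: quot_carrier R.is_cring smult_l_distr smult_r_distr smult_assoc1
      simp flip: quot_proj_add quot_proj_smult)

end

section \<open>Lifting out of restrictions of projective modules\<close>

lemma category_Idn: "category C \<Longrightarrow> x \<in> Ob C \<Longrightarrow> Idn C x \<in> Hom C x x"
  and category_Cmp: "category C \<Longrightarrow> x \<in> Ob C \<Longrightarrow> y \<in> Ob C \<Longrightarrow> z \<in> Ob C \<Longrightarrow>
    f \<in> Hom C x y \<Longrightarrow> g \<in> Hom C y z \<Longrightarrow> Cmp C g f \<in> Hom C x z"
  and category_Idn_right: "category C \<Longrightarrow> x \<in> Ob C \<Longrightarrow> y \<in> Ob C \<Longrightarrow> f \<in> Hom C x y \<Longrightarrow>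
    Cmp C f (Idn C x) = f"
  and category_Idn_left: "category C \<Longrightarrow> x \<in> Ob C \<Longrightarrow> y \<in> Ob C \<Longrightarrow> f \<in> Hom C x y \<Longrightarrow>
    Cmp C (Idn C y) f = f"
  and category_assoc: "category C \<Longrightarrow> w \<in> Ob C \<Longrightarrow> x \<in> Ob C \<Longrightarrow> y \<in> Ob C \<Longrightarrow> z \<in> Ob C \<Longrightarrow>
    f \<in> Hom C w x \<Longrightarrow> g \<in> Hom C x y \<Longrightarrow> h \<in> Hom C y z \<Longrightarrow>
    Cmp C h (Cmp C g f) = Cmp C (Cmp C h g) f"
  by (auto simp: category_def)

lemma functor_ob: "is_functor C D F \<Longrightarrow> x \<in> Ob C \<Longrightarrow> fun_ob F x \<in> Ob D"
  and functor_Idn: "is_functor C D F \<Longrightarrow> x \<in> Ob C \<Longrightarrow> fun_mor F x x (Idn C x) = Idn D (fun_ob F x)"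
  and functor_mor: "is_functor C D F \<Longrightarrow> x \<in> Ob C \<Longrightarrow> y \<in> Ob C \<Longrightarrow> f \<in> Hom C x y \<Longrightarrow>
    fun_mor F x y f \<in> Hom D (fun_ob F x) (fun_ob F y)"
  and functor_Cmp: "is_functor C D F \<Longrightarrow> x \<in> Ob C \<Longrightarrow> y \<in> Ob C \<Longrightarrow> z \<in> Ob C \<Longrightarrow>
    f \<in> Hom C x y \<Longrightarrow> g \<in> Hom C y z \<Longrightarrow>
    fun_mor F x z (Cmp C g f) = Cmp D (fun_mor F y z g) (fun_mor F x y f)"
  by (auto simp: is_functor_def)

lemma cat_module_at: "is_cat_module R C M \<Longrightarrow> x \<in> Ob C \<Longrightarrow> module R (mod_at M x)"
  and cat_module_lin: "is_cat_module R C M \<Longrightarrow> x \<in> Ob C \<Longrightarrow> y \<in> Ob C \<Longrightarrow> f \<in> Hom C x y \<Longrightarrow>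
    mod_map M x y f \<in> lin_maps R (mod_at M y) (mod_at M x)"
  and cat_module_Idn: "is_cat_module R C M \<Longrightarrow> x \<in> Ob C \<Longrightarrow> a \<in> carrier (mod_at M x) \<Longrightarrow>
    mod_map M x x (Idn C x) a = a"
  and cat_module_Cmp: "is_cat_module R C M \<Longrightarrow> x \<in> Ob C \<Longrightarrow> y \<in> Ob C \<Longrightarrow> z \<in> Ob C \<Longrightarrow>
    f \<in> Hom C x y \<Longrightarrow> g \<in> Hom C y z \<Longrightarrow> a \<in> carrier (mod_at M z) \<Longrightarrow>
    mod_map M x z (Cmp C g f) a = mod_map M x y f (mod_map M y z g a)"
  by (auto simp: is_cat_module_def)

lemma cat_module_closed: "is_cat_module R C M \<Longrightarrow> x \<in> Ob C \<Longrightarrow> y \<in> Ob C \<Longrightarrow> f \<in> Hom C x y \<Longrightarrow>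
    a \<in> carrier (mod_at M y) \<Longrightarrow> mod_map M x y f a \<in> carrier (mod_at M x)"
  by (rule lin_maps_closed[OF cat_module_lin])

lemma nat_trans_lin: "\<eta> \<in> nat_trans R C M N \<Longrightarrow> x \<in> Ob C \<Longrightarrow>
    \<eta> x \<in> lin_maps R (mod_at M x) (mod_at N x)"
  and nat_trans_nat: "\<eta> \<in> nat_trans R C M N \<Longrightarrow> x \<in> Ob C \<Longrightarrow> y \<in> Ob C \<Longrightarrow> f \<in> Hom C x y \<Longrightarrow>
    a \<in> carrier (mod_at M y) \<Longrightarrow> \<eta> x (mod_map M x y f a) = mod_map N x y f (\<eta> y a)"
  by (auto simp: nat_trans_def)

lemma nat_trans_closed: "\<eta> \<in> nat_trans R C M N \<Longrightarrow> x \<in> Ob C \<Longrightarrow> a \<in> carrier (mod_at M x) \<Longrightarrow>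
    \<eta> x a \<in> carrier (mod_at N x)"
  by (rule lin_maps_closed[OF nat_trans_lin])

lemma nat_transI:
  assumes "\<And>x. x \<in> Ob C \<Longrightarrow> \<eta> x \<in> lin_maps R (mod_at M x) (mod_at N x)"
    and "\<And>x y f a. x \<in> Ob C \<Longrightarrow> y \<in> Ob C \<Longrightarrow> f \<in> Hom C x y \<Longrightarrow> a \<in> carrier (mod_at M y) \<Longrightarrow>
      \<eta> x (mod_map M x y f a) = mod_map N x y f (\<eta> y a)"
  shows "\<eta> \<in> nat_trans R C M N"
  using assms by (auto simp: nat_trans_def)

lemma nat_trans_comp:
  assumes "\<eta> \<in> nat_trans R C M N" "\<theta> \<in> nat_trans R C N L"
  shows "(\<lambda>x a. \<theta> x (\<eta> x a)) \<in> nat_trans R C M L"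
proof (rule nat_transI)
  fix x assume "x \<in> Ob C"
  then show "(\<lambda>a. \<theta> x (\<eta> x a)) \<in> lin_maps R (mod_at M x) (mod_at L x)"
    using lin_maps_comp[OF nat_trans_lin[OF assms(1)] nat_trans_lin[OF assms(2)]] by blast
next
  fix x y f a assume "x \<in> Ob C" "y \<in> Ob C" "f \<in> Hom C x y" "a \<in> carrier (mod_at M y)"
  then show "\<theta> x (\<eta> x (mod_map M x y f a)) = mod_map L x y f (\<theta> y (\<eta> y a))"
    using assms by (simp add: nat_trans_nat nat_trans_closed)
qed

lemma nat_trans_minus:
  assumes "is_cat_module R C N" "\<eta> \<in> nat_trans R C M N" "\<theta> \<in> nat_trans R C M N"
  shows "(\<lambda>x a. \<eta> x a \<ominus>\<^bsub>mod_at N x\<^esub> \<theta> x a) \<in> nat_trans R C M N"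
proof (rule nat_transI)
  fix x assume "x \<in> Ob C"
  then show "(\<lambda>a. \<eta> x a \<ominus>\<^bsub>mod_at N x\<^esub> \<theta> x a) \<in> lin_maps R (mod_at M x) (mod_at N x)"
    using assms by (intro lin_maps_minus cat_module_at[OF assms(1)] nat_trans_lin)
next
  fix x y f a assume "x \<in> Ob C" "y \<in> Ob C" "f \<in> Hom C x y" "a \<in> carrier (mod_at M y)"
  then show "\<eta> x (mod_map M x y f a) \<ominus>\<^bsub>mod_at N x\<^esub> \<theta> x (mod_map M x y f a) =
       mod_map N x y f (\<eta> y a \<ominus>\<^bsub>mod_at N y\<^esub> \<theta> y a)"
    using assms lin_maps_diff[OF cat_module_at[OF assms(1)] cat_module_at[OF assms(1)]
        cat_module_lin[OF assms(1)]]
    by (simp add: nat_trans_nat nat_trans_closed)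
qed

section \<open>Free modules over a category and the splitting of projectives\<close>

definition generators :: "('o, 'm) cat \<Rightarrow> ('o, 'm, 'r, 'a) cat_module \<Rightarrow> 'o \<Rightarrow> ('o \<times> 'm \<times> 'a) set" where
  "generators C P x = {(y, f, a). y \<in> Ob C \<and> f \<in> Hom C x y \<and> a \<in> carrier (mod_at P y)}"

text \<open>The direct sum of the representables R Hom(-, y), one copy for each y and each a in P y.
  The component a is only a label; no relation from P is imposed.\<close>

definition free_cat_module ::
    "'r ring \<Rightarrow> ('o, 'm) cat \<Rightarrow> ('o, 'm, 'r, 'a) cat_module \<Rightarrow> ('o, 'm, 'r, 'o \<times> 'm \<times> 'a \<Rightarrow> 'r) cat_module"
  where
  "free_cat_module R C P =
     \<lparr>mod_at = (\<lambda>x. free_module R (generators C P x)),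
      mod_map = (\<lambda>x x' g. lincomb R (free_module R (generators C P x))
                              (\<lambda>(y, f, a). basis_vec R (y, Cmp C f g, a)))\<rparr>"

text \<open>By Yoneda each a in P y is a map from R Hom(-, y) to P; these maps are put
  together.\<close>

definition free_cover ::
    "'r ring \<Rightarrow> ('o, 'm, 'r, 'a) cat_module \<Rightarrow> 'o \<Rightarrow> ('o \<times> 'm \<times> 'a \<Rightarrow> 'r) \<Rightarrow> 'a" where
  "free_cover R P x = lincomb R (mod_at P x) (\<lambda>(y, f, a). mod_map P x y f a)"

context
  fixes R :: "'r ring" and C :: "('o, 'm) cat" and P :: "('o, 'm, 'r, 'a) cat_module"
  assumes R: "cring R" and C: "category C"
begin

lemma precompose_generators:
  assumes "x \<in> Ob C" "x' \<in> Ob C" "g \<in> Hom C x x'" "(y, f, a) \<in> generators C P x'"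
  shows "(y, Cmp C f g, a) \<in> generators C P x"
  using assms category_Cmp[OF C] by (auto simp: generators_def)

lemma free_map_lin:
  assumes "x \<in> Ob C" "x' \<in> Ob C" "g \<in> Hom C x x'"
  shows "mod_map (free_cat_module R C P) x x' g
    \<in> lin_maps R (free_module R (generators C P x')) (free_module R (generators C P x))"
  using precompose_generators[OF assms] unfolding free_cat_module_def cat_module.simps
  by (intro lincomb_lin module_free_module R) (auto intro!: basis_vec_closed R)

lemma free_map_basis_vec:
  assumes "x \<in> Ob C" "x' \<in> Ob C" "g \<in> Hom C x x'" "(y, f, a) \<in> generators C P x'"
  shows "mod_map (free_cat_module R C P) x x' g (basis_vec R (y, f, a)) = basis_vec R (y, Cmp C f g, a)"
  using precompose_generators[OF assms] unfolding free_cat_module_def cat_module.simps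
  by (subst lincomb_basis_vec) (auto intro!: basis_vec_closed module_free_module R)

lemma is_cat_module_free_cat_module: "is_cat_module R C (free_cat_module R C P)"
proof -
  note m = module_free_module[OF R]
  have at: "mod_at (free_cat_module R C P) x = free_module R (generators C P x)" for x
    by (simp add: free_cat_module_def)
  show ?thesis
    unfolding is_cat_module_def at
  proof (intro conjI ballI)
    fix x c assume x: "x \<in> Ob C" and c: "c \<in> carrier (free_module R (generators C P x))"
    note i = category_Idn[OF C x]
    have "mod_map (free_cat_module R C P) x x (Idn C x) (basis_vec R t) = basis_vec R t"
      if "t \<in> generators C P x" for t
    proof (cases t)
      case (fields y f a)
      with that x show ?thesis
        using free_map_basis_vec[OF x x i, of y f a] category_Idn_right[OF C x, of y f]
        by (auto simp: generators_def)
    qed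
    then show "mod_map (free_cat_module R C P) x x (Idn C x) c = c"
      using free_module_lin_ext[OF m free_map_lin[OF x x i] lin_maps_id _ c] by blast
  next
    fix x y z f g c assume h: "x \<in> Ob C" "y \<in> Ob C" "z \<in> Ob C" "f \<in> Hom C x y" "g \<in> Hom C y z"
      and c: "c \<in> carrier (free_module R (generators C P z))"
    note gf = category_Cmp[OF C h]
    have "mod_map (free_cat_module R C P) x z (Cmp C g f) (basis_vec R t) =
        mod_map (free_cat_module R C P) x y f (mod_map (free_cat_module R C P) y z g (basis_vec R t))"
      if "t \<in> generators C P z" for t
    proof (cases t)
      case (fields w k a)
      with that have w: "w \<in> Ob C" "k \<in> Hom C z w" "(w, k, a) \<in> generators C P z"
        by (auto simp: generators_def)
      have "(w, Cmp C k g, a) \<in> generators C P y"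
        using precompose_generators[OF h(2,3,5) w(3)] .
      then show ?thesis
        using free_map_basis_vec[OF h(1,3) gf w(3)] free_map_basis_vec[OF h(2,3,5) w(3)]
          free_map_basis_vec[OF h(1,2,4)] category_assoc[OF C h(1-3) w(1) h(4,5) w(2)] fields
        by simp
    qed
    then show "mod_map (free_cat_module R C P) x z (Cmp C g f) c =
        mod_map (free_cat_module R C P) x y f (mod_map (free_cat_module R C P) y z g c)"
      using free_module_lin_ext[OF m free_map_lin[OF h(1,3) gf]
        lin_maps_comp[OF free_map_lin[OF h(2,3,5)] free_map_lin[OF h(1,2,4)]] _ c] by blast
  qed (use m free_map_lin in auto)
qed

lemma is_epi_free_cover:
  assumes P: "is_cat_module R C P"
  shows "is_epi R C (free_cat_module R C P) P (free_cover R P)"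
proof -
  have at: "mod_at (free_cat_module R C P) x = free_module R (generators C P x)" for x
    by (simp add: free_cat_module_def)
  have v: "(\<lambda>(y, f, a). mod_map P x y f a) \<in> generators C P x \<rightarrow> carrier (mod_at P x)" if "x \<in> Ob C"
      for x
    using that cat_module_closed[OF P] by (auto simp: generators_def)
  have lin: "free_cover R P x \<in> lin_maps R (free_module R (generators C P x)) (mod_at P x)"
    if "x \<in> Ob C" for x
    unfolding free_cover_def by (intro lincomb_lin cat_module_at[OF P] that v)
  have bv: "free_cover R P x (basis_vec R (y, f, a)) = mod_map P x y f a"
    if "x \<in> Ob C" "(y, f, a) \<in> generators C P x" for x y f a
    using funcset_mem[OF v[OF that(1)] that(2)] unfolding free_cover_def
    by (subst lincomb_basis_vec[OF cat_module_at[OF P that(1)]]) auto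
  show ?thesis unfolding is_epi_def
  proof (intro conjI ballI nat_transI)
    fix x assume "x \<in> Ob C"
    then show "free_cover R P x \<in> lin_maps R (mod_at (free_cat_module R C P) x) (mod_at P x)"
      using lin by (simp add: at)
  next
    fix x z g c assume h: "x \<in> Ob C" "z \<in> Ob C" "g \<in> Hom C x z"
      "c \<in> carrier (mod_at (free_cat_module R C P) z)"
    have "free_cover R P x (mod_map (free_cat_module R C P) x z g (basis_vec R t)) =
         mod_map P x z g (free_cover R P z (basis_vec R t))" if "t \<in> generators C P z" for t
    proof (cases t)
      case (fields y f a)
      with that have w: "y \<in> Ob C" "f \<in> Hom C z y" "a \<in> carrier (mod_at P y)"
          "(y, f, a) \<in> generators C P z"
        by (auto simp: generators_def)
      have "(y, Cmp C f g, a) \<in> generators C P x"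
        using precompose_generators[OF h(1-3) w(4)] .
      then show ?thesis
        using bv[OF h(1)] bv[OF h(2) w(4)] free_map_basis_vec[OF h(1-3) w(4)]
          cat_module_Cmp[OF P h(1,2) w(1) h(3) w(2,3)] fields by simp
    qed
    then show "free_cover R P x (mod_map (free_cat_module R C P) x z g c) =
         mod_map P x z g (free_cover R P z c)"
      using free_module_lin_ext[OF cat_module_at[OF P h(1)]
        lin_maps_comp[OF free_map_lin[OF h(1-3)] lin[OF h(1)]]
        lin_maps_comp[OF lin[OF h(2)] cat_module_lin[OF P h(1-3)]]] h(4)
      by (simp add: at)
  next
    fix x assume x: "x \<in> Ob C"
    have "a \<in> free_cover R P x ` carrier (free_module R (generators C P x))"
      if a: "a \<in> carrier (mod_at P x)" for a
    proof -
      have g: "(x, Idn C x, a) \<in> generators C P x"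
        using x a category_Idn[OF C x] by (auto simp: generators_def)
      have "a = free_cover R P x (basis_vec R (x, Idn C x, a))"
        using bv[OF x g] cat_module_Idn[OF P x a] by simp
      then show ?thesis using basis_vec_closed[OF R g] by blast
    qed
    then show "free_cover R P x ` carrier (mod_at (free_cat_module R C P) x) = carrier (mod_at P x)"
      using lin_maps_closed[OF lin[OF x]] by (auto simp: at)
  qed
qed

text \<open>The lifting property is applied to the identity, with B = P and A the free module, whose
  element types are those fixed in \<open>projective\<close>. From here on the section s stands for
  projectivity, and targets of lifts may have any type.\<close>

lemma projective_section:
  assumes "projective R C P"
  obtains s where "s \<in> nat_trans R C P (free_cat_module R C P)"
    and "\<And>x a. x \<in> Ob C \<Longrightarrow> a \<in> carrier (mod_at P x) \<Longrightarrow> free_cover R P x (s x a) = a"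
proof -
  have P: "is_cat_module R C P" using assms by (simp add: projective_def)
  have i: "(\<lambda>x a. a) \<in> nat_trans R C P P"
    by (auto intro!: nat_transI lin_maps_id)
  show ?thesis
    using assms is_cat_module_free_cat_module P is_epi_free_cover[OF P] i that
    unfolding projective_def by fast
qed

end

definition representable_decomposition ::
    "('o, 'm) cat \<Rightarrow> ('p, 'n) cat \<Rightarrow> ('o, 'm, 'p, 'n) cat_functor \<Rightarrow>
       ('p \<Rightarrow> 'o \<Rightarrow> 'n \<Rightarrow> 'o) \<Rightarrow> ('p \<Rightarrow> 'o \<Rightarrow> 'n \<Rightarrow> 'n) \<Rightarrow> ('p \<Rightarrow> 'o \<Rightarrow> 'n \<Rightarrow> 'm) \<Rightarrow> bool" where
  "representable_decomposition E C J Y u \<iota> \<longleftrightarrow>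
     (\<forall>X\<in>Ob C. \<forall>L\<in>Ob E. \<forall>f\<in>Hom C (fun_ob J L) X.
        Y X L f \<in> Ob E \<and> u X L f \<in> Hom C (fun_ob J (Y X L f)) X \<and> \<iota> X L f \<in> Hom E L (Y X L f) \<and>
        Cmp C (u X L f) (fun_mor J L (Y X L f) (\<iota> X L f)) = f \<and>
        (\<forall>L'\<in>Ob E. \<forall>g\<in>Hom E L' L.
           Y X L' (Cmp C f (fun_mor J L' L g)) = Y X L f \<and>
           u X L' (Cmp C f (fun_mor J L' L g)) = u X L f \<and>
           \<iota> X L' (Cmp C f (fun_mor J L' L g)) = Cmp E (\<iota> X L f) g))"

text \<open>Every functor \<open>Hom C (J -) X\<close> on \<open>E\<close> is a disjoint union of representable ones: \<open>f\<close> lies in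
  the summand represented by \<open>Y X L f\<close>, embedded by composition with \<open>u X L f\<close>.\<close>

definition sums_of_representables ::
    "('o, 'm) cat \<Rightarrow> ('p, 'n) cat \<Rightarrow> ('o, 'm, 'p, 'n) cat_functor \<Rightarrow> bool" where
  "sums_of_representables E C J \<longleftrightarrow> (\<exists>Y u \<iota>. representable_decomposition E C J Y u \<iota>)"

lemma is_cat_module_res_module:
  assumes F: "is_functor C D F" and M: "is_cat_module R D M"
  shows "is_cat_module R C (res_module F M)"
  using functor_ob[OF F] functor_mor[OF F] functor_Idn[OF F] functor_Cmp[OF F]
    cat_module_at[OF M] cat_module_lin[OF M] cat_module_Idn[OF M] cat_module_Cmp[OF M]
  unfolding is_cat_module_def res_module_def by simp

text \<open>By s, N is a retract of its free cover, so it suffices to lift from the free cover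
  pulled back along J. The decomposition makes that a sum of representable functors on E, so values
  can be chosen freely at the representing morphisms u. Asking only that q lands in the image of e
  allows e to be a differential, which is onto the cycles but not onto the module.\<close>

lemma projective_lift:
  fixes A :: "('o, 'm, 'r, 'b) cat_module" and B :: "('o, 'm, 'r, 'c) cat_module"
    and N :: "('p, 'n, 'r, 'a) cat_module"
  assumes R: "cring R" and E: "category E" and C: "category C" and J: "is_functor E C J"
    and rep: "sums_of_representables E C J" and N: "projective R C N"
    and A: "is_cat_module R E A" and B: "is_cat_module R E B"
    and e: "e \<in> nat_trans R E A B" and q: "q \<in> nat_trans R E (res_module J N) B"
    and im: "\<And>x a. x \<in> Ob E \<Longrightarrow> a \<in> carrier (mod_at (res_module J N) x) \<Longrightarrow>
        q x a \<in> e x ` carrier (mod_at A x)"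
  shows "\<exists>k\<in>nat_trans R E (res_module J N) A.
    \<forall>x\<in>Ob E. \<forall>a\<in>carrier (mod_at (res_module J N) x). e x (k x a) = q x a"
proof -
  have Nm: "is_cat_module R C N" using N by (simp add: projective_def)
  obtain s where s: "s \<in> nat_trans R C N (free_cat_module R C N)"
    and s_id: "\<And>x a. x \<in> Ob C \<Longrightarrow> a \<in> carrier (mod_at N x) \<Longrightarrow> free_cover R N x (s x a) = a"
    using projective_section[OF R C N] by blast
  obtain Y u \<iota> where D: "representable_decomposition E C J Y u \<iota>"
    using rep unfolding sums_of_representables_def by blast
  have Y: "Y X L f \<in> Ob E" and u: "u X L f \<in> Hom C (fun_ob J (Y X L f)) X"
    and \<iota>: "\<iota> X L f \<in> Hom E L (Y X L f)"
    and u\<iota>: "Cmp C (u X L f) (fun_mor J L (Y X L f) (\<iota> X L f)) = f"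
    if "X \<in> Ob C" "L \<in> Ob E" "f \<in> Hom C (fun_ob J L) X" for X L f
    using D that unfolding representable_decomposition_def by simp_all
  have nat: "Y X L' (Cmp C f (fun_mor J L' L g)) = Y X L f \<and>
       u X L' (Cmp C f (fun_mor J L' L g)) = u X L f \<and>
       \<iota> X L' (Cmp C f (fun_mor J L' L g)) = Cmp E (\<iota> X L f) g"
    if "X \<in> Ob C" "L \<in> Ob E" "f \<in> Hom C (fun_ob J L) X" "L' \<in> Ob E" "g \<in> Hom E L' L" for X L f L' g
    using D that unfolding representable_decomposition_def by simp
  note Jo = functor_ob[OF J] and Jm = functor_mor[OF J]
  have at: "mod_at (res_module J N) x = mod_at N (fun_ob J x)"
    "mod_map (res_module J N) x y f = mod_map N (fun_ob J x) (fun_ob J y) (fun_mor J x y f)" for x y f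
    by (auto simp: res_module_def)
  \<comment> \<open>The preimage is chosen per summand: it depends on the representing object Z and
    morphism w, not on f. Here b is a pair of an object X and an element of N X.\<close>
  define l where "l Z w b = (SOME a. a \<in> carrier (mod_at A Z) \<and>
      e Z a = q Z (mod_map N (fun_ob J Z) (fst b) w (snd b)))"
    for Z w b
  have l: "l Z w (X, b) \<in> carrier (mod_at A Z) \<and> e Z (l Z w (X, b)) = q Z (mod_map N (fun_ob J Z) X
      w b)"
    if "Z \<in> Ob E" "X \<in> Ob C" "w \<in> Hom C (fun_ob J Z) X" "b \<in> carrier (mod_at N X)" for Z w X b
  proof -
    have "mod_map N (fun_ob J Z) X w b \<in> carrier (mod_at (res_module J N) Z)"
      using that cat_module_closed[OF Nm Jo] by (simp add: at)
    from im[OF that(1) this] obtain a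
      where "a \<in> carrier (mod_at A Z) \<and> e Z a = q Z (mod_map N (fun_ob J Z) X w b)" by auto
    then show ?thesis unfolding l_def fst_conv snd_conv by (rule someI)
  qed
  \<comment> \<open>As f is u after \<iota>, naturality dictates the value at f: the chosen preimage
    moved along \<iota>.\<close>
  define v where "v L = (\<lambda>(X, f, b). mod_map A L (Y X L f) (\<iota> X L f) (l (Y X L f) (u X L f) (X,
      b)))" for L
  have v: "v L (X, f, b) \<in> carrier (mod_at A L)"
      "e L (v L (X, f, b)) = q L (mod_map N (fun_ob J L) X f b)"
    if L: "L \<in> Ob E" and g: "(X, f, b) \<in> generators C N (fun_ob J L)" for L X f b
  proof -
    have g: "X \<in> Ob C" "f \<in> Hom C (fun_ob J L) X" "b \<in> carrier (mod_at N X)"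
      using g by (auto simp: generators_def)
    note Y' = Y[OF g(1) L g(2)] and u' = u[OF g(1) L g(2)] and \<iota>' = \<iota>[OF g(1) L g(2)]
    note l' = l[OF Y' g(1) u' g(3)]
    show "v L (X, f, b) \<in> carrier (mod_at A L)"
      unfolding v_def using cat_module_closed[OF A L Y' \<iota>'] l' by simp
    have ub: "mod_map N (fun_ob J (Y X L f)) X (u X L f) b \<in> carrier (mod_at N (fun_ob J (Y X L f)))"
      by (rule cat_module_closed[OF Nm Jo[OF Y'] g(1) u' g(3)])
    have "e L (v L (X, f, b)) = mod_map B L (Y X L f) (\<iota> X L f) (q (Y X L f) (mod_map N (fun_ob J (Y
        X L f)) X (u X L f) b))"
      unfolding v_def using nat_trans_nat[OF e L Y' \<iota>'] l' by simp
    also have "\<dots> = q L (mod_map N (fun_ob J L) (fun_ob J (Y X L f)) (fun_mor J L (Y X L f) (\<iota> X L f))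
        (mod_map N (fun_ob J (Y X L f)) X (u X L f) b))"
      using nat_trans_nat[OF q L Y' \<iota>'] ub by (simp add: at)
    also have "\<dots> = q L (mod_map N (fun_ob J L) X f b)"
      using cat_module_Cmp[OF Nm Jo[OF L] Jo[OF Y'] g(1) Jm[OF L Y' \<iota>'] u' g(3)] u\<iota>[OF g(1) L g(2)]
          by simp
    finally show "e L (v L (X, f, b)) = q L (mod_map N (fun_ob J L) X f b)" .
  qed
  have vc: "v L \<in> generators C N (fun_ob J L) \<rightarrow> carrier (mod_at A L)" if "L \<in> Ob E" for L
    using v(1)[OF that] by auto
  note lc = lincomb_lin[OF cat_module_at[OF A] vc]
  have fat: "mod_at (free_cat_module R C N) x = free_module R (generators C N x)" for x
    by (simp add: free_cat_module_def)
  have slin: "s x \<in> lin_maps R (mod_at N x) (free_module R (generators C N x))" if "x \<in> Ob C" for x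
    using nat_trans_lin[OF s that] by (simp add: fat)
  define k where "k L a = lincomb R (mod_at A L) (v L) (s (fun_ob J L) a)" for L a
  show ?thesis
  proof (intro bexI[of _ k] ballI)
    show "k \<in> nat_trans R E (res_module J N) A"
    proof (rule nat_transI)
      fix L assume L: "L \<in> Ob E"
      show "k L \<in> lin_maps R (mod_at (res_module J N) L) (mod_at A L)"
        using lin_maps_comp[OF slin[OF Jo[OF L]] lc[OF L L]] by (simp add: at k_def[abs_def])
    next
      fix L' L g a assume L: "L' \<in> Ob E" "L \<in> Ob E" and g: "g \<in> Hom E L' L"
        and a: "a \<in> carrier (mod_at (res_module J N) L)"
      note Jg = Jm[OF L g]
      have "lincomb R (mod_at A L') (v L') (mod_map (free_cat_module R C N) (fun_ob J L') (fun_ob J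
          L) (fun_mor J L' L g) (basis_vec R t))
          = mod_map A L' L g (lincomb R (mod_at A L) (v L) (basis_vec R t))"
        if "t \<in> generators C N (fun_ob J L)" for t
      proof (cases t)
        case (fields X f b)
        with that have w: "X \<in> Ob C" "f \<in> Hom C (fun_ob J L) X" "b \<in> carrier (mod_at N X)"
          "(X, f, b) \<in> generators C N (fun_ob J L)"
          by (auto simp: generators_def)
        have w': "(X, Cmp C f (fun_mor J L' L g), b) \<in> generators C N (fun_ob J L')"
          using precompose_generators[OF R C Jo[OF L(1)] Jo[OF L(2)] Jg w(4)] .
        \<comment> \<open>Precomposition with g keeps Y and u and changes only \<iota>, so the same
          preimage is used at L and L'.\<close>
        note n = nat[OF w(1) L(2) w(2) L(1) g]
        note Y' = Y[OF w(1) L(2) w(2)] and u' = u[OF w(1) L(2) w(2)] and \<iota>' = \<iota>[OF w(1) L(2) w(2)]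
        have "lincomb R (mod_at A L') (v L') (mod_map (free_cat_module R C N) (fun_ob J L') (fun_ob
            J L) (fun_mor J L' L g) (basis_vec R t))
          = v L' (X, Cmp C f (fun_mor J L' L g), b)"
          using free_map_basis_vec[OF R C Jo[OF L(1)] Jo[OF L(2)] Jg w(4)] fields
            lincomb_basis_vec[where v = "v L'" and t = "(X, Cmp C f (fun_mor J L' L g), b)", OF
                cat_module_at[OF A L(1)] v(1)[OF L(1) w']] by simp
        also have "\<dots> = mod_map A L' L g (v L (X, f, b))"
          using n cat_module_Cmp[OF A L Y' g \<iota>'] l[OF Y' w(1) u' w(3)] by (simp add: v_def)
        also have "v L (X, f, b) = lincomb R (mod_at A L) (v L) (basis_vec R t)"
          using lincomb_basis_vec[where v = "v L" and t = t, OF cat_module_at[OF A L(2)]] v(1)[OF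
              L(2) w(4)] fields by simp
        finally show ?thesis .
      qed
      then have "lincomb R (mod_at A L') (v L') (mod_map (free_cat_module R C N) (fun_ob J L')
          (fun_ob J L) (fun_mor J L' L g) (s (fun_ob J L) a))
          = mod_map A L' L g (lincomb R (mod_at A L) (v L) (s (fun_ob J L) a))"
        using free_module_lin_ext[OF cat_module_at[OF A L(1)]
          lin_maps_comp[OF free_map_lin[OF R C Jo[OF L(1)] Jo[OF L(2)] Jg, of N] lc[OF L(1) L(1)]]
          lin_maps_comp[OF lc[OF L(2) L(2)] cat_module_lin[OF A L g]]]
          lin_maps_closed[OF slin[OF Jo[OF L(2)]]] a by (simp add: at)
      then show "k L' (mod_map (res_module J N) L' L g a) = mod_map A L' L g (k L a)"
        using nat_trans_nat[OF s Jo[OF L(1)] Jo[OF L(2)] Jg] a by (simp add: k_def at)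
    qed
  next
    fix L a assume L: "L \<in> Ob E" and a: "a \<in> carrier (mod_at (res_module J N) L)"
    have cov: "free_cover R N (fun_ob J L) \<in> lin_maps R (free_module R (generators C N (fun_ob J
        L))) (mod_at N (fun_ob J L))"
      using is_epi_free_cover[OF R C Nm] nat_trans_lin[OF _ Jo[OF L]] unfolding is_epi_def
          fat[symmetric] by blast
    have "e L (lincomb R (mod_at A L) (v L) (basis_vec R t)) = q L (free_cover R N (fun_ob J L)
        (basis_vec R t))"
      if "t \<in> generators C N (fun_ob J L)" for t
    proof (cases t)
      case (fields X f b)
      with that have w: "X \<in> Ob C" "f \<in> Hom C (fun_ob J L) X" "b \<in> carrier (mod_at N X)"
          "(X, f, b) \<in> generators C N (fun_ob J L)"
        by (auto simp: generators_def)
      show ?thesis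
        using lincomb_basis_vec[where v = "v L" and t = t, OF cat_module_at[OF A L]] v[OF L w(4)] fields
          lincomb_basis_vec[where v = "\<lambda>(y, f, a). mod_map N (fun_ob J L) y f a" and t = t, OF
              cat_module_at[OF Nm Jo[OF L]]]
          cat_module_closed[OF Nm Jo[OF L] w(1-3)]
        by (simp add: free_cover_def)
    qed
    then have "e L (lincomb R (mod_at A L) (v L) (s (fun_ob J L) a)) = q L (free_cover R N (fun_ob J
        L) (s (fun_ob J L) a))"
      using free_module_lin_ext[OF cat_module_at[OF B L] lin_maps_comp[OF lc[OF L L]
          nat_trans_lin[OF e L]]
        lin_maps_comp[OF cov nat_trans_lin[OF q L, unfolded at]]] lin_maps_closed[OF slin[OF Jo[OF
            L]]] a by (simp add: at)
    then show "e L (k L a) = q L a"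
      using s_id[OF Jo[OF L]] a by (simp add: k_def at)
  qed
qed

section \<open>Comparison and homotopy\<close>

text \<open>Resolutions by arbitrary modules: the form taken by restrictions and Kan extensions of
  resolutions, which occur as targets of lifts.\<close>

definition exact_resolution ::
    "'r ring \<Rightarrow> ('o, 'm) cat \<Rightarrow> ('o, 'm, 'r, 'b) cat_module
       \<Rightarrow> ('o, 'm, 'r, 'a, 'b) resolution \<Rightarrow> bool" where
  "exact_resolution R C N P \<longleftrightarrow>
     is_cat_module R C N \<and>
     (\<forall>n. is_cat_module R C (trm P n)) \<and>
     (\<forall>n. diff P n \<in> nat_trans R C (trm P (Suc n)) (trm P n)) \<and>
     is_epi R C (trm P 0) N (aug P) \<and>
     (\<forall>x\<in>Ob C. diff P 0 x ` carrier (mod_at (trm P 1) x)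
        = a_kernel (mod_at (trm P 0) x) (mod_at N x) (aug P x)) \<and>
     (\<forall>n. \<forall>x\<in>Ob C. diff P (Suc n) x ` carrier (mod_at (trm P (Suc (Suc n))) x)
        = a_kernel (mod_at (trm P (Suc n)) x) (mod_at (trm P n) x) (diff P n x))"

definition res_resolution ::
    "('o, 'm, 'p, 'n) cat_functor \<Rightarrow> ('p, 'n, 'r, 'a, 'b) resolution \<Rightarrow> ('o, 'm, 'r, 'a, 'b) resolution"
  where
  "res_resolution F P =
     \<lparr>trm = (\<lambda>n. res_module F (trm P n)), diff = (\<lambda>n x. diff P n (fun_ob F x)),
      aug = (\<lambda>x. aug P (fun_ob F x))\<rparr>"

lemma is_cat_module_const_module: "cring R \<Longrightarrow> is_cat_module R C (const_module R)"
proof -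
  assume "cring R"
  then interpret cring R .
  have "module R \<lparr>carrier = carrier R, monoid.mult = monoid.mult R, one = one R, zero = zero R,
                       add = add R, smult = monoid.mult R\<rparr>"
    by (intro moduleI abelian_groupI) (auto simp: is_cring a_ac l_distr r_distr m_assoc intro:
        add.l_inv_ex)
  then show ?thesis by (auto simp: is_cat_module_def const_module_def lin_maps_def)
qed

lemma res_const_module: "res_module F (const_module R) = const_module R"
  by (simp add: res_module_def const_module_def)

lemma projective_resolution_exact:
  "projective_resolution R C N P \<Longrightarrow> is_cat_module R C N \<Longrightarrow> exact_resolution R C N P"
  by (auto simp: projective_resolution_def exact_resolution_def projective_def)

lemma res_nat_trans:
  assumes "is_functor C D F" "\<eta> \<in> nat_trans R D M N"
  shows "(\<lambda>x. \<eta> (fun_ob F x)) \<in> nat_trans R C (res_module F M) (res_module F N)"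
  using nat_trans_lin[OF assms(2)] nat_trans_nat[OF assms(2)] functor_ob[OF assms(1)] functor_mor[OF
      assms(1)]
  unfolding nat_trans_def res_module_def by simp

text \<open>Exactness is an objectwise condition, and restriction only reindexes the
  objects.\<close>

lemma exact_resolution_res:
  assumes F: "is_functor C D F" and P: "exact_resolution R D N P"
  shows "exact_resolution R C (res_module F N) (res_resolution F P)"
proof -
  note o = functor_ob[OF F]
  have at: "mod_at (res_module F (trm P n)) x = mod_at (trm P n) (fun_ob F x)" for n x
    by (simp add: res_module_def)
  have at': "mod_at (res_module F N) x = mod_at N (fun_ob F x)" for x by (simp add: res_module_def)
  show ?thesis
    using P o unfolding exact_resolution_def is_epi_def res_resolution_def
    by (simp add: at at' is_cat_module_res_module[OF F] res_nat_trans[OF F])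
qed

context
  fixes R :: "'r ring" and C :: "('o, 'm) cat" and N :: "('o, 'm, 'r, 'b) cat_module"
    and P :: "('o, 'm, 'r, 'a, 'b) resolution"
  assumes P: "exact_resolution R C N P"
begin

lemma exact_trm: "is_cat_module R C (trm P n)"
  and exact_target: "is_cat_module R C N"
  and exact_diff: "diff P n \<in> nat_trans R C (trm P (Suc n)) (trm P n)"
  and exact_aug: "aug P \<in> nat_trans R C (trm P 0) N"
  and exact_aug_surj: "x \<in> Ob C \<Longrightarrow> aug P x ` carrier (mod_at (trm P 0) x) = carrier (mod_at N x)"
  using P by (auto simp: exact_resolution_def is_epi_def)

lemma exact_at_0:
  assumes "x \<in> Ob C" "a \<in> carrier (mod_at (trm P 0) x)"
  shows "aug P x a = \<zero>\<^bsub>mod_at N x\<^esub> \<longleftrightarrow> a \<in> diff P 0 x ` carrier (mod_at (trm P (Suc 0)) x)"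
  using P assms by (auto simp: exact_resolution_def a_kernel_def')

lemma exact_at_Suc:
  assumes "x \<in> Ob C" "a \<in> carrier (mod_at (trm P (Suc n)) x)"
  shows "diff P n x a = \<zero>\<^bsub>mod_at (trm P n) x\<^esub>
    \<longleftrightarrow> a \<in> diff P (Suc n) x ` carrier (mod_at (trm P (Suc (Suc n))) x)"
  using P assms by (auto simp: exact_resolution_def a_kernel_def')

lemma exact_closed:
  assumes "x \<in> Ob C" "a \<in> carrier (mod_at (trm P (Suc n)) x)"
  shows "diff P n x a \<in> carrier (mod_at (trm P n) x)"
  by (rule nat_trans_closed[OF exact_diff assms])

lemma exact_aug_diff:
  assumes "x \<in> Ob C" "a \<in> carrier (mod_at (trm P (Suc 0)) x)"
  shows "aug P x (diff P 0 x a) = \<zero>\<^bsub>mod_at N x\<^esub>"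
  using exact_at_0[OF assms(1) exact_closed[OF assms]] assms(2) by blast

lemma exact_diff_diff:
  assumes "x \<in> Ob C" "a \<in> carrier (mod_at (trm P (Suc (Suc n))) x)"
  shows "diff P n x (diff P (Suc n) x a) = \<zero>\<^bsub>mod_at (trm P n) x\<^esub>"
  using exact_at_Suc[OF assms(1) exact_closed[OF assms]] assms(2) by blast

lemma nat_trans_zero:
  assumes "\<eta> \<in> nat_trans R C M K" "is_cat_module R C M" "is_cat_module R C K" "x \<in> Ob C"
  shows "\<eta> x \<zero>\<^bsub>mod_at M x\<^esub> = \<zero>\<^bsub>mod_at K x\<^esub>"
  using assms by (intro lin_maps_zero[of R] cat_module_at nat_trans_lin)

end

text \<open>The equation d k + k d = \<phi> - \<psi> solved for d k, the shape in which k is lifted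
  degree by degree. In degree 0 the term k d is absent.\<close>

definition chain_homotopy :: "('o, 'm) cat \<Rightarrow> ('o, 'm, 'r, 'a, 'd) resolution \<Rightarrow> ('o, 'm, 'r, 'b, 'e)
    resolution
    \<Rightarrow> (nat \<Rightarrow> 'o \<Rightarrow> 'a \<Rightarrow> 'b) \<Rightarrow> (nat \<Rightarrow> 'o \<Rightarrow> 'a \<Rightarrow> 'b) \<Rightarrow> (nat \<Rightarrow> 'o \<Rightarrow> 'a \<Rightarrow> 'b) \<Rightarrow> bool" where
  "chain_homotopy C P Y k \<phi> \<psi> \<longleftrightarrow>
     (\<forall>x\<in>Ob C. \<forall>a\<in>carrier (mod_at (trm P 0) x).
        diff Y 0 x (k 0 x a) = \<phi> 0 x a \<ominus>\<^bsub>mod_at (trm Y 0) x\<^esub> \<psi> 0 x a) \<and>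
     (\<forall>n. \<forall>x\<in>Ob C. \<forall>a\<in>carrier (mod_at (trm P (Suc n)) x).
        diff Y (Suc n) x (k (Suc n) x a) =
          (\<phi> (Suc n) x a \<ominus>\<^bsub>mod_at (trm Y (Suc n)) x\<^esub> \<psi> (Suc n) x a)
            \<ominus>\<^bsub>mod_at (trm Y (Suc n)) x\<^esub> k n x (diff P n x a))"

text \<open>The comparison theorem relative to J: maps go from the restriction along J of a
  projective resolution over C to an exact resolution over E. The identity gives the classical case,
  the inclusion of the groups between H and K the contraction.\<close>

locale lifting_situation =
  fixes R :: "'r ring" and E :: "('o, 'm) cat" and C :: "('p, 'n) cat"
    and J :: "('o, 'm, 'p, 'n) cat_functor"
    and N :: "('p, 'n, 'r, 'd) cat_module" and Q :: "('p, 'n, 'r, 'a, 'd) resolution"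
    and Z :: "('o, 'm, 'r, 'e) cat_module" and Y :: "('o, 'm, 'r, 'b, 'e) resolution"
  assumes R: "cring R" and E: "category E" and C: "category C" and J: "is_functor E C J"
    and rep: "sums_of_representables E C J"
    and Q: "projective_resolution R C N Q" and N: "is_cat_module R C N"
    and Y: "exact_resolution R E Z Y"
begin

abbreviation "X n \<equiv> res_module J (trm Q n)"
abbreviation "dX n x \<equiv> diff Q n (fun_ob J x)"

lemma XQ: "exact_resolution R E (res_module J N) (res_resolution J Q)"
  by (rule exact_resolution_res[OF J projective_resolution_exact[OF Q N]])

lemma res_sel: "trm (res_resolution J Q) n = X n" "diff (res_resolution J Q) n x = dX n x"
  "aug (res_resolution J Q) x = aug Q (fun_ob J x)"
  by (simp_all add: res_resolution_def)

lemmas XQ_trm = exact_trm[OF XQ, unfolded res_sel]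
  and XQ_aug_diff = exact_aug_diff[OF XQ, unfolded res_sel]
  and XQ_diff_diff = exact_diff_diff[OF XQ, unfolded res_sel]
  and XQ_closed = exact_closed[OF XQ, unfolded res_sel]

lemma XQ_diff: "dX n \<in> nat_trans R E (X (Suc n)) (X n)"
  using exact_diff[OF XQ, of n] by (simp add: res_resolution_def)

lemma XQ_aug: "(\<lambda>x. aug Q (fun_ob J x)) \<in> nat_trans R E (X 0) (res_module J N)"
  using exact_aug[OF XQ] by (simp add: res_resolution_def)

lemma lift:
  assumes "is_cat_module R E A" "is_cat_module R E B" "e \<in> nat_trans R E A B"
      "q \<in> nat_trans R E (X n) B"
    and "\<And>x a. x \<in> Ob E \<Longrightarrow> a \<in> carrier (mod_at (X n) x) \<Longrightarrow> q x a \<in> e x ` carrier (mod_at A x)"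
  shows "\<exists>k\<in>nat_trans R E (X n) A. \<forall>x\<in>Ob E. \<forall>a\<in>carrier (mod_at (X n) x). e x (k x a) = q x a"
proof -
  have "projective R C (trm Q n)" using Q by (simp add: projective_resolution_def)
  from projective_lift[OF R E C J rep this assms] show ?thesis .
qed

lemma comparison_exists:
  assumes \<theta>: "\<theta> \<in> nat_trans R E (res_module J N) Z"
  shows "\<exists>\<phi>. (\<forall>n. \<phi> n \<in> nat_trans R E (X n) (trm Y n)) \<and>
    (\<forall>x\<in>Ob E. \<forall>a\<in>carrier (mod_at (X 0) x). aug Y x (\<phi> 0 x a) = \<theta> x (aug Q (fun_ob J x) a)) \<and>
    (\<forall>n. \<forall>x\<in>Ob E. \<forall>a\<in>carrier (mod_at (X (Suc n)) x). diff Y n x (\<phi> (Suc n) x a) = \<phi> n x (dX n x a))"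
proof -
  \<comment> \<open>\<open>?bd\<close> is what the lift to degree n + 1 requires. It belongs to the
    invariant because \<open>dependent_nat_choice\<close> hands on only the current map.\<close>
  let ?bd = "\<lambda>n \<phi>. \<forall>x\<in>Ob E. \<forall>a\<in>carrier (mod_at (X (Suc n)) x).
      \<phi> x (dX n x a) \<in> diff Y n x ` carrier (mod_at (trm Y (Suc n)) x)"
  let ?I = "\<lambda>n \<phi>. \<phi> \<in> nat_trans R E (X n) (trm Y n) \<and> ?bd n \<phi> \<and>
      (n = 0 \<longrightarrow> (\<forall>x\<in>Ob E. \<forall>a\<in>carrier (mod_at (X 0) x). aug Y x (\<phi> x a) = \<theta> x (aug Q (fun_ob J x) a)))"
  let ?S = "\<lambda>n \<phi> \<psi>. \<forall>x\<in>Ob E. \<forall>a\<in>carrier (mod_at (X (Suc n)) x). diff Y n x (\<psi> x a) = \<phi> x (dX n x a)"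
  have "\<exists>\<phi>. \<forall>n. ?I n (\<phi> n) \<and> ?S n (\<phi> n) (\<phi> (Suc n))"
  proof (rule dependent_nat_choice)
    have q: "(\<lambda>x a. \<theta> x (aug Q (fun_ob J x) a)) \<in> nat_trans R E (X 0) Z"
      by (rule nat_trans_comp[OF XQ_aug \<theta>])
    obtain \<phi> where \<phi>: "\<phi> \<in> nat_trans R E (X 0) (trm Y 0)"
      "\<And>x a. x \<in> Ob E \<Longrightarrow> a \<in> carrier (mod_at (X 0) x) \<Longrightarrow> aug Y x (\<phi> x a) = \<theta> x (aug Q (fun_ob J x) a)"
      using lift[OF exact_trm[OF Y] exact_target[OF Y] exact_aug[OF Y] q] exact_aug_surj[OF Y]
        nat_trans_closed[OF q] by blast
    have "?bd 0 \<phi>"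
    proof (intro ballI)
      fix x a assume x: "x \<in> Ob E" and a: "a \<in> carrier (mod_at (X (Suc 0)) x)"
      have "aug Y x (\<phi> x (dX 0 x a)) = \<zero>\<^bsub>mod_at Z x\<^esub>"
        using \<phi>(2)[OF x XQ_closed[OF x a]] XQ_aug_diff[OF x a]
          nat_trans_zero[OF XQ \<theta> exact_target[OF XQ] exact_target[OF Y] x] by simp
      then show "\<phi> x (dX 0 x a) \<in> diff Y 0 x ` carrier (mod_at (trm Y (Suc 0)) x)"
        using exact_at_0[OF Y x nat_trans_closed[OF \<phi>(1) x XQ_closed[OF x a]]] by simp
    qed
    then show "\<exists>\<phi>. ?I 0 \<phi>" using \<phi> by blast
  next
    fix \<phi> n assume I: "?I n \<phi>"
    then have \<phi>: "\<phi> \<in> nat_trans R E (X n) (trm Y n)" and bd: "?bd n \<phi>" by blast+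
    have q: "(\<lambda>x a. \<phi> x (dX n x a)) \<in> nat_trans R E (X (Suc n)) (trm Y n)"
      by (rule nat_trans_comp[OF XQ_diff \<phi>])
    obtain \<psi> where \<psi>: "\<psi> \<in> nat_trans R E (X (Suc n)) (trm Y (Suc n))"
      "\<And>x a. x \<in> Ob E \<Longrightarrow> a \<in> carrier (mod_at (X (Suc n)) x) \<Longrightarrow> diff Y n x (\<psi> x a) = \<phi> x (dX n x a)"
      using lift[OF exact_trm[OF Y] exact_trm[OF Y] exact_diff[OF Y] q] bd by blast
    have "?bd (Suc n) \<psi>"
    proof (intro ballI)
      fix x a assume x: "x \<in> Ob E" and a: "a \<in> carrier (mod_at (X (Suc (Suc n))) x)"
      have "diff Y n x (\<psi> x (dX (Suc n) x a)) = \<zero>\<^bsub>mod_at (trm Y n) x\<^esub>"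
        using \<psi>(2)[OF x XQ_closed[OF x a]] XQ_diff_diff[OF x a]
          nat_trans_zero[OF XQ \<phi> XQ_trm exact_trm[OF Y] x] by simp
      then show "\<psi> x (dX (Suc n) x a) \<in> diff Y (Suc n) x ` carrier (mod_at (trm Y (Suc (Suc n))) x)"
        using exact_at_Suc[OF Y x nat_trans_closed[OF \<psi>(1) x XQ_closed[OF x a]]] by simp
    qed
    then show "\<exists>\<psi>. ?I (Suc n) \<psi> \<and> ?S n \<phi> \<psi>" using \<psi> by blast
  qed
  then obtain \<phi> where "\<And>n. ?I n (\<phi> n) \<and> ?S n (\<phi> n) (\<phi> (Suc n))" by blast
  then show ?thesis by (intro exI[of _ \<phi>]) blast
qed

text \<open>At each stage g - k d is a cycle of the exact Y and so lifts along d. Formulated for a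
  single chain map g, to serve both for differences of comparison maps and for the identity minus a
  projection in \<open>contracting_homotopy\<close>.\<close>

lemma homotopy_exists:
  assumes g: "\<And>n. g n \<in> nat_trans R E (X n) (trm Y n)"
    and g0: "\<And>x a. x \<in> Ob E \<Longrightarrow> a \<in> carrier (mod_at (X 0) x) \<Longrightarrow> aug Y x (g 0 x a) = \<zero>\<^bsub>mod_at Z x\<^esub>"
    and gS: "\<And>n x a. x \<in> Ob E \<Longrightarrow> a \<in> carrier (mod_at (X (Suc n)) x) \<Longrightarrow>
      diff Y n x (g (Suc n) x a) = g n x (dX n x a)"
  shows "\<exists>k. (\<forall>n. k n \<in> nat_trans R E (X n) (trm Y (Suc n))) \<and>
    (\<forall>x\<in>Ob E. \<forall>a\<in>carrier (mod_at (X 0) x). diff Y 0 x (k 0 x a) = g 0 x a) \<and>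
    (\<forall>n. \<forall>x\<in>Ob E. \<forall>a\<in>carrier (mod_at (X (Suc n)) x).
       diff Y (Suc n) x (k (Suc n) x a) = g (Suc n) x a \<ominus>\<^bsub>mod_at (trm Y (Suc n)) x\<^esub> k n x (dX n x a))"
proof -
  \<comment> \<open>As d d = 0, the homotopy relation in degree n yields d k d = g d, and this makes
    g - k d a cycle in degree n + 1.\<close>
  let ?bd = "\<lambda>n k. \<forall>x\<in>Ob E. \<forall>a\<in>carrier (mod_at (X (Suc n)) x).
      diff Y n x (k x (dX n x a)) = g n x (dX n x a)"
  let ?I = "\<lambda>n k. k \<in> nat_trans R E (X n) (trm Y (Suc n)) \<and> ?bd n k \<and>
      (n = 0 \<longrightarrow> (\<forall>x\<in>Ob E. \<forall>a\<in>carrier (mod_at (X 0) x). diff Y 0 x (k x a) = g 0 x a))"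
  let ?S = "\<lambda>n k k'. \<forall>x\<in>Ob E. \<forall>a\<in>carrier (mod_at (X (Suc n)) x).
       diff Y (Suc n) x (k' x a) = g (Suc n) x a \<ominus>\<^bsub>mod_at (trm Y (Suc n)) x\<^esub> k x (dX n x a)"
  note gc = nat_trans_closed[OF g] and Yat = cat_module_at[OF exact_trm[OF Y]]
  have "\<exists>k. \<forall>n. ?I n (k n) \<and> ?S n (k n) (k (Suc n))"
  proof (rule dependent_nat_choice)
    obtain k where k: "k \<in> nat_trans R E (X 0) (trm Y (Suc 0))"
      "\<And>x a. x \<in> Ob E \<Longrightarrow> a \<in> carrier (mod_at (X 0) x) \<Longrightarrow> diff Y 0 x (k x a) = g 0 x a"
      using lift[OF exact_trm[OF Y] exact_trm[OF Y] exact_diff[OF Y] g] g0 exact_at_0[OF Y _ gc] by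
          blast
    then have "?bd 0 k" using XQ_closed by blast
    then show "\<exists>k. ?I 0 k" using k by blast
  next
    fix k n assume I: "?I n k"
    then have k: "k \<in> nat_trans R E (X n) (trm Y (Suc n))" and bd: "?bd n k" by blast+
    let ?q = "\<lambda>x a. g (Suc n) x a \<ominus>\<^bsub>mod_at (trm Y (Suc n)) x\<^esub> k x (dX n x a)"
    have kd: "(\<lambda>x a. k x (dX n x a)) \<in> nat_trans R E (X (Suc n)) (trm Y (Suc n))"
      by (rule nat_trans_comp[OF XQ_diff k])
    have q: "?q \<in> nat_trans R E (X (Suc n)) (trm Y (Suc n))"
      by (rule nat_trans_minus[OF exact_trm[OF Y] g kd])
    have qi: "?q x a \<in> diff Y (Suc n) x ` carrier (mod_at (trm Y (Suc (Suc n))) x)"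
      if x: "x \<in> Ob E" and a: "a \<in> carrier (mod_at (X (Suc n)) x)" for x a
    proof -
      interpret Yn: module R "mod_at (trm Y n) x" by (rule Yat[OF x])
      note da = XQ_closed[OF x a]
      have "diff Y n x (?q x a) = diff Y n x (g (Suc n) x a) \<ominus>\<^bsub>mod_at (trm Y n) x\<^esub> diff Y n x (k x
          (dX n x a))"
        by (rule lin_maps_diff[OF Yat[OF x] Yat[OF x] nat_trans_lin[OF exact_diff[OF Y] x]
              gc[OF x a] nat_trans_closed[OF kd x a]])
      also have "\<dots> = \<zero>\<^bsub>mod_at (trm Y n) x\<^esub>"
        using gS[OF x a] bd x a gc[OF x da] by (simp add: a_minus_def Yn.M.r_neg)
      finally show ?thesis
        using exact_at_Suc[OF Y x nat_trans_closed[OF q x a]] by simp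
    qed
    obtain k' where k': "k' \<in> nat_trans R E (X (Suc n)) (trm Y (Suc (Suc n)))"
      "\<And>x a. x \<in> Ob E \<Longrightarrow> a \<in> carrier (mod_at (X (Suc n)) x) \<Longrightarrow> diff Y (Suc n) x (k' x a) = ?q x a"
      using lift[OF exact_trm[OF Y] exact_trm[OF Y] exact_diff[OF Y] q] qi by blast
    have "?bd (Suc n) k'"
    proof (intro ballI)
      fix x a assume x: "x \<in> Ob E" and a: "a \<in> carrier (mod_at (X (Suc (Suc n))) x)"
      interpret Yn: module R "mod_at (trm Y (Suc n)) x" by (rule Yat[OF x])
      note da = XQ_closed[OF x a]
      have "k x \<zero>\<^bsub>mod_at (X n) x\<^esub> = \<zero>\<^bsub>mod_at (trm Y (Suc n)) x\<^esub>"
        by (rule nat_trans_zero[OF XQ k XQ_trm exact_trm[OF Y] x])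
      then have "?q x (dX (Suc n) x a) = g (Suc n) x (dX (Suc n) x a) \<ominus>\<^bsub>mod_at (trm Y (Suc n)) x\<^esub>
          \<zero>\<^bsub>mod_at (trm Y (Suc n)) x\<^esub>"
        using XQ_diff_diff[OF x a] by simp
      also have "\<dots> = g (Suc n) x (dX (Suc n) x a)"
        using gc[OF x da] by (metis a_minus_def Yn.M.l_zero Yn.M.r_neg Yn.M.r_zero Yn.M.a_inv_closed
            Yn.M.zero_closed)
      finally show "diff Y (Suc n) x (k' x (dX (Suc n) x a)) = g (Suc n) x (dX (Suc n) x a)"
        using k'(2)[OF x da] by simp
    qed
    then show "\<exists>k'. ?I (Suc n) k' \<and> ?S n k k'" using k' by blast
  qed
  then obtain k where "\<And>n. ?I n (k n) \<and> ?S n (k n) (k (Suc n))" by blast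
  then show ?thesis by (intro exI[of _ k]) blast
qed

lemma comparison_homotopic:
  assumes \<phi>: "\<And>n. \<phi> n \<in> nat_trans R E (X n) (trm Y n)" and \<psi>: "\<And>n. \<psi> n \<in> nat_trans R E (X n) (trm Y n)"
    and aug: "\<And>x a. x \<in> Ob E \<Longrightarrow> a \<in> carrier (mod_at (X 0) x) \<Longrightarrow> aug Y x (\<phi> 0 x a) = aug Y x (\<psi> 0 x a)"
    and d\<phi>: "\<And>n x a. x \<in> Ob E \<Longrightarrow> a \<in> carrier (mod_at (X (Suc n)) x) \<Longrightarrow>
      diff Y n x (\<phi> (Suc n) x a) = \<phi> n x (dX n x a)"
    and d\<psi>: "\<And>n x a. x \<in> Ob E \<Longrightarrow> a \<in> carrier (mod_at (X (Suc n)) x) \<Longrightarrow>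
      diff Y n x (\<psi> (Suc n) x a) = \<psi> n x (dX n x a)"
  shows "\<exists>k. (\<forall>n. k n \<in> nat_trans R E (X n) (trm Y (Suc n))) \<and>
    chain_homotopy E (res_resolution J Q) Y k \<phi> \<psi>"
  unfolding chain_homotopy_def res_sel
proof (rule homotopy_exists)
  note Yat = cat_module_at[OF exact_trm[OF Y]] and Zat = cat_module_at[OF exact_target[OF Y]]
  show "(\<lambda>x a. \<phi> n x a \<ominus>\<^bsub>mod_at (trm Y n) x\<^esub> \<psi> n x a) \<in> nat_trans R E (X n) (trm Y n)" for n
    by (rule nat_trans_minus[OF exact_trm[OF Y] \<phi> \<psi>])
  show "aug Y x (\<phi> 0 x a \<ominus>\<^bsub>mod_at (trm Y 0) x\<^esub> \<psi> 0 x a) = \<zero>\<^bsub>mod_at Z x\<^esub>"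
    if h: "x \<in> Ob E" "a \<in> carrier (mod_at (X 0) x)" for x a
    using lin_maps_diff[OF Yat Zat nat_trans_lin[OF exact_aug[OF Y]] nat_trans_closed[OF \<phi>]
        nat_trans_closed[OF \<psi>]]
      aug[OF h] nat_trans_closed[OF exact_aug[OF Y] h(1) nat_trans_closed[OF \<psi> h]] h
      abelian_group.minus_eq_zero_iff[OF module_ag[OF Zat[OF h(1)]]] by simp
  show "diff Y n x (\<phi> (Suc n) x a \<ominus>\<^bsub>mod_at (trm Y (Suc n)) x\<^esub> \<psi> (Suc n) x a) =
      \<phi> n x (dX n x a) \<ominus>\<^bsub>mod_at (trm Y n) x\<^esub> \<psi> n x (dX n x a)"
    if h: "x \<in> Ob E" "a \<in> carrier (mod_at (X (Suc n)) x)" for n x a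
    using lin_maps_diff[OF Yat Yat nat_trans_lin[OF exact_diff[OF Y]] nat_trans_closed[OF \<phi>]
        nat_trans_closed[OF \<psi>]]
      d\<phi>[OF h] d\<psi>[OF h] h by simp
qed

end

text \<open>Also serves as the inclusion of a category with fewer objects and morphisms, so that
  source and target in \<open>is_functor\<close> may differ.\<close>

definition id_functor :: "('o, 'm, 'o, 'm) cat_functor" where
  "id_functor = \<lparr>fun_ob = (\<lambda>x. x), fun_mor = (\<lambda>_ _ f. f)\<rparr>"

lemma id_functor_sel [simp]: "fun_ob id_functor x = x" "fun_mor id_functor x y f = f"
  by (simp_all add: id_functor_def)

lemma is_functor_id_functor: "is_functor C C id_functor"
  by (simp add: is_functor_def)

lemma res_module_id_functor [simp]: "res_module id_functor M = M"
  by (simp add: res_module_def)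

lemma res_resolution_id_functor [simp]: "res_resolution id_functor P = P"
  by (simp add: res_resolution_def)

text \<open>Hom(-, X) is represented by X itself, each f being the identity of X after f.\<close>

lemma sums_of_representables_id_functor:
  assumes "category C"
  shows "sums_of_representables C C id_functor"
proof -
  have "representable_decomposition C C id_functor (\<lambda>X L f. X) (\<lambda>X L f. Idn C X) (\<lambda>X L f. f)"
    using assms by (auto simp: representable_decomposition_def category_Idn category_Idn_left)
  then show ?thesis by (auto simp: sums_of_representables_def)
qed

section \<open>Left Kan extension along a full functor\<close>

text \<open>The module spanned by the differences of the two actions of morphisms identified by \<open>F\<close>.
  For the projection to the fusion orbit category, the quotient by it is the module of coinvariants
  of the centralizer.\<close>

inductive_set fiber_span ::
    "('o, 'm) cat \<Rightarrow> ('o, 'm, 'o, 'n) cat_functor \<Rightarrow> ('o, 'm, 'r, 'a) cat_module \<Rightarrow> 'o \<Rightarrow> 'a set"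
  for C F N x where
  zero: "\<zero>\<^bsub>mod_at N x\<^esub> \<in> fiber_span C F N x"
| step: "u \<in> fiber_span C F N x \<Longrightarrow> y \<in> Ob C \<Longrightarrow> f \<in> Hom C x y \<Longrightarrow> f' \<in> Hom C x y \<Longrightarrow>
    fun_mor F x y f = fun_mor F x y f' \<Longrightarrow> a \<in> carrier (mod_at N y) \<Longrightarrow>
    u \<oplus>\<^bsub>mod_at N x\<^esub> (mod_map N x y f a \<ominus>\<^bsub>mod_at N x\<^esub> mod_map N x y f' a) \<in> fiber_span C F N x"

definition coinv :: "('o, 'm) cat \<Rightarrow> ('o, 'm, 'o, 'n) cat_functor \<Rightarrow> ('o, 'm, 'r, 'a) cat_module \<Rightarrow>
    'o \<Rightarrow> 'a \<Rightarrow> 'a set" where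
  "coinv C F N x = quot_proj (mod_at N x) (fiber_span C F N x)"

text \<open>For F full and the identity on objects, every element of the left Kan extension at x
  comes from N x, and only actions of morphisms with equal image get identified. The choices are a
  lift of g and a representative of U; \<open>kan_map\<close> shows that they do not matter.\<close>

definition kan_module :: "('o, 'm) cat \<Rightarrow> ('o, 'm, 'o, 'n) cat_functor \<Rightarrow> ('o, 'm, 'r, 'a) cat_module \<Rightarrow>
    ('o, 'n, 'r, 'a set) cat_module" where
  "kan_module C F N =
     \<lparr>mod_at = (\<lambda>x. quot_module (mod_at N x) (fiber_span C F N x)),
      mod_map = (\<lambda>x y g U. coinv C F N x (mod_map N x y
        (SOME f. f \<in> Hom C x y \<and> fun_mor F x y f = g)
        (SOME a. a \<in> carrier (mod_at N y) \<and> coinv C F N y a = U)))\<rparr>"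

text \<open>The adjunct Lan N -> K of a map \<theta> : N -> Res K.\<close>

definition kan_factor :: "('o, 'm) cat \<Rightarrow> ('o, 'm, 'o, 'n) cat_functor \<Rightarrow> ('o, 'm, 'r, 'a) cat_module \<Rightarrow>
    ('o \<Rightarrow> 'a \<Rightarrow> 'b) \<Rightarrow> 'o \<Rightarrow> 'a set \<Rightarrow> 'b" where
  "kan_factor C F N \<theta> x U = \<theta> x (SOME a. a \<in> carrier (mod_at N x) \<and> coinv C F N x a = U)"

definition kan_resolution :: "('o, 'm) cat \<Rightarrow> ('o, 'm, 'o, 'n) cat_functor \<Rightarrow>
    ('o, 'm, 'r, 'a, 'b) resolution \<Rightarrow> ('o, 'n, 'r, 'a set, 'b) resolution" where
  "kan_resolution C F Q =
     \<lparr>trm = (\<lambda>n. kan_module C F (trm Q n)),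
      diff = (\<lambda>n. kan_factor C F (trm Q (Suc n)) (\<lambda>x a. coinv C F (trm Q n) x (diff Q n x a))),
      aug = kan_factor C F (trm Q 0) (aug Q)\<rparr>"

section \<open>Full functors that are the identity on objects\<close>

locale full_functor =
  fixes C :: "('o, 'm) cat" and D :: "('o, 'n) cat" and F :: "('o, 'm, 'o, 'n) cat_functor"
  assumes C: "category C" and D: "category D" and F: "is_functor C D F"
    and ob: "Ob D = Ob C" "\<And>x. fun_ob F x = x"
    and full: "x \<in> Ob C \<Longrightarrow> y \<in> Ob C \<Longrightarrow> g \<in> Hom D x y \<Longrightarrow> \<exists>f\<in>Hom C x y. fun_mor F x y f = g"
begin

lemma res_at [simp]: "mod_at (res_module F K) x = mod_at K x"
  and res_map [simp]: "mod_map (res_module F K) x y f = mod_map K x y (fun_mor F x y f)"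
  by (simp_all add: res_module_def ob)

lemma functor_Cmp': "x \<in> Ob C \<Longrightarrow> y \<in> Ob C \<Longrightarrow> z \<in> Ob C \<Longrightarrow> f \<in> Hom C x y \<Longrightarrow> g \<in> Hom C y z \<Longrightarrow>
    fun_mor F x z (Cmp C g f) = Cmp D (fun_mor F y z g) (fun_mor F x y f)"
  by (rule functor_Cmp[OF F])

lemma functor_Idn': "x \<in> Ob C \<Longrightarrow> fun_mor F x x (Idn C x) = Idn D x"
  using functor_Idn[OF F] ob by simp

text \<open>A generator goes to h (N f a) - h (N f' a), which is zero by \<open>eq\<close>.
  Membership in the carrier is proved along with it, so that additivity of h applies in the
  induction.\<close>

lemma fiber_span_kernel:
  assumes N: "is_cat_module R C N" and K: "module R K" and x: "x \<in> Ob C"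
    and h: "h \<in> lin_maps R (mod_at N x) K"
    and eq: "\<And>y f f' a. y \<in> Ob C \<Longrightarrow> f \<in> Hom C x y \<Longrightarrow> f' \<in> Hom C x y \<Longrightarrow>
      fun_mor F x y f = fun_mor F x y f' \<Longrightarrow> a \<in> carrier (mod_at N y) \<Longrightarrow>
      h (mod_map N x y f a) = h (mod_map N x y f' a)"
    and u: "u \<in> fiber_span C F N x"
  shows "u \<in> carrier (mod_at N x) \<and> h u = \<zero>\<^bsub>K\<^esub>"
  using u
proof induction
  case zero
  interpret module R "mod_at N x" by (rule cat_module_at[OF N x])
  show ?case using lin_maps_zero[OF cat_module_at[OF N x] K h] by simp
next
  case (step u y f f' a)
  interpret N: module R "mod_at N x" by (rule cat_module_at[OF N x])
  interpret K: module R K by (rule K)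
  have c: "mod_map N x y f a \<in> carrier (mod_at N x)" "mod_map N x y f' a \<in> carrier (mod_at N x)"
    using cat_module_closed[OF N x step.hyps(2)] step.hyps by auto
  have "h (mod_map N x y f a \<ominus>\<^bsub>mod_at N x\<^esub> mod_map N x y f' a) = \<zero>\<^bsub>K\<^esub>"
    using lin_maps_diff[OF cat_module_at[OF N x] K h c] eq[OF step.hyps(2-6)] lin_maps_closed[OF h c(2)]
    by (simp add: a_minus_def K.M.r_neg)
  then show ?case
    using step.IH c lin_maps_add[OF h, of u "mod_map N x y f a \<ominus>\<^bsub>mod_at N x\<^esub> mod_map N x y f' a"]
    by (simp add: a_minus_def)
qed

context
  fixes R :: "'r ring" and N :: "('o, 'm, 'r, 'a) cat_module"
  assumes N: "is_cat_module R C N"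
begin

abbreviation "I \<equiv> fiber_span C F N"
abbreviation "\<pi> \<equiv> coinv C F N"
abbreviation "Lan \<equiv> kan_module C F N"

lemma fiber_span_subset: "x \<in> Ob C \<Longrightarrow> I x \<subseteq> carrier (mod_at N x)"
proof
  fix u assume x: "x \<in> Ob C" and u: "u \<in> I x"
  interpret N: module R "mod_at N x" by (rule cat_module_at[OF N x])
  show "u \<in> carrier (mod_at N x)" using u
    by induction (use cat_module_closed[OF N x] in auto)
qed

lemma fiber_span_generator:
  assumes "x \<in> Ob C" "y \<in> Ob C" "f \<in> Hom C x y" "f' \<in> Hom C x y"
    "fun_mor F x y f = fun_mor F x y f'" "a \<in> carrier (mod_at N y)"
  shows "mod_map N x y f a \<ominus>\<^bsub>mod_at N x\<^esub> mod_map N x y f' a \<in> I x"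
proof -
  interpret N: module R "mod_at N x" by (rule cat_module_at[OF N assms(1)])
  show ?thesis
    using fiber_span.step[OF fiber_span.zero assms(2-6)] cat_module_closed[OF N assms(1,2)] assms by
        simp
qed

lemma fiber_span_add:
  assumes x: "x \<in> Ob C" and u: "u \<in> I x" and v: "v \<in> I x"
  shows "u \<oplus>\<^bsub>mod_at N x\<^esub> v \<in> I x"
  using v
proof induction
  case zero
  interpret N: module R "mod_at N x" by (rule cat_module_at[OF N x])
  show ?case using u fiber_span_subset[OF x] by auto
next
  case (step v y f f' a)
  interpret N: module R "mod_at N x" by (rule cat_module_at[OF N x])
  have "u \<in> carrier (mod_at N x)" "v \<in> carrier (mod_at N x)"
    using u step.hyps(1) fiber_span_subset[OF x] by auto
  then show ?case
    using fiber_span.step[OF step.IH step.hyps(2-6)] cat_module_closed[OF N x] step.hyps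
    by (simp add: N.M.a_assoc)
qed

lemma fiber_span_lin_image:
  assumes x: "x \<in> Ob C" and K: "module R K" and h: "h \<in> lin_maps R (mod_at N x) K"
    and zero: "\<zero>\<^bsub>K\<^esub> \<in> B" and add: "\<And>u v. u \<in> B \<Longrightarrow> v \<in> B \<Longrightarrow> u \<oplus>\<^bsub>K\<^esub> v \<in> B"
    and gen: "\<And>y f f' a. y \<in> Ob C \<Longrightarrow> f \<in> Hom C x y \<Longrightarrow> f' \<in> Hom C x y \<Longrightarrow>
      fun_mor F x y f = fun_mor F x y f' \<Longrightarrow> a \<in> carrier (mod_at N y) \<Longrightarrow>
      h (mod_map N x y f a) \<ominus>\<^bsub>K\<^esub> h (mod_map N x y f' a) \<in> B"
    and u: "u \<in> I x"
  shows "h u \<in> B"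
  using u
proof induction
  case zero
  show ?case using lin_maps_zero[OF cat_module_at[OF N x] K h] assms(4) by simp
next
  case (step u y f f' a)
  interpret N: module R "mod_at N x" by (rule cat_module_at[OF N x])
  have c: "mod_map N x y f a \<in> carrier (mod_at N x)" "mod_map N x y f' a \<in> carrier (mod_at N x)"
     "u \<in> carrier (mod_at N x)"
    using cat_module_closed[OF N x step.hyps(2)] step.hyps fiber_span_subset[OF x] by auto
  then show ?case
    using lin_maps_add[OF h, of u "mod_map N x y f a \<ominus>\<^bsub>mod_at N x\<^esub> mod_map N x y f' a"]
      lin_maps_diff[OF cat_module_at[OF N x] K h c(1,2)] add[OF step.IH gen[OF step.hyps(2-6)]] by simp
qed

text \<open>Scalars are not built into \<open>fiber_span\<close>, but by linearity of the actions r
  times the generator given by a is the generator given by r a.\<close>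

lemma fiber_span_smult:
  assumes x: "x \<in> Ob C" and r: "r \<in> carrier R" and u: "u \<in> I x"
  shows "r \<odot>\<^bsub>mod_at N x\<^esub> u \<in> I x"
proof (rule fiber_span_lin_image[OF x cat_module_at[OF N x] _ fiber_span.zero fiber_span_add[OF x] _ u])
  interpret N: module R "mod_at N x" by (rule cat_module_at[OF N x])
  show "(\<lambda>u. r \<odot>\<^bsub>mod_at N x\<^esub> u) \<in> lin_maps R (mod_at N x) (mod_at N x)"
    using r by (intro lin_mapsI) (auto simp: N.smult_r_distr N.smult_assoc1[symmetric] N.R.m_comm)
  fix y f f' a assume h: "y \<in> Ob C" "f \<in> Hom C x y" "f' \<in> Hom C x y"
      "fun_mor F x y f = fun_mor F x y f'" "a \<in> carrier (mod_at N y)"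
  interpret Ny: module R "mod_at N y" by (rule cat_module_at[OF N h(1)])
  show "r \<odot>\<^bsub>mod_at N x\<^esub> mod_map N x y f a \<ominus>\<^bsub>mod_at N x\<^esub> r \<odot>\<^bsub>mod_at N x\<^esub> mod_map N x y f' a \<in> I x"
    using fiber_span_generator[OF x h(1-4), of "r \<odot>\<^bsub>mod_at N y\<^esub> a"] r h(5)
      lin_maps_smult[OF cat_module_lin[OF N x h(1)]] h(2,3) by simp
qed

lemma submodule_fiber_span:
  assumes x: "x \<in> Ob C"
  shows "submodule (I x) R (mod_at N x)"
proof -
  interpret N: module R "mod_at N x" by (rule cat_module_at[OF N x])
  show ?thesis
  proof (rule N.submoduleI)
    fix u assume u: "u \<in> I x"
    then show "\<ominus>\<^bsub>mod_at N x\<^esub> u \<in> I x"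
      using fiber_span_smult[OF x, of "\<ominus>\<^bsub>R\<^esub> \<one>\<^bsub>R\<^esub>" u] fiber_span_subset[OF x] N.smult_minus_one
      by (metis N.R.a_inv_closed N.R.one_closed subsetD)
  qed (use fiber_span_subset[OF x] fiber_span.zero fiber_span_add[OF x] fiber_span_smult[OF x] in auto)
qed

lemma module_quotient_fiber_span: "x \<in> Ob C \<Longrightarrow> module_quotient R (mod_at N x) (I x)"
  by (intro module_quotient.intro module_quotient_axioms.intro cat_module_at[OF N] submodule_fiber_span)

lemma kan_at: "mod_at Lan x = quot_module (mod_at N x) (I x)"
  by (simp add: kan_module_def)

lemma module_kan: "x \<in> Ob C \<Longrightarrow> module R (mod_at Lan x)"
  using module_quotient.module_quot_module[OF module_quotient_fiber_span] by (simp add: kan_at)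

lemma coinv_lin: "x \<in> Ob C \<Longrightarrow> \<pi> x \<in> lin_maps R (mod_at N x) (mod_at Lan x)"
  using module_quotient.quot_proj_lin[OF module_quotient_fiber_span] by (simp add: kan_at coinv_def)

lemma coinv_closed: "x \<in> Ob C \<Longrightarrow> a \<in> carrier (mod_at N x) \<Longrightarrow> \<pi> x a \<in> carrier (mod_at Lan x)"
  by (rule lin_maps_closed[OF coinv_lin])

lemma kan_carrier: "x \<in> Ob C \<Longrightarrow> carrier (mod_at Lan x) = \<pi> x ` carrier (mod_at N x)"
  using module_quotient.quot_carrier[OF module_quotient_fiber_span] by (simp add: kan_at coinv_def)

lemma kan_cases:
  assumes "x \<in> Ob C" "U \<in> carrier (mod_at Lan x)"
  obtains a where "a \<in> carrier (mod_at N x)" "U = \<pi> x a"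
  using assms by (auto simp: kan_carrier)

lemma coinv_eq_iff:
  "x \<in> Ob C \<Longrightarrow> a \<in> carrier (mod_at N x) \<Longrightarrow> b \<in> carrier (mod_at N x) \<Longrightarrow>
     \<pi> x a = \<pi> x b \<longleftrightarrow> a \<ominus>\<^bsub>mod_at N x\<^esub> b \<in> I x"
  using module_quotient.quot_proj_eq_iff[OF module_quotient_fiber_span] by (simp add: coinv_def)

lemma coinv_zero_iff:
  "x \<in> Ob C \<Longrightarrow> a \<in> carrier (mod_at N x) \<Longrightarrow> \<pi> x a = \<zero>\<^bsub>mod_at Lan x\<^esub> \<longleftrightarrow> a \<in> I x"
  using module_quotient.quot_proj_zero_iff[OF module_quotient_fiber_span] by (simp add: kan_at
      coinv_def)

lemma coinv_fiber:
  assumes "x \<in> Ob C" "y \<in> Ob C" "f \<in> Hom C x y" "f' \<in> Hom C x y"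
    "fun_mor F x y f = fun_mor F x y f'" "a \<in> carrier (mod_at N y)"
  shows "\<pi> x (mod_map N x y f a) = \<pi> x (mod_map N x y f' a)"
  using assms fiber_span_generator cat_module_closed[OF N] by (simp add: coinv_eq_iff)

lemma lin_maps_coinv_factor:
  assumes x: "x \<in> Ob C" and K: "module R K" and h: "h \<in> lin_maps R (mod_at N x) K"
    and eq: "\<And>y f f' a. y \<in> Ob C \<Longrightarrow> f \<in> Hom C x y \<Longrightarrow> f' \<in> Hom C x y \<Longrightarrow>
      fun_mor F x y f = fun_mor F x y f' \<Longrightarrow> a \<in> carrier (mod_at N y) \<Longrightarrow>
      h (mod_map N x y f a) = h (mod_map N x y f' a)"
    and ab: "a \<in> carrier (mod_at N x)" "b \<in> carrier (mod_at N x)" "\<pi> x a = \<pi> x b"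
  shows "h a = h b"
proof -
  interpret K: module R K by (rule K)
  have c: "h a \<in> carrier K" "h b \<in> carrier K" using lin_maps_closed[OF h] ab by auto
  have "a \<ominus>\<^bsub>mod_at N x\<^esub> b \<in> I x" using ab x by (simp add: coinv_eq_iff)
  then have "h (a \<ominus>\<^bsub>mod_at N x\<^esub> b) = \<zero>\<^bsub>K\<^esub>"
    using fiber_span_kernel[OF N K x h] eq by blast
  then show ?thesis
    using lin_maps_diff[OF cat_module_at[OF N x] K h ab(1,2)] c K.M.minus_eq_zero_iff by simp
qed

text \<open>The chosen lift is replaced by f through \<open>coinv_fiber\<close>. The chosen
  representative is replaced by a because the action of f sends generators at y to generators at x:
  if F g = F g', then F (g f) = F (g' f).\<close>

lemma kan_map:
  assumes x: "x \<in> Ob C" and y: "y \<in> Ob C" and f: "f \<in> Hom C x y" and a: "a \<in> carrier (mod_at N y)"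
  shows "mod_map Lan x y (fun_mor F x y f) (\<pi> y a) = \<pi> x (mod_map N x y f a)"
proof -
  define f' where "f' = (SOME f'. f' \<in> Hom C x y \<and> fun_mor F x y f' = fun_mor F x y f)"
  have f': "f' \<in> Hom C x y \<and> fun_mor F x y f' = fun_mor F x y f"
    unfolding f'_def by (rule someI[of _ f]) (use f in auto)
  define a' where "a' = (SOME a'. a' \<in> carrier (mod_at N y) \<and> \<pi> y a' = \<pi> y a)"
  have a': "a' \<in> carrier (mod_at N y) \<and> \<pi> y a' = \<pi> y a"
    unfolding a'_def by (rule someI[of _ a]) (use a in auto)
  have "mod_map Lan x y (fun_mor F x y f) (\<pi> y a) = \<pi> x (mod_map N x y f' a')"
    by (simp add: kan_module_def f'_def a'_def)
  also have "\<dots> = \<pi> x (mod_map N x y f a')"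
    using a' f f' x y by (intro coinv_fiber) auto
  also have "\<dots> = \<pi> x (mod_map N x y f a)"
  proof (rule lin_maps_coinv_factor[where h = "\<lambda>a. \<pi> x (mod_map N x y f a)", OF y module_kan[OF x]])
    show "(\<lambda>a. \<pi> x (mod_map N x y f a)) \<in> lin_maps R (mod_at N y) (mod_at Lan x)"
      by (rule lin_maps_comp[OF cat_module_lin[OF N x y f] coinv_lin[OF x]])
    fix z g g' b assume h: "z \<in> Ob C" "g \<in> Hom C y z" "g' \<in> Hom C y z"
      "fun_mor F y z g = fun_mor F y z g'" "b \<in> carrier (mod_at N z)"
    have "\<pi> x (mod_map N x z (Cmp C g f) b) = \<pi> x (mod_map N x z (Cmp C g' f) b)"
      using h f x y category_Cmp[OF C x y h(1) f] by (intro coinv_fiber) (auto simp: functor_Cmp')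
    then show "\<pi> x (mod_map N x y f (mod_map N y z g b)) = \<pi> x (mod_map N x y f (mod_map N y z g' b))"
      using cat_module_Cmp[OF N x y h(1) f] h by simp
  qed (use a a' in auto)
  finally show ?thesis .
qed

lemma kan_lin_mapsI:
  assumes x: "x \<in> Ob C" and h: "h \<in> lin_maps R (mod_at N x) K"
    and h': "\<And>a. a \<in> carrier (mod_at N x) \<Longrightarrow> h' (\<pi> x a) = h a"
  shows "h' \<in> lin_maps R (mod_at Lan x) K"
proof (rule lin_mapsI)
  interpret N: module R "mod_at N x" by (rule cat_module_at[OF N x])
  show "h' U \<in> carrier K" if "U \<in> carrier (mod_at Lan x)" for U
    using that by (elim kan_cases[OF x]) (simp add: h' lin_maps_closed[OF h])
  show "h' (U \<oplus>\<^bsub>mod_at Lan x\<^esub> V) = h' U \<oplus>\<^bsub>K\<^esub> h' V"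
    if "U \<in> carrier (mod_at Lan x)" "V \<in> carrier (mod_at Lan x)" for U V
    using that
    by (elim kan_cases[OF x]) (simp add: lin_maps_add[OF coinv_lin[OF x], symmetric] h'
        lin_maps_add[OF h])
  show "h' (r \<odot>\<^bsub>mod_at Lan x\<^esub> U) = r \<odot>\<^bsub>K\<^esub> h' U"
    if "r \<in> carrier R" "U \<in> carrier (mod_at Lan x)" for r U
    using that(2,1)
    by (elim kan_cases[OF x]) (simp add: lin_maps_smult[OF coinv_lin[OF x], symmetric] h'
        lin_maps_smult[OF h])
qed

lemma is_cat_module_kan: "is_cat_module R D Lan"
  unfolding is_cat_module_def ob
proof (intro conjI ballI)
  fix x assume "x \<in> Ob C" then show "module R (mod_at Lan x)" by (rule module_kan)
next
  fix x y g assume x: "x \<in> Ob C" and y: "y \<in> Ob C" and g: "g \<in> Hom D x y"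
  obtain f where f: "f \<in> Hom C x y" "g = fun_mor F x y f" using full[OF x y g] by blast
  show "mod_map Lan x y g \<in> lin_maps R (mod_at Lan y) (mod_at Lan x)"
    using lin_maps_comp[OF cat_module_lin[OF N x y f(1)] coinv_lin[OF x]]
    by (rule kan_lin_mapsI[OF y]) (simp add: f kan_map[OF x y])
next
  fix x U assume x: "x \<in> Ob C" and "U \<in> carrier (mod_at Lan x)"
  then obtain a where "a \<in> carrier (mod_at N x)" "U = \<pi> x a" by (metis kan_cases[OF x])
  then show "mod_map Lan x x (Idn D x) U = U"
    using kan_map[OF x x category_Idn[OF C x]] functor_Idn'[OF x] cat_module_Idn[OF N x] by simp
next
  fix x y z g h U assume x: "x \<in> Ob C" and y: "y \<in> Ob C" and z: "z \<in> Ob C"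
    and g: "g \<in> Hom D x y" and h: "h \<in> Hom D y z" and "U \<in> carrier (mod_at Lan z)"
  then obtain a where a: "a \<in> carrier (mod_at N z)" "U = \<pi> z a" by (metis kan_cases[OF z])
  obtain f where f: "f \<in> Hom C x y" "g = fun_mor F x y f" using full[OF x y g] by blast
  obtain k where k: "k \<in> Hom C y z" "h = fun_mor F y z k" using full[OF y z h] by blast
  have "mod_map Lan x z (Cmp D h g) U = \<pi> x (mod_map N x z (Cmp C k f) a)"
    using kan_map[OF x z category_Cmp[OF C x y z f(1) k(1)] a(1)] functor_Cmp'[OF x y z f(1) k(1)] a
        f k by simp
  then show "mod_map Lan x z (Cmp D h g) U = mod_map Lan x y g (mod_map Lan y z h U)"
    using a f k kan_map[OF y z k(1) a(1)] kan_map[OF x y f(1) cat_module_closed[OF N y z k(1) a(1)]]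
      cat_module_Cmp[OF N x y z f(1) k(1) a(1)] by simp
qed

lemma coinv_nat: "\<pi> \<in> nat_trans R C N (res_module F Lan)"
  by (rule nat_transI) (simp_all add: coinv_lin kan_map)

text \<open>On a module restricted along F, morphisms with equal image act equally, so by naturality
  \<theta> x is constant on classes.\<close>

lemma kan_factor:
  assumes K: "is_cat_module R D K" and \<theta>: "\<theta> \<in> nat_trans R C N (res_module F K)"
    and x: "x \<in> Ob C" and a: "a \<in> carrier (mod_at N x)"
  shows "kan_factor C F N \<theta> x (\<pi> x a) = \<theta> x a"
proof -
  define a' where "a' = (SOME a'. a' \<in> carrier (mod_at N x) \<and> \<pi> x a' = \<pi> x a)"
  have a': "a' \<in> carrier (mod_at N x) \<and> \<pi> x a' = \<pi> x a"
    unfolding a'_def by (rule someI[of _ a]) (use a in auto)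
  have "\<theta> x a' = \<theta> x a"
  proof (rule lin_maps_coinv_factor[OF x])
    show "module R (mod_at K x)" using cat_module_at[OF K] x ob by simp
    show "\<theta> x \<in> lin_maps R (mod_at N x) (mod_at K x)" using nat_trans_lin[OF \<theta> x] by simp
    show "\<pi> x a' = \<pi> x a" using a' by simp
  qed (use nat_trans_nat[OF \<theta> x] a a' in auto)
  then show ?thesis by (simp add: kan_factor_def a'_def)
qed

lemma kan_factor_nat:
  assumes K: "is_cat_module R D K" and \<theta>: "\<theta> \<in> nat_trans R C N (res_module F K)"
  shows "kan_factor C F N \<theta> \<in> nat_trans R D Lan K"
proof (rule nat_transI, unfold ob)
  fix x assume x: "x \<in> Ob C"
  show "kan_factor C F N \<theta> x \<in> lin_maps R (mod_at Lan x) (mod_at K x)"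
    using kan_lin_mapsI[OF x nat_trans_lin[OF \<theta> x] kan_factor[OF K \<theta> x]] by simp
next
  fix x y g U assume x: "x \<in> Ob C" and y: "y \<in> Ob C" and g: "g \<in> Hom D x y" and
      "U \<in> carrier (mod_at Lan y)"
  then obtain a where a: "a \<in> carrier (mod_at N y)" "U = \<pi> y a" by (metis kan_cases[OF y])
  obtain f where f: "f \<in> Hom C x y" "g = fun_mor F x y f" using full[OF x y g] by blast
  show "kan_factor C F N \<theta> x (mod_map Lan x y g U) = mod_map K x y g (kan_factor C F N \<theta> y U)"
    using a f nat_trans_nat[OF \<theta> x y f(1) a(1)]
    by (simp add: kan_map[OF x y] kan_factor[OF K \<theta>] x y cat_module_closed[OF N x y])
qed

end

end

section \<open>The Kan extension of a resolution of the constant module\<close>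

context full_functor begin

context
  fixes R :: "'r ring" and Q :: "('o, 'm, 'r, 'a, 'r) resolution"
  assumes R: "cring R" and Q: "exact_resolution R C (const_module R) Q"
begin

lemma kan_trm: "trm (kan_resolution C F Q) n = kan_module C F (trm Q n)"
  by (simp add: kan_resolution_def)

lemma kan_resolution_lifts:
  "(\<lambda>x a. coinv C F (trm Q n) x (diff Q n x a))
     \<in> nat_trans R C (trm Q (Suc n)) (res_module F (kan_module C F (trm Q n)))"
  "aug Q \<in> nat_trans R C (trm Q 0) (res_module F (const_module R))"
  using nat_trans_comp[OF exact_diff[OF Q] coinv_nat[OF exact_trm[OF Q]]] exact_aug[OF Q]
  by (simp_all add: res_const_module)

lemma kan_diff_nat: "diff (kan_resolution C F Q) n
    \<in> nat_trans R D (kan_module C F (trm Q (Suc n))) (kan_module C F (trm Q n))"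
  using kan_factor_nat[OF exact_trm[OF Q] is_cat_module_kan[OF exact_trm[OF Q]] kan_resolution_lifts(1)]
  by (simp add: kan_resolution_def)

lemma kan_aug_nat: "aug (kan_resolution C F Q) \<in> nat_trans R D (kan_module C F (trm Q 0))
    (const_module R)"
  using kan_factor_nat[OF exact_trm[OF Q] is_cat_module_const_module[OF R] kan_resolution_lifts(2)]
  by (simp add: kan_resolution_def)

lemma kan_diff_coinv:
  "x \<in> Ob C \<Longrightarrow> a \<in> carrier (mod_at (trm Q (Suc n)) x) \<Longrightarrow>
     diff (kan_resolution C F Q) n x (coinv C F (trm Q (Suc n)) x a) = coinv C F (trm Q n) x (diff Q
         n x a)"
  using kan_factor[OF exact_trm[OF Q] is_cat_module_kan[OF exact_trm[OF Q]] kan_resolution_lifts(1)]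
  by (simp add: kan_resolution_def)

lemma kan_aug_coinv:
  "x \<in> Ob C \<Longrightarrow> a \<in> carrier (mod_at (trm Q 0) x) \<Longrightarrow>
     aug (kan_resolution C F Q) x (coinv C F (trm Q 0) x a) = aug Q x a"
  using kan_factor[OF exact_trm[OF Q] is_cat_module_const_module[OF R] kan_resolution_lifts(2)]
  by (simp add: kan_resolution_def)

text \<open>On classes the augmentation is that of Q, so its kernel consists of classes of
  boundaries and degree 0 is automatic. This is why \<open>acyclic\<close> speaks of positive
  degrees only.\<close>

lemma exact_kan_resolution:
  assumes acyclic: "\<And>n x z. x \<in> Ob C \<Longrightarrow> z \<in> carrier (mod_at (trm Q (Suc n)) x) \<Longrightarrow>
      diff Q n x z \<in> fiber_span C F (trm Q n) x \<Longrightarrow>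
      \<exists>w\<in>carrier (mod_at (trm Q (Suc (Suc n))) x).
        z \<ominus>\<^bsub>mod_at (trm Q (Suc n)) x\<^esub> diff Q (Suc n) x w \<in> fiber_span C F (trm Q (Suc n)) x"
  shows "exact_resolution R D (const_module R) (kan_resolution C F Q)"
proof -
  note QN = exact_trm[OF Q]
  define pi where "pi n = coinv C F (trm Q n)" for n
  define dK where "dK = diff (kan_resolution C F Q)"
  define aK where "aK = aug (kan_resolution C F Q)"
  note dK = kan_diff_coinv[folded pi_def dK_def] and aK = kan_aug_coinv[folded pi_def aK_def]
  have car: "carrier (mod_at (kan_module C F (trm Q n)) x) = pi n x ` carrier (mod_at (trm Q n) x)"
    if "x \<in> Ob C" for n x
    using kan_carrier[OF QN that] by (simp add: pi_def)
  have zero: "\<zero>\<^bsub>mod_at (kan_module C F (trm Q n)) x\<^esub> = pi n x a \<longleftrightarrow> a \<in> fiber_span C F (trm Q n) x"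
    if "x \<in> Ob C" "a \<in> carrier (mod_at (trm Q n) x)" for n x a
    using coinv_zero_iff[OF QN that] by (auto simp: pi_def)
  have cK: "mod_at (const_module R :: ('o, 'm, 'r, 'r) cat_module) x = mod_at (const_module R ::
      ('o, 'n, 'r, 'r) cat_module) x" for x
    by (simp add: const_module_def)
  note dc = exact_closed[OF Q]
  have imd: "dK n x ` carrier (mod_at (kan_module C F (trm Q (Suc n))) x) = (\<lambda>a. pi n x (diff Q n x
      a)) ` carrier (mod_at (trm Q (Suc n)) x)"
    if "x \<in> Ob C" for n x
    using dK[OF that] by (auto simp: car[OF that] image_image)
  let ?k = "const_module R :: ('o, 'n, 'r, 'r) cat_module"
  have ex0: "dK 0 x ` carrier (mod_at (kan_module C F (trm Q (Suc 0))) x)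
      = a_kernel (mod_at (kan_module C F (trm Q 0)) x) (mod_at ?k x) (aK x)" if x: "x \<in> Ob C" for x
  proof -
    have iff: "aug Q x a = \<zero>\<^bsub>mod_at ?k x\<^esub> \<longleftrightarrow> a \<in> diff Q 0 x ` carrier (mod_at (trm Q (Suc 0)) x)"
      if "a \<in> carrier (mod_at (trm Q 0) x)" for a
      using exact_at_0[OF Q x that] by (simp add: cK)
    show ?thesis
    proof (intro equalityI subsetI)
      fix U assume "U \<in> dK 0 x ` carrier (mod_at (kan_module C F (trm Q (Suc 0))) x)"
      then obtain a where a: "a \<in> carrier (mod_at (trm Q (Suc 0)) x)" "U = pi 0 x (diff Q 0 x a)"
        unfolding imd[OF x] by blast
      then show "U \<in> a_kernel (mod_at (kan_module C F (trm Q 0)) x) (mod_at ?k x) (aK x)"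
        using dc[OF x a(1)] iff[OF dc[OF x a(1)]] by (simp add: a_kernel_def' car[OF x] aK[OF x])
    next
      fix U assume "U \<in> a_kernel (mod_at (kan_module C F (trm Q 0)) x) (mod_at ?k x) (aK x)"
      then obtain a where "a \<in> carrier (mod_at (trm Q 0) x)" "U = pi 0 x a"
        "aug Q x a = \<zero>\<^bsub>mod_at ?k x\<^esub>"
        by (auto simp: a_kernel_def' car[OF x] aK[OF x])
      then show "U \<in> dK 0 x ` carrier (mod_at (kan_module C F (trm Q (Suc 0))) x)"
        using iff unfolding imd[OF x] by blast
    qed
  qed
  have exS: "dK (Suc n) x ` carrier (mod_at (kan_module C F (trm Q (Suc (Suc n)))) x)
      = a_kernel (mod_at (kan_module C F (trm Q (Suc n))) x) (mod_at (kan_module C F (trm Q n)) x)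
          (dK n x)"
    if x: "x \<in> Ob C" for x n
  proof (intro equalityI subsetI)
    fix U assume "U \<in> dK (Suc n) x ` carrier (mod_at (kan_module C F (trm Q (Suc (Suc n)))) x)"
    then obtain a where a: "a \<in> carrier (mod_at (trm Q (Suc (Suc n))) x)"
        "U = pi (Suc n) x (diff Q (Suc n) x a)"
      by (auto simp: imd[OF x])
    then have "dK n x U = pi n x \<zero>\<^bsub>mod_at (trm Q n) x\<^esub>"
      using dK[OF x dc[OF x a(1)]] exact_diff_diff[OF Q x a(1)] by simp
    also have "\<dots> = \<zero>\<^bsub>mod_at (kan_module C F (trm Q n)) x\<^esub>"
      using lin_maps_zero[OF cat_module_at[OF QN x] module_kan[OF QN x] coinv_lin[OF QN x]] by (simp
          add: pi_def)
    finally show "U \<in> a_kernel (mod_at (kan_module C F (trm Q (Suc n))) x) (mod_at (kan_module C F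
        (trm Q n)) x) (dK n x)"
      using a dc[OF x] by (auto simp: a_kernel_def' car[OF x])
  next
    fix U assume "U \<in> a_kernel (mod_at (kan_module C F (trm Q (Suc n))) x) (mod_at (kan_module C F
        (trm Q n)) x) (dK n x)"
    then obtain z where z: "z \<in> carrier (mod_at (trm Q (Suc n)) x)" "U = pi (Suc n) x z"
      and 0: "dK n x U = \<zero>\<^bsub>mod_at (kan_module C F (trm Q n)) x\<^esub>"
      by (auto simp: a_kernel_def' car[OF x])
    have "diff Q n x z \<in> fiber_span C F (trm Q n) x"
      using 0 dK[OF x z(1)] zero[OF x dc[OF x z(1)]] z(2) by simp
    from acyclic[OF x z(1) this] obtain w where w: "w \<in> carrier (mod_at (trm Q (Suc (Suc n))) x)"
      "z \<ominus>\<^bsub>mod_at (trm Q (Suc n)) x\<^esub> diff Q (Suc n) x w \<in> fiber_span C F (trm Q (Suc n)) x" by blast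
    then have "U = pi (Suc n) x (diff Q (Suc n) x w)"
      using coinv_eq_iff[OF QN x z(1) dc[OF x w(1)]] z(2) by (simp add: pi_def)
    then show "U \<in> dK (Suc n) x ` carrier (mod_at (kan_module C F (trm Q (Suc (Suc n)))) x)"
      using w(1) by (auto simp: imd[OF x])
  qed
  have surj: "aK x ` carrier (mod_at (kan_module C F (trm Q 0)) x) = carrier (mod_at ?k x)"
    if x: "x \<in> Ob C" for x
    using exact_aug_surj[OF Q x] aK[OF x] by (simp add: car[OF x] image_image cK)
  show ?thesis
    unfolding exact_resolution_def is_epi_def kan_trm ob dK_def[symmetric] aK_def[symmetric]
    using is_cat_module_kan[OF QN] is_cat_module_const_module[OF R] kan_diff_nat kan_aug_nat ex0 exS
        surj
    by (simp add: dK_def aK_def)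
qed

end

end

section \<open>Cohomology\<close>

lemma submodule_kernel:
  assumes "module R M" "module R N" "h \<in> lin_maps R M N"
  shows "submodule (a_kernel M N h) R M"
proof -
  interpret M: module R M by fact
  interpret N: module R N by fact
  show ?thesis
    by (rule M.submoduleI)
      (auto simp: a_kernel_def' lin_maps_zero[OF assms] lin_maps_uminus[OF assms] lin_maps_add[OF
          assms(3)]
         lin_maps_smult[OF assms(3)])
qed

lemma submodule_image:
  assumes "module R M" "module R N" "h \<in> lin_maps R M N"
  shows "submodule (h ` carrier M) R N"
proof -
  interpret M: module R M by fact
  interpret N: module R N by fact
  show ?thesis
  proof (rule N.submoduleI)
    show "\<zero>\<^bsub>N\<^esub> \<in> h ` carrier M" using lin_maps_zero[OF assms] by (metis M.M.zero_closed imageI)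
  qed (auto simp: lin_maps_closed[OF assms(3)] lin_maps_uminus[OF assms, symmetric]
      lin_maps_add[OF assms(3), symmetric] lin_maps_smult[OF assms(3), symmetric])
qed

lemma submodule_restrict:
  assumes "module R M" "submodule B R M" "submodule Z R M" "B \<subseteq> Z"
  shows "submodule B R (M\<lparr>carrier := Z\<rparr>)"
proof -
  interpret M: module R M by fact
  interpret Z: module R "M\<lparr>carrier := Z\<rparr>" by (rule submodule.submodule_is_module[OF assms(3,1)])
  have "module R (M\<lparr>carrier := B\<rparr>)" by (rule submodule.submodule_is_module[OF assms(2,1)])
  then show ?thesis using Z.module_incl_imp_submodule[of B] assms(4) by simp
qed

locale cochain_complex =
  fixes R :: "'r ring" and K :: "nat \<Rightarrow> ('r, 'a) module" and \<delta> :: "nat \<Rightarrow> 'a \<Rightarrow> 'a"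
  assumes K: "module R (K n)" and \<delta>: "\<delta> n \<in> lin_maps R (K n) (K (Suc n))"
    and \<delta>\<delta>: "a \<in> carrier (K n) \<Longrightarrow> \<delta> (Suc n) (\<delta> n a) = \<zero>\<^bsub>K (Suc (Suc n))\<^esub>"
begin

lemma cocycles_iff: "a \<in> cocycles K \<delta> n \<longleftrightarrow> a \<in> carrier (K n) \<and> \<delta> n a = \<zero>\<^bsub>K (Suc n)\<^esub>"
  by (simp add: cocycles_def a_kernel_def')

lemma coboundaries_submodule: "submodule (coboundaries K \<delta> n) R (K n)"
proof (cases n)
  case 0
  interpret module R "K 0" by (rule K)
  show ?thesis unfolding 0 coboundaries_def
  proof (simp, rule submoduleI)
    fix a assume "a \<in> {\<zero>\<^bsub>K 0\<^esub>}"
    then show "\<ominus>\<^bsub>K 0\<^esub> a \<in> {\<zero>\<^bsub>K 0\<^esub>}"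
      by (metis M.l_zero M.r_neg M.a_inv_closed M.zero_closed singletonD singletonI)
  qed auto
qed (simp add: coboundaries_def submodule_image[OF K K \<delta>])

lemma coboundaries_subset: "coboundaries K \<delta> n \<subseteq> cocycles K \<delta> n"
proof (cases n)
  case 0
  interpret module R "K 0" by (rule K)
  show ?thesis using lin_maps_zero[OF K K \<delta>] by (simp add: 0 coboundaries_def cocycles_iff)
qed (auto simp: coboundaries_def cocycles_iff lin_maps_closed[OF \<delta>] \<delta>\<delta>)

sublocale coh: module_quotient R "(K n)\<lparr>carrier := cocycles K \<delta> n\<rparr>" "coboundaries K \<delta> n" for n
proof (intro module_quotient.intro module_quotient_axioms.intro)
  have Z: "submodule (cocycles K \<delta> n) R (K n)"
    unfolding cocycles_def by (rule submodule_kernel[OF K K \<delta>])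
  show "module R ((K n)\<lparr>carrier := cocycles K \<delta> n\<rparr>)"
    by (rule submodule.submodule_is_module[OF Z K])
  show "submodule (coboundaries K \<delta> n) R ((K n)\<lparr>carrier := cocycles K \<delta> n\<rparr>)"
    by (rule submodule_restrict[OF K coboundaries_submodule Z coboundaries_subset])
qed

definition "cls n = quot_proj ((K n)\<lparr>carrier := cocycles K \<delta> n\<rparr>) (coboundaries K \<delta> n)"

lemma cls_def': "cls n z = {b \<oplus>\<^bsub>K n\<^esub> z | b. b \<in> coboundaries K \<delta> n}"
  by (auto simp: cls_def quot_proj_def a_r_coset_def')

lemma cohomology_carrier: "carrier (cohomology K \<delta> n) = cls n ` cocycles K \<delta> n"
  using coh.quot_carrier[of n] by (simp add: cohomology_def cls_def)

lemma cls_add: "z \<in> cocycles K \<delta> n \<Longrightarrow> w \<in> cocycles K \<delta> n \<Longrightarrow>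
    cls n (z \<oplus>\<^bsub>K n\<^esub> w) = cls n z \<oplus>\<^bsub>cohomology K \<delta> n\<^esub> cls n w"
  using coh.quot_proj_add[of z n w] by (simp add: cohomology_def cls_def)

lemma cls_smult: "r \<in> carrier R \<Longrightarrow> z \<in> cocycles K \<delta> n \<Longrightarrow>
    cls n (r \<odot>\<^bsub>K n\<^esub> z) = r \<odot>\<^bsub>cohomology K \<delta> n\<^esub> cls n z"
  using coh.quot_proj_smult[of r z n] by (simp add: cohomology_def cls_def)

lemma cocycles_closed:
  "z \<in> cocycles K \<delta> n \<Longrightarrow> w \<in> cocycles K \<delta> n \<Longrightarrow> z \<oplus>\<^bsub>K n\<^esub> w \<in> cocycles K \<delta> n"
  "r \<in> carrier R \<Longrightarrow> z \<in> cocycles K \<delta> n \<Longrightarrow> r \<odot>\<^bsub>K n\<^esub> z \<in> cocycles K \<delta> n"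
  "z \<in> cocycles K \<delta> n \<Longrightarrow> w \<in> cocycles K \<delta> n \<Longrightarrow> z \<ominus>\<^bsub>K n\<^esub> w \<in> cocycles K \<delta> n"
proof -
  interpret module R "K n" by (rule K)
  interpret M': module R "K (Suc n)" by (rule K)
  show "z \<in> cocycles K \<delta> n \<Longrightarrow> w \<in> cocycles K \<delta> n \<Longrightarrow> z \<oplus>\<^bsub>K n\<^esub> w \<in> cocycles K \<delta> n"
    "r \<in> carrier R \<Longrightarrow> z \<in> cocycles K \<delta> n \<Longrightarrow> r \<odot>\<^bsub>K n\<^esub> z \<in> cocycles K \<delta> n"
    "z \<in> cocycles K \<delta> n \<Longrightarrow> w \<in> cocycles K \<delta> n \<Longrightarrow> z \<ominus>\<^bsub>K n\<^esub> w \<in> cocycles K \<delta> n"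
    by (auto simp: cocycles_iff lin_maps_add[OF \<delta>] lin_maps_smult[OF \<delta>] lin_maps_diff[OF K K \<delta>]
      M'.M.minus_eq_zero_iff)
qed

lemma cls_eq_iff:
  assumes z: "z \<in> cocycles K \<delta> n" "w \<in> cocycles K \<delta> n"
  shows "cls n z = cls n w \<longleftrightarrow> z \<ominus>\<^bsub>K n\<^esub> w \<in> coboundaries K \<delta> n"
proof -
  interpret module R "K n" by (rule K)
  have sub: "submodule (cocycles K \<delta> n) R (K n)"
    unfolding cocycles_def by (rule submodule_kernel[OF K K \<delta>])
  \<comment> \<open>The additive inverse of a record is taken relative to its carrier, so
    subtraction in the module of cocycles has to be compared with that in K n.\<close>
  have "z \<ominus>\<^bsub>(K n)\<lparr>carrier := cocycles K \<delta> n\<rparr>\<^esub> w = z \<ominus>\<^bsub>K n\<^esub> w"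
  proof -
    have "subgroup (cocycles K \<delta> n) (add_monoid (K n))" using sub by (simp add: submodule_def)
    then have "inv\<^bsub>(add_monoid (K n))\<lparr>carrier := cocycles K \<delta> n\<rparr>\<^esub> w = inv\<^bsub>add_monoid (K n)\<^esub> w"
      using M.add.m_inv_consistent[of "cocycles K \<delta> n" w] z by (simp add: a_inv_def)
    then show ?thesis by (simp add: a_minus_def a_inv_def)
  qed
  then show ?thesis using coh.quot_proj_eq_iff[of z n w] z by (simp add: cls_def)
qed

end

text \<open>The hypotheses speak of representatives, so that later only identities between cochains
  remain: \<open>inj\<close> says that the kernel on classes is trivial, and \<open>surj\<close>
  asks for preimages up to coboundaries.\<close>

lemma cohomology_map_iso:
  assumes K: "cochain_complex R K \<delta>" and K': "cochain_complex R K' \<delta>'"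
    and h: "\<And>n. h n \<in> lin_maps R (K n) (K' n)"
    and hd: "\<And>n a. a \<in> carrier (K n) \<Longrightarrow> \<delta>' n (h n a) = h (Suc n) (\<delta> n a)"
    and inj: "\<And>z. z \<in> cocycles K \<delta> n \<Longrightarrow> h n z \<in> coboundaries K' \<delta>' n \<Longrightarrow> z \<in> coboundaries K \<delta> n"
    and surj: "\<And>w. w \<in> cocycles K' \<delta>' n \<Longrightarrow>
      \<exists>z\<in>cocycles K \<delta> n. h n z \<ominus>\<^bsub>K' n\<^esub> w \<in> coboundaries K' \<delta>' n"
  shows "cohomology_map K' \<delta>' n (h n) \<in> lin_isos R (cohomology K \<delta> n) (cohomology K' \<delta>' n)"
proof -
  interpret K: cochain_complex R K \<delta> by fact
  interpret K': cochain_complex R K' \<delta>' by fact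
  interpret Kn: module R "K n" by (rule K.K)
  interpret Kn': module R "K' n" by (rule K'.K)
  let ?H = "cohomology_map K' \<delta>' n (h n)"
  have hz: "h n z \<in> cocycles K' \<delta>' n" if "z \<in> cocycles K \<delta> n" for z
    using that lin_maps_closed[OF h] hd lin_maps_zero[OF K.K K'.K h]
    by (auto simp: K.cocycles_iff K'.cocycles_iff)
  have hb: "h n b \<in> coboundaries K' \<delta>' n" if b: "b \<in> coboundaries K \<delta> n" for b
  proof (cases n)
    case 0
    then show ?thesis using b lin_maps_zero[OF K.K K'.K h] by (simp add: coboundaries_def)
  next
    case (Suc m)
    then obtain a where a: "a \<in> carrier (K m)" "b = \<delta> m a"
      using b unfolding coboundaries_def Suc by auto
    then have "h n b = \<delta>' m (h m a)" using hd Suc by simp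
    then show ?thesis using lin_maps_closed[OF h a(1)] Suc by (simp add: coboundaries_def)
  qed
  note B' = Kn'.submoduleE[OF K'.coboundaries_submodule[of n]]
  note B = Kn.submoduleE[OF K.coboundaries_submodule[of n]]
  \<comment> \<open>\<open>cohomology_map\<close> acts on whole classes. One inclusion absorbs the
    images of coboundaries; the other uses that z lies in its own class.\<close>
  have H: "?H (K.cls n z) = K'.cls n (h n z)" if z: "z \<in> cocycles K \<delta> n" for z
  proof -
    have zc: "z \<in> carrier (K n)" using z by (simp add: K.cocycles_iff)
    note hzc = lin_maps_closed[OF h zc]
    show ?thesis
    proof (intro equalityI subsetI)
      fix u assume "u \<in> ?H (K.cls n z)"
      then obtain b' b where b: "b' \<in> coboundaries K' \<delta>' n" "b \<in> coboundaries K \<delta> n"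
        "u = b' \<oplus>\<^bsub>K' n\<^esub> h n (b \<oplus>\<^bsub>K n\<^esub> z)"
        by (auto simp: cohomology_map_def set_add_def' K.cls_def')
      then have "u = (b' \<oplus>\<^bsub>K' n\<^esub> h n b) \<oplus>\<^bsub>K' n\<^esub> h n z"
        using B(1) B'(1) hb[of b] zc hzc by (subst Kn'.M.a_assoc) (auto simp: lin_maps_add[OF h]
            subset_iff)
      then show "u \<in> K'.cls n (h n z)" using B'(5) b hb by (auto simp: K'.cls_def')
    next
      fix u assume "u \<in> K'.cls n (h n z)"
      then obtain b' where b: "b' \<in> coboundaries K' \<delta>' n" "u = b' \<oplus>\<^bsub>K' n\<^esub> h n z" by (auto simp:
          K'.cls_def')
      have "\<zero>\<^bsub>K n\<^esub> \<in> coboundaries K \<delta> n"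
        using K.coboundaries_submodule[of n] Kn.submoduleE(2,4) by (metis B(1,3,5) Kn.M.r_neg
            ex_in_conv subsetD)
      then have "\<zero>\<^bsub>K n\<^esub> \<oplus>\<^bsub>K n\<^esub> z \<in> K.cls n z" unfolding K.cls_def' by blast
      then have "z \<in> K.cls n z" using zc by simp
      then show "u \<in> ?H (K.cls n z)" using b by (auto simp: cohomology_map_def set_add_def')
    qed
  qed
  have zc: "z \<in> carrier (K n)" if "z \<in> cocycles K \<delta> n" for z using that by (simp add: K.cocycles_iff)
  show ?thesis
    unfolding lin_isos_def mem_Collect_eq
  proof
    show "?H \<in> lin_maps R (cohomology K \<delta> n) (cohomology K' \<delta>' n)"
      by (rule lin_mapsI) (auto simp: K.cohomology_carrier K'.cohomology_carrier H hz K.cocycles_closed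
         lin_maps_add[OF h] lin_maps_smult[OF h] zc simp flip: K.cls_add K.cls_smult K'.cls_add
             K'.cls_smult)
    show "bij_betw ?H (carrier (cohomology K \<delta> n)) (carrier (cohomology K' \<delta>' n))"
      unfolding bij_betw_def
    proof
      show "inj_on ?H (carrier (cohomology K \<delta> n))"
      proof (rule inj_onI)
        fix U V assume "U \<in> carrier (cohomology K \<delta> n)" "V \<in> carrier (cohomology K \<delta> n)" and e:
            "?H U = ?H V"
        then obtain z w where z: "z \<in> cocycles K \<delta> n" "U = K.cls n z" and w: "w \<in> cocycles K \<delta> n"
            "V = K.cls n w"
          by (auto simp: K.cohomology_carrier)
        have "h n z \<ominus>\<^bsub>K' n\<^esub> h n w \<in> coboundaries K' \<delta>' n"
          using e z w by (simp add: H K'.cls_eq_iff hz)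
        then have "h n (z \<ominus>\<^bsub>K n\<^esub> w) \<in> coboundaries K' \<delta>' n"
          using z w by (simp add: lin_maps_diff[OF K.K K'.K h] zc)
        then show "U = V"
          using inj K.cocycles_closed(3) z w by (simp add: K.cls_eq_iff)
      qed
      show "?H ` carrier (cohomology K \<delta> n) = carrier (cohomology K' \<delta>' n)"
      proof (intro equalityI subsetI)
        fix V assume "V \<in> carrier (cohomology K' \<delta>' n)"
        then obtain w where w: "w \<in> cocycles K' \<delta>' n" "V = K'.cls n w" by (auto simp:
            K'.cohomology_carrier)
        from surj[OF w(1)] obtain z where z: "z \<in> cocycles K \<delta> n"
            "h n z \<ominus>\<^bsub>K' n\<^esub> w \<in> coboundaries K' \<delta>' n" by blast
        then have "K'.cls n (h n z) = K'.cls n w" using w by (simp add: K'.cls_eq_iff hz)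
        then have "V = ?H (K.cls n z)" using w z by (simp add: H)
        then show "V \<in> ?H ` carrier (cohomology K \<delta> n)" using z by (auto simp: K.cohomology_carrier)
      qed (auto simp: K.cohomology_carrier K'.cohomology_carrier H hz)
    qed
  qed
qed

section \<open>Modules of natural transformations\<close>

lemma nat_trans_add:
  assumes "is_cat_module R C N" "\<eta> \<in> nat_trans R C M N" "\<theta> \<in> nat_trans R C M N"
  shows "(\<lambda>x a. \<eta> x a \<oplus>\<^bsub>mod_at N x\<^esub> \<theta> x a) \<in> nat_trans R C M N"
proof (rule nat_transI)
  fix x assume x: "x \<in> Ob C"
  interpret module R "mod_at N x" by (rule cat_module_at[OF assms(1) x])
  show "(\<lambda>a. \<eta> x a \<oplus>\<^bsub>mod_at N x\<^esub> \<theta> x a) \<in> lin_maps R (mod_at M x) (mod_at N x)"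
    using nat_trans_lin[OF assms(2) x] nat_trans_lin[OF assms(3) x]
    by (intro lin_mapsI) (auto simp: lin_maps_closed lin_maps_add lin_maps_smult smult_r_distr M.a_ac)
next
  fix x y f a assume h: "x \<in> Ob C" "y \<in> Ob C" "f \<in> Hom C x y" "a \<in> carrier (mod_at M y)"
  then show "\<eta> x (mod_map M x y f a) \<oplus>\<^bsub>mod_at N x\<^esub> \<theta> x (mod_map M x y f a) =
       mod_map N x y f (\<eta> y a \<oplus>\<^bsub>mod_at N y\<^esub> \<theta> y a)"
    using assms lin_maps_add[OF cat_module_lin[OF assms(1)]]
    by (simp add: nat_trans_nat nat_trans_closed)
qed

lemma nat_trans_smult:
  assumes "is_cat_module R C N" "\<eta> \<in> nat_trans R C M N" "r \<in> carrier R"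
  shows "(\<lambda>x a. r \<odot>\<^bsub>mod_at N x\<^esub> \<eta> x a) \<in> nat_trans R C M N"
proof (rule nat_transI)
  fix x assume x: "x \<in> Ob C"
  interpret module R "mod_at N x" by (rule cat_module_at[OF assms(1) x])
  show "(\<lambda>a. r \<odot>\<^bsub>mod_at N x\<^esub> \<eta> x a) \<in> lin_maps R (mod_at M x) (mod_at N x)"
    using nat_trans_lin[OF assms(2) x] assms(3)
    by (intro lin_mapsI)
      (auto simp: lin_maps_closed lin_maps_add lin_maps_smult smult_r_distr R.m_comm
          smult_assoc1[symmetric])
next
  fix x y f a assume h: "x \<in> Ob C" "y \<in> Ob C" "f \<in> Hom C x y" "a \<in> carrier (mod_at M y)"
  then show "r \<odot>\<^bsub>mod_at N x\<^esub> \<eta> x (mod_map M x y f a) = mod_map N x y f (r \<odot>\<^bsub>mod_at N y\<^esub> \<eta> y a)"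
    using assms lin_maps_smult[OF cat_module_lin[OF assms(1)]]
    by (simp add: nat_trans_nat nat_trans_closed)
qed

lemma zero_nat_trans:
  assumes "is_cat_module R C N"
  shows "(\<lambda>x a. \<zero>\<^bsub>mod_at N x\<^esub>) \<in> nat_trans R C M N"
proof (rule nat_transI)
  fix x assume x: "x \<in> Ob C"
  interpret module R "mod_at N x" by (rule cat_module_at[OF assms(1) x])
  show "(\<lambda>a. \<zero>\<^bsub>mod_at N x\<^esub>) \<in> lin_maps R (mod_at M x) (mod_at N x)"
    by (intro lin_mapsI) auto
next
  fix x y f a assume h: "x \<in> Ob C" "y \<in> Ob C" "f \<in> Hom C x y"
  then show "\<zero>\<^bsub>mod_at N x\<^esub> = mod_map N x y f \<zero>\<^bsub>mod_at N y\<^esub>"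
    using lin_maps_zero[OF cat_module_at[OF assms h(2)] cat_module_at[OF assms h(1)]
        cat_module_lin[OF assms h]] by simp
qed

text \<open>The extensional form of a natural transformation that membership in
  \<open>hom_module\<close> demands.\<close>

definition restrict_trans ::
    "('o, 'm) cat \<Rightarrow> ('o, 'm, 'r, 'a) cat_module \<Rightarrow> ('o \<Rightarrow> 'a \<Rightarrow> 'b) \<Rightarrow> 'o \<Rightarrow> 'a \<Rightarrow> 'b" where
  "restrict_trans C M \<eta> = (\<lambda>x\<in>Ob C. \<lambda>a\<in>carrier (mod_at M x). \<eta> x a)"

lemma restrict_trans_eval [simp]:
  "x \<in> Ob C \<Longrightarrow> a \<in> carrier (mod_at M x) \<Longrightarrow> restrict_trans C M \<eta> x a = \<eta> x a"
  by (simp add: restrict_trans_def)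

context
  fixes R :: "'r ring" and C :: "('o, 'm) cat" and M :: "('o, 'm, 'r, 'a) cat_module"
    and N :: "('o, 'm, 'r, 'b) cat_module"
  assumes M: "is_cat_module R C M" and N: "is_cat_module R C N"
begin

lemma hom_moduleD: "\<eta> \<in> carrier (hom_module R C M N) \<Longrightarrow> \<eta> \<in> nat_trans R C M N"
  by (simp add: hom_module_def)

lemma restrict_trans_carrier:
  assumes "\<eta> \<in> nat_trans R C M N"
  shows "restrict_trans C M \<eta> \<in> carrier (hom_module R C M N)"
proof -
  have "restrict_trans C M \<eta> \<in> nat_trans R C M N"
  proof (rule nat_transI)
    fix x assume x: "x \<in> Ob C"
    interpret module R "mod_at M x" by (rule cat_module_at[OF M x])
    show "restrict_trans C M \<eta> x \<in> lin_maps R (mod_at M x) (mod_at N x)"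
      using nat_trans_lin[OF assms x] x
      by (intro lin_mapsI) (auto simp: lin_maps_closed lin_maps_add lin_maps_smult)
  qed (simp add: nat_trans_nat[OF assms] cat_module_closed[OF M])
  then show ?thesis by (auto simp: hom_module_def restrict_trans_def)
qed

lemma hom_module_ext:
  assumes "\<eta> \<in> carrier (hom_module R C M N)" "\<theta> \<in> carrier (hom_module R C M N)"
    and "\<And>x a. x \<in> Ob C \<Longrightarrow> a \<in> carrier (mod_at M x) \<Longrightarrow> \<eta> x a = \<theta> x a"
  shows "\<eta> = \<theta>"
proof -
  have "\<eta> \<in> (\<Pi>\<^sub>E x\<in>Ob C. extensional (carrier (mod_at M x)))"
      "\<theta> \<in> (\<Pi>\<^sub>E x\<in>Ob C. extensional (carrier (mod_at M x)))"
    using assms(1,2) by (simp_all add: hom_module_def)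
  then show ?thesis
  proof (rule PiE_ext)
    fix x assume x: "x \<in> Ob C"
    have "\<eta> x \<in> extensional (carrier (mod_at M x))" "\<theta> x \<in> extensional (carrier (mod_at M x))"
      using assms(1,2) x by (auto simp: hom_module_def PiE_iff)
    then show "\<eta> x = \<theta> x" by (rule extensionalityI) (rule assms(3)[OF x])
  qed
qed

lemma hom_module_sel:
  "\<eta> \<oplus>\<^bsub>hom_module R C M N\<^esub> \<theta> = restrict_trans C M (\<lambda>x a. \<eta> x a \<oplus>\<^bsub>mod_at N x\<^esub> \<theta> x a)"
  "r \<odot>\<^bsub>hom_module R C M N\<^esub> \<eta> = restrict_trans C M (\<lambda>x a. r \<odot>\<^bsub>mod_at N x\<^esub> \<eta> x a)"
  "\<zero>\<^bsub>hom_module R C M N\<^esub> = restrict_trans C M (\<lambda>x a. \<zero>\<^bsub>mod_at N x\<^esub>)"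
  by (simp_all add: hom_module_def restrict_trans_def)

lemma hom_module_closed:
  "\<eta> \<in> carrier (hom_module R C M N) \<Longrightarrow> \<theta> \<in> carrier (hom_module R C M N) \<Longrightarrow>
     \<eta> \<oplus>\<^bsub>hom_module R C M N\<^esub> \<theta> \<in> carrier (hom_module R C M N)"
  "r \<in> carrier R \<Longrightarrow> \<eta> \<in> carrier (hom_module R C M N) \<Longrightarrow>
     r \<odot>\<^bsub>hom_module R C M N\<^esub> \<eta> \<in> carrier (hom_module R C M N)"
  "\<zero>\<^bsub>hom_module R C M N\<^esub> \<in> carrier (hom_module R C M N)"
  unfolding hom_module_sel
  by (rule restrict_trans_carrier nat_trans_add[OF N] nat_trans_smult[OF N] zero_nat_trans[OF N]
      hom_moduleD | assumption)+

lemma hom_module_eval_closed: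
  "\<eta> \<in> carrier (hom_module R C M N) \<Longrightarrow> x \<in> Ob C \<Longrightarrow> a \<in> carrier (mod_at M x) \<Longrightarrow>
      \<eta> x a \<in> carrier (mod_at N x)"
  by (rule nat_trans_closed[OF hom_moduleD])

lemma module_hom_module:
  assumes R: "cring R"
  shows "module R (hom_module R C M N)"
proof (rule moduleI)
  interpret R: cring R by fact
  note c = hom_module_closed and e = hom_module_eval_closed
  have m: "module R (mod_at N x)" if "x \<in> Ob C" for x by (rule cat_module_at[OF N that])
  note ag = abelian_group.axioms(1)[OF module.axioms(2)[OF m]]
  show "abelian_group (hom_module R C M N)"
  proof (rule abelian_groupI)
    fix \<eta> \<theta> \<zeta> assume h: "\<eta> \<in> carrier (hom_module R C M N)" "\<theta> \<in> carrier (hom_module R C M N)"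
      "\<zeta> \<in> carrier (hom_module R C M N)"
    show "(\<eta> \<oplus>\<^bsub>hom_module R C M N\<^esub> \<theta>) \<oplus>\<^bsub>hom_module R C M N\<^esub> \<zeta> =
      \<eta> \<oplus>\<^bsub>hom_module R C M N\<^esub> (\<theta> \<oplus>\<^bsub>hom_module R C M N\<^esub> \<zeta>)"
      by (rule hom_module_ext) (use h in \<open>auto simp: c\<close>, auto simp: hom_module_sel
          abelian_monoid.a_assoc[OF ag] e)
  next
    fix \<eta> \<theta> assume h: "\<eta> \<in> carrier (hom_module R C M N)" "\<theta> \<in> carrier (hom_module R C M N)"
    show "\<eta> \<oplus>\<^bsub>hom_module R C M N\<^esub> \<theta> = \<theta> \<oplus>\<^bsub>hom_module R C M N\<^esub> \<eta>"
      by (rule hom_module_ext) (use h in \<open>auto simp: c\<close>, auto simp: hom_module_sel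
          abelian_monoid.a_comm[OF ag] e)
  next
    fix \<eta> assume h: "\<eta> \<in> carrier (hom_module R C M N)"
    show "\<zero>\<^bsub>hom_module R C M N\<^esub> \<oplus>\<^bsub>hom_module R C M N\<^esub> \<eta> = \<eta>"
      by (rule hom_module_ext) (use h in \<open>auto simp: c\<close>, auto simp: hom_module_sel
          abelian_monoid.l_zero[OF ag] e)
    \<comment> \<open>The additive inverse is taken to be (-1) \<eta>, so that closure under scalars
      supplies it.\<close>
    have mo: "\<ominus>\<^bsub>R\<^esub> \<one>\<^bsub>R\<^esub> \<in> carrier R" by simp
    have "((\<ominus>\<^bsub>R\<^esub> \<one>\<^bsub>R\<^esub>) \<odot>\<^bsub>hom_module R C M N\<^esub> \<eta>) \<oplus>\<^bsub>hom_module R C M N\<^esub> \<eta> = \<zero>\<^bsub>hom_module R C M N\<^esub>"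
    proof (rule hom_module_ext)
      fix x a assume x: "x \<in> Ob C" and a: "a \<in> carrier (mod_at M x)"
      interpret Nx: module R "mod_at N x" by (rule m[OF x])
      show "(((\<ominus>\<^bsub>R\<^esub> \<one>\<^bsub>R\<^esub>) \<odot>\<^bsub>hom_module R C M N\<^esub> \<eta>) \<oplus>\<^bsub>hom_module R C M N\<^esub> \<eta>) x a
          = \<zero>\<^bsub>hom_module R C M N\<^esub> x a"
        using x a e[OF h x a] by (simp add: hom_module_sel Nx.smult_minus_one Nx.M.l_neg)
    qed (use c h mo in auto)
    then show "\<exists>\<theta>\<in>carrier (hom_module R C M N). \<theta> \<oplus>\<^bsub>hom_module R C M N\<^esub> \<eta> = \<zero>\<^bsub>hom_module R C M N\<^esub>"
      using c(2)[OF mo h] by blast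
  qed (auto simp: c)
  fix r s \<eta> \<theta> assume h: "r \<in> carrier R" "s \<in> carrier R" "\<eta> \<in> carrier (hom_module R C M N)"
      "\<theta> \<in> carrier (hom_module R C M N)"
  show "(r \<oplus>\<^bsub>R\<^esub> s) \<odot>\<^bsub>hom_module R C M N\<^esub> \<eta> = r \<odot>\<^bsub>hom_module R C M N\<^esub> \<eta> \<oplus>\<^bsub>hom_module R C M N\<^esub> s
      \<odot>\<^bsub>hom_module R C M N\<^esub> \<eta>"
    by (rule hom_module_ext) (use h in \<open>auto simp: c\<close>, auto simp: hom_module_sel
        module.smult_l_distr[OF m] e)
  show "r \<odot>\<^bsub>hom_module R C M N\<^esub> (\<eta> \<oplus>\<^bsub>hom_module R C M N\<^esub> \<theta>) = r \<odot>\<^bsub>hom_module R C M N\<^esub> \<eta> \<oplus>\<^bsub>hom_module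
      R C M N\<^esub> r \<odot>\<^bsub>hom_module R C M N\<^esub> \<theta>"
    by (rule hom_module_ext) (use h in \<open>auto simp: c\<close>, auto simp: hom_module_sel
        module.smult_r_distr[OF m] e)
  show "(r \<otimes>\<^bsub>R\<^esub> s) \<odot>\<^bsub>hom_module R C M N\<^esub> \<eta> = r \<odot>\<^bsub>hom_module R C M N\<^esub> (s \<odot>\<^bsub>hom_module R C M N\<^esub> \<eta>)"
    by (rule hom_module_ext) (use h in \<open>auto simp: c\<close>, auto simp: hom_module_sel
        module.smult_assoc1[OF m] e)
next
  interpret R: cring R by fact
  note c = hom_module_closed and e = hom_module_eval_closed
  have m: "module R (mod_at N x)" if "x \<in> Ob C" for x by (rule cat_module_at[OF N that])
  fix \<eta> assume h: "\<eta> \<in> carrier (hom_module R C M N)"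
  show "\<one>\<^bsub>R\<^esub> \<odot>\<^bsub>hom_module R C M N\<^esub> \<eta> = \<eta>"
    by (rule hom_module_ext) (use h in \<open>auto simp: c\<close>, auto simp: hom_module_sel module.smult_one[OF
        m] e)
qed (use assms hom_module_closed in auto)

text \<open>Subtraction in \<open>hom_module\<close> has no explicit formula; linearity of
  evaluation is what makes it pointwise in \<open>hom_module_minus_eval\<close>.\<close>

lemma eval_lin_maps:
  "x \<in> Ob C \<Longrightarrow> a \<in> carrier (mod_at M x) \<Longrightarrow> (\<lambda>\<eta>. \<eta> x a) \<in> lin_maps R (hom_module R C M N) (mod_at N x)"
  by (rule lin_mapsI) (auto simp: hom_module_eval_closed hom_module_sel)

lemma hom_module_minus_eval:
  assumes "cring R" "\<eta> \<in> carrier (hom_module R C M N)" "\<theta> \<in> carrier (hom_module R C M N)"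
    "x \<in> Ob C" "a \<in> carrier (mod_at M x)"
  shows "(\<eta> \<ominus>\<^bsub>hom_module R C M N\<^esub> \<theta>) x a = \<eta> x a \<ominus>\<^bsub>mod_at N x\<^esub> \<theta> x a"
  by (rule lin_maps_diff[OF module_hom_module[OF assms(1)] cat_module_at[OF N] eval_lin_maps]) (use
      assms in auto)

end

section \<open>The cochain complex Hom(P, M)\<close>

lemma precompose_lin_maps:
  assumes M: "is_cat_module R C M" and M': "is_cat_module R C M'" and N: "is_cat_module R C N"
    and \<phi>: "\<phi> \<in> nat_trans R C M' M"
  shows "(\<lambda>\<eta>. restrict_trans C M' (\<lambda>x a. \<eta> x (\<phi> x a))) \<in> lin_maps R (hom_module R C M N) (hom_module
      R C M' N)"
proof -
  have r: "restrict_trans C M' (\<lambda>x a. \<eta> x (\<phi> x a)) \<in> carrier (hom_module R C M' N)"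
    if "\<eta> \<in> carrier (hom_module R C M N)" for \<eta>
    by (rule restrict_trans_carrier[OF M' N nat_trans_comp[OF \<phi> hom_moduleD[OF M N that]]])
  note c = hom_module_closed[OF M' N] hom_module_closed[OF M N]
  show ?thesis
  proof (rule lin_mapsI)
    fix \<eta> \<theta> assume h: "\<eta> \<in> carrier (hom_module R C M N)" "\<theta> \<in> carrier (hom_module R C M N)"
    show "restrict_trans C M' (\<lambda>x a. (\<eta> \<oplus>\<^bsub>hom_module R C M N\<^esub> \<theta>) x (\<phi> x a)) =
      restrict_trans C M' (\<lambda>x a. \<eta> x (\<phi> x a)) \<oplus>\<^bsub>hom_module R C M' N\<^esub> restrict_trans C M' (\<lambda>x a. \<theta> x
          (\<phi> x a))"
      by (rule hom_module_ext[OF M' N]) (use h in \<open>auto simp: r c\<close>, auto simp: hom_module_sel[OF M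
          N] hom_module_sel[OF M' N] nat_trans_closed[OF \<phi>])
  next
    fix t \<eta> assume h: "t \<in> carrier R" "\<eta> \<in> carrier (hom_module R C M N)"
    show "restrict_trans C M' (\<lambda>x a. (t \<odot>\<^bsub>hom_module R C M N\<^esub> \<eta>) x (\<phi> x a)) =
      t \<odot>\<^bsub>hom_module R C M' N\<^esub> restrict_trans C M' (\<lambda>x a. \<eta> x (\<phi> x a))"
      by (rule hom_module_ext[OF M' N]) (use h in \<open>auto simp: r c\<close>, auto simp: hom_module_sel[OF M
          N] hom_module_sel[OF M' N] nat_trans_closed[OF \<phi>])
  qed (rule r)
qed

lemma hom_diff_restrict_trans: "hom_diff C P n \<eta> = restrict_trans C (trm P (Suc n)) (\<lambda>x a. \<eta> x (diff
    P n x a))"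
  by (simp add: hom_diff_def restrict_trans_def)

lemma hom_cochain_complex:
  assumes R: "cring R" and P: "exact_resolution R C N P" and M: "is_cat_module R C M"
  shows "cochain_complex R (hom_complex R C P M) (hom_diff C P)"
proof (rule cochain_complex.intro)
  note PN = exact_trm[OF P]
  fix n show "module R (hom_complex R C P M n)"
    unfolding hom_complex_def by (rule module_hom_module[OF PN M R])
  show "hom_diff C P n \<in> lin_maps R (hom_complex R C P M n) (hom_complex R C P M (Suc n))"
    unfolding hom_complex_def hom_diff_restrict_trans[abs_def] by (rule precompose_lin_maps[OF PN PN
        M exact_diff[OF P]])
  then have l: "hom_diff C P n \<in> lin_maps R (hom_complex R C P M n) (hom_complex R C P M (Suc n))" for n
    unfolding hom_complex_def hom_diff_restrict_trans[abs_def] by (intro precompose_lin_maps[OF PN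
        PN M exact_diff[OF P]])
  fix \<eta> assume h: "\<eta> \<in> carrier (hom_complex R C P M n)"
  then have \<eta>: "\<eta> \<in> nat_trans R C (trm P n) M" unfolding hom_complex_def by (rule hom_moduleD[OF PN M])
  show "hom_diff C P (Suc n) (hom_diff C P n \<eta>) = \<zero>\<^bsub>hom_complex R C P M (Suc (Suc n))\<^esub>"
    unfolding hom_complex_def
  proof (rule hom_module_ext[OF PN M])
    show "hom_diff C P (Suc n) (hom_diff C P n \<eta>) \<in> carrier (hom_module R C (trm P (Suc (Suc n))) M)"
      using lin_maps_closed[OF l lin_maps_closed[OF l h]] by (simp add: hom_complex_def)
    fix x a assume x: "x \<in> Ob C" "a \<in> carrier (mod_at (trm P (Suc (Suc n))) x)"
    show "hom_diff C P (Suc n) (hom_diff C P n \<eta>) x a = \<zero>\<^bsub>hom_module R C (trm P (Suc (Suc n))) M\<^esub> x a"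
      using x exact_closed[OF P x] exact_diff_diff[OF P x] nat_trans_zero[OF P \<eta> PN M x(1)]
      by (simp add: hom_diff_restrict_trans hom_module_sel[OF PN M])
  qed (rule hom_module_closed[OF PN M])
qed

lemma hom_cocycles_iff:
  assumes R: "cring R" and P: "exact_resolution R C N P" and M: "is_cat_module R C M"
  shows "\<eta> \<in> cocycles (hom_complex R C P M) (hom_diff C P) n \<longleftrightarrow>
    \<eta> \<in> carrier (hom_module R C (trm P n) M) \<and>
    (\<forall>x\<in>Ob C. \<forall>a\<in>carrier (mod_at (trm P (Suc n)) x). \<eta> x (diff P n x a) = \<zero>\<^bsub>mod_at M x\<^esub>)"
proof -
  interpret cochain_complex R "hom_complex R C P M" "hom_diff C P" by (rule hom_cochain_complex[OF
      assms])
  note PN = exact_trm[OF P]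
  have "hom_diff C P n \<eta> = \<zero>\<^bsub>hom_module R C (trm P (Suc n)) M\<^esub> \<longleftrightarrow>
     (\<forall>x\<in>Ob C. \<forall>a\<in>carrier (mod_at (trm P (Suc n)) x). \<eta> x (diff P n x a) = \<zero>\<^bsub>mod_at M x\<^esub>)"
    if h: "\<eta> \<in> carrier (hom_module R C (trm P n) M)"
  proof
    assume e: "hom_diff C P n \<eta> = \<zero>\<^bsub>hom_module R C (trm P (Suc n)) M\<^esub>"
    show "\<forall>x\<in>Ob C. \<forall>a\<in>carrier (mod_at (trm P (Suc n)) x). \<eta> x (diff P n x a) = \<zero>\<^bsub>mod_at M x\<^esub>"
    proof (intro ballI)
      fix x a assume "x \<in> Ob C" "a \<in> carrier (mod_at (trm P (Suc n)) x)"
      then show "\<eta> x (diff P n x a) = \<zero>\<^bsub>mod_at M x\<^esub>"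
        using fun_cong[OF fun_cong[OF e, of x], of a] by (simp add: hom_diff_restrict_trans
            hom_module_sel[OF PN M])
    qed
  next
    assume z: "\<forall>x\<in>Ob C. \<forall>a\<in>carrier (mod_at (trm P (Suc n)) x). \<eta> x (diff P n x a) = \<zero>\<^bsub>mod_at M x\<^esub>"
    show "hom_diff C P n \<eta> = \<zero>\<^bsub>hom_module R C (trm P (Suc n)) M\<^esub>"
    proof (rule hom_module_ext[OF PN M])
      show "hom_diff C P n \<eta> \<in> carrier (hom_module R C (trm P (Suc n)) M)"
        using lin_maps_closed[OF \<delta>, of \<eta> n] h by (simp add: hom_complex_def)
      show "\<zero>\<^bsub>hom_module R C (trm P (Suc n)) M\<^esub> \<in> carrier (hom_module R C (trm P (Suc n)) M)"
        by (rule hom_module_closed(3)[OF PN M])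
    qed (use z in \<open>auto simp: hom_diff_restrict_trans hom_module_sel[OF PN M]\<close>)
  qed
  then show ?thesis by (auto simp: cocycles_iff hom_complex_def)
qed

lemma hom_coboundaries_0:
  assumes P: "exact_resolution R C N P" and M: "is_cat_module R C M"
    and \<eta>: "\<eta> \<in> carrier (hom_module R C (trm P 0) M)"
  shows "\<eta> \<in> coboundaries (hom_complex R C P M) (hom_diff C P) 0 \<longleftrightarrow>
    (\<forall>x\<in>Ob C. \<forall>a\<in>carrier (mod_at (trm P 0) x). \<eta> x a = \<zero>\<^bsub>mod_at M x\<^esub>)"
proof -
  note PN = exact_trm[OF P]
  have "\<eta> = \<zero>\<^bsub>hom_module R C (trm P 0) M\<^esub>" if "\<forall>x\<in>Ob C. \<forall>a\<in>carrier (mod_at (trm P 0) x). \<eta> x a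
      = \<zero>\<^bsub>mod_at M x\<^esub>"
    by (rule hom_module_ext[OF PN M \<eta> hom_module_closed(3)[OF PN M]]) (use that in \<open>auto simp:
        hom_module_sel[OF PN M]\<close>)
  then show ?thesis
    by (auto simp: coboundaries_def hom_complex_def) (auto simp: hom_module_sel[OF PN M])
qed

text \<open>The witness \<theta> is asked to be natural but not extensional, so composites can be
  supplied directly; \<open>restrict_trans\<close> makes up the difference.\<close>

lemma hom_coboundaries_Suc:
  assumes P: "exact_resolution R C N P" and M: "is_cat_module R C M"
    and \<eta>: "\<eta> \<in> carrier (hom_module R C (trm P (Suc n)) M)"
  shows "\<eta> \<in> coboundaries (hom_complex R C P M) (hom_diff C P) (Suc n) \<longleftrightarrow>
    (\<exists>\<theta>\<in>nat_trans R C (trm P n) M. \<forall>x\<in>Ob C. \<forall>a\<in>carrier (mod_at (trm P (Suc n)) x). \<eta> x a = \<theta> x (diff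
        P n x a))"
proof
  note PN = exact_trm[OF P]
  assume "\<eta> \<in> coboundaries (hom_complex R C P M) (hom_diff C P) (Suc n)"
  then obtain \<theta> where \<theta>: "\<theta> \<in> carrier (hom_module R C (trm P n) M)" "\<eta> = hom_diff C P n \<theta>"
    by (auto simp: coboundaries_def hom_complex_def)
  then show "\<exists>\<theta>\<in>nat_trans R C (trm P n) M. \<forall>x\<in>Ob C. \<forall>a\<in>carrier (mod_at (trm P (Suc n)) x). \<eta> x a
      = \<theta> x (diff P n x a)"
    by (intro bexI[of _ \<theta>] hom_moduleD[OF PN M]) (auto simp: hom_diff_restrict_trans)
next
  note PN = exact_trm[OF P]
  assume "\<exists>\<theta>\<in>nat_trans R C (trm P n) M. \<forall>x\<in>Ob C. \<forall>a\<in>carrier (mod_at (trm P (Suc n)) x). \<eta> x a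
      = \<theta> x (diff P n x a)"
  then obtain \<theta> where \<theta>: "\<theta> \<in> nat_trans R C (trm P n) M"
    and e: "\<And>x a. x \<in> Ob C \<Longrightarrow> a \<in> carrier (mod_at (trm P (Suc n)) x) \<Longrightarrow> \<eta> x a = \<theta> x (diff P n x a)" by
        blast
  note r = restrict_trans_carrier[OF PN M \<theta>]
  have "hom_diff C P n (restrict_trans C (trm P n) \<theta>) \<in> carrier (hom_module R C (trm P (Suc n)) M)"
    unfolding hom_diff_restrict_trans
    by (rule lin_maps_closed[OF precompose_lin_maps[OF PN PN M exact_diff[OF P]] r])
  then have "\<eta> = hom_diff C P n (restrict_trans C (trm P n) \<theta>)"
    by (rule hom_module_ext[OF PN M \<eta>]) (simp add: e hom_diff_restrict_trans exact_closed[OF P])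
  then show "\<eta> \<in> coboundaries (hom_complex R C P M) (hom_diff C P) (Suc n)"
    using r by (auto simp: coboundaries_def hom_complex_def)
qed

section \<open>Full functors with exact Kan extension\<close>

text \<open>\<open>acyclic\<close> is exactness of the coinvariants of Q in positive degrees,
  phrased on elements of Q: a cycle modulo the fiber span is a boundary modulo the fiber
  span.\<close>

locale exact_kan_extension = full_functor C D F
  for C :: "('o, 'm) cat" and D :: "('o, 'n) cat" and F :: "('o, 'm, 'o, 'n) cat_functor" +
  fixes R :: "'r ring" and P :: "('o, 'n, 'r, 'b, 'r) resolution" and Q ::
      "('o, 'm, 'r, 'c, 'r) resolution"
  assumes R: "cring R"
    and P: "projective_resolution R D (const_module R) P"
    and Q: "projective_resolution R C (const_module R) Q"
    and acyclic: "\<And>n x z. x \<in> Ob C \<Longrightarrow> z \<in> carrier (mod_at (trm Q (Suc n)) x) \<Longrightarrow>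
      diff Q n x z \<in> fiber_span C F (trm Q n) x \<Longrightarrow>
      \<exists>w\<in>carrier (mod_at (trm Q (Suc (Suc n))) x).
        z \<ominus>\<^bsub>mod_at (trm Q (Suc n)) x\<^esub> diff Q (Suc n) x w \<in> fiber_span C F (trm Q (Suc n)) x"
begin

lemmas const = is_cat_module_const_module[OF R]
lemmas PE = projective_resolution_exact[OF P const]
lemmas QE = projective_resolution_exact[OF Q const]
lemmas KE = exact_kan_resolution[OF R QE acyclic]
lemmas Pm = exact_trm[OF PE] and Qm = exact_trm[OF QE]
lemmas Km = is_cat_module_kan[OF Qm]

abbreviation "KQ n \<equiv> kan_module C F (trm Q n)"
abbreviation "dK n \<equiv> diff (kan_resolution C F Q) n"
abbreviation "aK \<equiv> aug (kan_resolution C F Q)"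
abbreviation "cv n \<equiv> coinv C F (trm Q n)"

lemmas [simp] = kan_trm[OF R QE]

lemma cv_nat: "cv n \<in> nat_trans R C (trm Q n) (res_module F (KQ n))"
  by (rule coinv_nat[OF Qm])

lemmas dK_cv = kan_diff_coinv[OF R QE] and aK_cv = kan_aug_coinv[OF R QE] and dK_nat =
    kan_diff_nat[OF R QE]

lemma Pat: "x \<in> Ob C \<Longrightarrow> module R (mod_at (trm P n) x)"
  using cat_module_at[OF Pm] by (simp add: ob)

lemma Kat: "x \<in> Ob C \<Longrightarrow> module R (mod_at (KQ n) x)"
  using cat_module_at[OF Km] by (simp add: ob)

lemma cvc: "x \<in> Ob C \<Longrightarrow> a \<in> carrier (mod_at (trm Q n) x) \<Longrightarrow> cv n x a \<in> carrier (mod_at (KQ n) x)"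
  by (rule coinv_closed[OF Qm])

lemma cv_cases:
  assumes "x \<in> Ob C" "U \<in> carrier (mod_at (KQ n) x)"
  obtains a where "a \<in> carrier (mod_at (trm Q n) x)" "U = cv n x a"
  using kan_cases[OF Qm assms] .

lemma res_F_nat: "\<eta> \<in> nat_trans R D M N \<Longrightarrow> \<eta> \<in> nat_trans R C (res_module F M) (res_module F N)"
  using res_nat_trans[OF F, of \<eta>] by (simp add: ob)

text \<open>Restriction makes P an exact resolution of the constant module over C, and Q is
  projective, so the comparison theorem applies.\<close>

theorem comparison_map_exists: "\<exists>\<phi>. comparison_map R C F P Q \<phi>"
proof -
  have Y: "exact_resolution R C (const_module R) (res_resolution F P)"
    using exact_resolution_res[OF F PE] by (simp add: res_const_module)
  interpret lifting_situation R C C id_functor "const_module R" Q "const_module R" "res_resolution F P"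
    by (intro lifting_situation.intro R C is_functor_id_functor sums_of_representables_id_functor Q
        const Y)
  have "(\<lambda>x a. a) \<in> nat_trans R C (res_module id_functor (const_module R)) (const_module R)"
    by (simp add: nat_trans_def lin_maps_id)
  from comparison_exists[OF this] show ?thesis
    unfolding comparison_map_def by (simp add: res_resolution_def ob)
qed

context
  fixes \<phi> assumes \<phi>: "comparison_map R C F P Q \<phi>"
begin

text \<open>The adjunct of \<phi>, a chain map Lan Q -> P.\<close>

abbreviation "\<phi>b n \<equiv> kan_factor C F (trm Q n) (\<phi> n)"

lemma \<phi>_nat: "\<phi> n \<in> nat_trans R C (trm Q n) (res_module F (trm P n))"
  and \<phi>_aug: "x \<in> Ob C \<Longrightarrow> a \<in> carrier (mod_at (trm Q 0) x) \<Longrightarrow> aug P x (\<phi> 0 x a) = aug Q x a"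
  and \<phi>_diff: "x \<in> Ob C \<Longrightarrow> a \<in> carrier (mod_at (trm Q (Suc n)) x) \<Longrightarrow>
    diff P n x (\<phi> (Suc n) x a) = \<phi> n x (diff Q n x a)"
  using \<phi> by (auto simp: comparison_map_def ob)

lemma \<phi>_closed: "x \<in> Ob C \<Longrightarrow> a \<in> carrier (mod_at (trm Q n) x) \<Longrightarrow> \<phi> n x a \<in> carrier (mod_at (trm P n) x)"
  using nat_trans_closed[OF \<phi>_nat, of x a n] by simp

lemma \<phi>b_nat: "\<phi>b n \<in> nat_trans R D (KQ n) (trm P n)"
  by (rule kan_factor_nat[OF Qm Pm \<phi>_nat])

lemma \<phi>bc: "x \<in> Ob C \<Longrightarrow> U \<in> carrier (mod_at (KQ n) x) \<Longrightarrow> \<phi>b n x U \<in> carrier (mod_at (trm P n) x)"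
  using nat_trans_closed[OF \<phi>b_nat] by (simp add: ob)

lemma \<phi>b_cv: "x \<in> Ob C \<Longrightarrow> a \<in> carrier (mod_at (trm Q n) x) \<Longrightarrow> \<phi>b n x (cv n x a) = \<phi> n x a"
  by (rule kan_factor[OF Qm Pm \<phi>_nat])

lemma \<phi>b_diff:
  assumes "x \<in> Ob C" "U \<in> carrier (mod_at (KQ (Suc n)) x)"
  shows "diff P n x (\<phi>b (Suc n) x U) = \<phi>b n x (dK n x U)"
  using assms(2) by (elim cv_cases[OF assms(1)])
    (simp add: \<phi>b_cv dK_cv \<phi>_diff assms(1) exact_closed[OF QE])

lemma \<phi>b_aug:
  assumes "x \<in> Ob C" "U \<in> carrier (mod_at (KQ 0) x)"
  shows "aug P x (\<phi>b 0 x U) = aK x U"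
  using assms(2) by (elim cv_cases[OF assms(1)]) (simp add: \<phi>b_cv aK_cv \<phi>_aug assms(1))

text \<open>\<psi> is a lift from the projective P to the exact Lan Q, and k compares two lifts from
  P to P. The composite of \<psi> and \<phi> is compared with \<open>cv\<close> as a map out of Q,
  where projectivity is at hand; by adjunction l amounts to a homotopy from the composite on Lan Q
  to the identity.\<close>

lemma homotopy_inverse:
  obtains \<psi> k l where
    "\<And>n. \<psi> n \<in> nat_trans R D (trm P n) (KQ n)"
    "\<And>n x a. x \<in> Ob C \<Longrightarrow> a \<in> carrier (mod_at (trm P (Suc n)) x) \<Longrightarrow>
       dK n x (\<psi> (Suc n) x a) = \<psi> n x (diff P n x a)"
    "\<And>n. k n \<in> nat_trans R D (trm P n) (trm P (Suc n))"
    "chain_homotopy D P P k (\<lambda>n x a. \<phi>b n x (\<psi> n x a)) (\<lambda>n x a. a)"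
    "\<And>n. l n \<in> nat_trans R C (trm Q n) (res_module F (KQ (Suc n)))"
    "chain_homotopy C Q (res_resolution F (kan_resolution C F Q)) l (\<lambda>n x a. \<psi> n x (\<phi> n x a)) cv"
proof -
  have id: "(\<lambda>x a. a) \<in> nat_trans R D N N" for N :: "('o, 'n, 'r, 'e) cat_module"
    by (simp add: nat_trans_def lin_maps_id)
  interpret L: lifting_situation R D D id_functor "const_module R" P "const_module R"
      "kan_resolution C F Q"
    by (intro lifting_situation.intro R D is_functor_id_functor sums_of_representables_id_functor P
        const KE)
  have "(\<lambda>x a. a) \<in> nat_trans R D (res_module id_functor (const_module R)) (const_module R)"
    by (simp add: nat_trans_def lin_maps_id)
  from L.comparison_exists[OF this]
  have "\<exists>\<psi>. (\<forall>n. \<psi> n \<in> nat_trans R D (trm P n) (KQ n)) \<and>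
    (\<forall>x\<in>Ob C. \<forall>a\<in>carrier (mod_at (trm P 0) x). aK x (\<psi> 0 x a) = aug P x a) \<and>
    (\<forall>n. \<forall>x\<in>Ob C. \<forall>a\<in>carrier (mod_at (trm P (Suc n)) x). dK n x (\<psi> (Suc n) x a) = \<psi> n x (diff P n x a))"
    by (simp add: ob)
  then obtain \<psi> where
    \<psi>: "\<And>n. \<psi> n \<in> nat_trans R D (trm P n) (KQ n)"
    and \<psi>0: "\<And>x a. x \<in> Ob C \<Longrightarrow> a \<in> carrier (mod_at (trm P 0) x) \<Longrightarrow> aK x (\<psi> 0 x a) = aug P x a"
    and \<psi>S: "\<And>n x a. x \<in> Ob C \<Longrightarrow> a \<in> carrier (mod_at (trm P (Suc n)) x) \<Longrightarrow>
       dK n x (\<psi> (Suc n) x a) = \<psi> n x (diff P n x a)"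
    by blast
  have \<psi>c: "\<psi> n x a \<in> carrier (mod_at (KQ n) x)" if "x \<in> Ob C" "a \<in> carrier (mod_at (trm P n) x)"
      for n x a
    using nat_trans_closed[OF \<psi>] that by (simp add: ob)

  interpret L3: lifting_situation R D D id_functor "const_module R" P "const_module R" P
    by (intro lifting_situation.intro R D is_functor_id_functor sums_of_representables_id_functor P
        const PE)
  have "\<exists>k. (\<forall>n. k n \<in> nat_trans R D (res_module id_functor (trm P n)) (trm P (Suc n))) \<and>
    chain_homotopy D (res_resolution id_functor P) P k (\<lambda>n x a. \<phi>b n x (\<psi> n x a)) (\<lambda>n x a. a)"
    by (rule L3.comparison_homotopic)
      (use nat_trans_comp[OF \<psi> \<phi>b_nat] \<psi>c in \<open>simp_all add: id ob \<phi>b_aug \<psi>0 \<phi>b_diff \<psi>S\<close>)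
  then obtain k where k: "\<And>n. k n \<in> nat_trans R D (trm P n) (trm P (Suc n))"
    "chain_homotopy D P P k (\<lambda>n x a. \<phi>b n x (\<psi> n x a)) (\<lambda>n x a. a)" by auto

  let ?Y = "res_resolution F (kan_resolution C F Q)"
  have Y: "exact_resolution R C (const_module R) ?Y"
    using exact_resolution_res[OF F KE] by (simp add: res_const_module)
  have Y_trm: "trm ?Y n = res_module F (KQ n)" for n by (simp add: res_resolution_def)
  interpret L4: lifting_situation R C C id_functor "const_module R" Q "const_module R" ?Y
    by (intro lifting_situation.intro R C is_functor_id_functor sums_of_representables_id_functor Q
        const Y)
  have "\<exists>l. (\<forall>n. l n \<in> nat_trans R C (res_module id_functor (trm Q n)) (trm ?Y (Suc n))) \<and>
    chain_homotopy C (res_resolution id_functor Q) ?Y l (\<lambda>n x a. \<psi> n x (\<phi> n x a)) cv"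
    by (rule L4.comparison_homotopic)
      (use nat_trans_comp[OF \<phi>_nat res_F_nat[OF \<psi>]] cv_nat \<phi>_closed in
        \<open>simp_all add: res_resolution_def ob \<psi>0 \<phi>_aug aK_cv \<psi>S \<phi>_diff dK_cv\<close>)
  then obtain l where l: "\<And>n. l n \<in> nat_trans R C (trm Q n) (res_module F (KQ (Suc n)))"
    "chain_homotopy C Q ?Y l (\<lambda>n x a. \<psi> n x (\<phi> n x a)) cv"
    by (auto simp: Y_trm)
  show ?thesis by (rule that[OF \<psi> \<psi>S k l])
qed

text \<open>On cohomology the inverse sends the class of \<theta> to that of the adjunct of \<theta>
  composed with \<psi>. Injectivity comes from the homotopy k, surjectivity from l.\<close>

theorem induced_map_iso:
  assumes M: "is_cat_module R D M"
  shows "induced_map R C F Q \<phi> M n \<in> lin_isos R (Ext R D P M n) (Ext R C Q (res_module F M) n)"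
proof -
  note M' = is_cat_module_res_module[OF F M]
  obtain \<psi> k l where
    \<psi>: "\<And>n. \<psi> n \<in> nat_trans R D (trm P n) (KQ n)" and
    \<psi>S: "\<And>n x a. x \<in> Ob C \<Longrightarrow> a \<in> carrier (mod_at (trm P (Suc n)) x) \<Longrightarrow>
       dK n x (\<psi> (Suc n) x a) = \<psi> n x (diff P n x a)" and
    k: "\<And>n. k n \<in> nat_trans R D (trm P n) (trm P (Suc n))" and
    kh: "chain_homotopy D P P k (\<lambda>n x a. \<phi>b n x (\<psi> n x a)) (\<lambda>n x a. a)" and
    l: "\<And>n. l n \<in> nat_trans R C (trm Q n) (res_module F (KQ (Suc n)))" and
    lh: "chain_homotopy C Q (res_resolution F (kan_resolution C F Q)) l (\<lambda>n x a. \<psi> n x (\<phi> n x a)) cv"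
    by (rule homotopy_inverse) blast
  note kh = kh[unfolded chain_homotopy_def ob] and lh = lh[unfolded chain_homotopy_def]
  note k0 = kh[THEN conjunct1, rule_format] and kS = kh[THEN conjunct2, rule_format]
    and l0 = lh[THEN conjunct1, rule_format, simplified res_resolution_def, simplified, unfolded ob]
    and lS = lh[THEN conjunct2, rule_format, simplified res_resolution_def, simplified, unfolded ob]
  have Mat: "module R (mod_at M x)" if "x \<in> Ob C" for x using cat_module_at[OF M] that by (simp add: ob)
  have \<psi>c: "\<psi> n x a \<in> carrier (mod_at (KQ n) x)" if "x \<in> Ob C" "a \<in> carrier (mod_at (trm P n) x)"
      for n x a
    using nat_trans_closed[OF \<psi>] that by (simp add: ob)
  have kc: "k n x a \<in> carrier (mod_at (trm P (Suc n)) x)" if "x \<in> Ob C"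
      "a \<in> carrier (mod_at (trm P n) x)" for n x a
    using nat_trans_closed[OF k] that by (simp add: ob)
  have lc: "l n x a \<in> carrier (mod_at (KQ (Suc n)) x)" if "x \<in> Ob C"
      "a \<in> carrier (mod_at (trm Q n) x)" for n x a
    using nat_trans_closed[OF l that] by simp
  have Pdc: "diff P n x a \<in> carrier (mod_at (trm P n) x)" if "x \<in> Ob C"
      "a \<in> carrier (mod_at (trm P (Suc n)) x)" for n x a
    using exact_closed[OF PE] that by (simp add: ob)
  note Qdc = exact_closed[OF QE]
  let ?bar = "\<lambda>n \<theta>. kan_factor C F (trm Q n) \<theta>"
  have bar: "?bar n \<theta> \<in> nat_trans R D (KQ n) M" if "\<theta> \<in> nat_trans R C (trm Q n) (res_module F M)"
      for n \<theta>
    by (rule kan_factor_nat[OF Qm M that])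
  have bar_cv: "?bar n \<theta> x (cv n x a) = \<theta> x a"
    if "\<theta> \<in> nat_trans R C (trm Q n) (res_module F M)" "x \<in> Ob C" "a \<in> carrier (mod_at (trm Q n) x)"
        for n \<theta> x a
    by (rule kan_factor[OF Qm M that])
  have linP: "\<eta> x \<in> lin_maps R (mod_at (trm P n) x) (mod_at M x)" if "\<eta> \<in> nat_trans R D (trm P n) M"
      "x \<in> Ob C" for \<eta> x n
    using nat_trans_lin[OF that(1)] that(2) by (simp add: ob)
  have linK: "\<eta> x \<in> lin_maps R (mod_at (KQ n) x) (mod_at M x)" if "\<eta> \<in> nat_trans R D (KQ n) M"
      "x \<in> Ob C" for \<eta> x n
    using nat_trans_lin[OF that(1)] that(2) by (simp add: ob)
  let ?K = "hom_complex R D P M" and ?K' = "hom_complex R C Q (res_module F M)"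
  let ?h = "pull C F Q \<phi>"
  have pull: "?h n \<eta> = restrict_trans C (trm Q n) (\<lambda>x a. \<eta> x (\<phi> n x a))" for n and \<eta> :: "'o \<Rightarrow> 'b \<Rightarrow> 'h"
    by (simp add: pull_def restrict_trans_def ob)
  have pull_carrier: "?h n \<eta> \<in> carrier (hom_module R C (trm Q n) (res_module F M))"
    if "\<eta> \<in> nat_trans R D (trm P n) M" for n \<eta>
    unfolding pull by (rule restrict_trans_carrier[OF Qm M' nat_trans_comp[OF \<phi>_nat res_F_nat[OF
        that]]])
  note hP = hom_moduleD[OF Pm M] and hQ = hom_moduleD[OF Qm M']
  have lin_pull: "?h n \<in> lin_maps R (?K n) (?K' n)" for n
    unfolding hom_complex_def
  proof (rule lin_mapsI)
    fix \<eta> assume "\<eta> \<in> carrier (hom_module R D (trm P n) M)"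
    then show "?h n \<eta> \<in> carrier (hom_module R C (trm Q n) (res_module F M))" by (intro pull_carrier hP)
  qed (auto simp: pull hom_module_sel[OF Pm M] hom_module_sel[OF Qm M'] restrict_trans_def ob
      \<phi>_closed fun_eq_iff)
  have pull_diff: "hom_diff C Q n (?h n \<eta>) = ?h (Suc n) (hom_diff D P n \<eta>)" for n \<eta>
    by (auto simp: pull hom_diff_restrict_trans restrict_trans_def ob \<phi>_closed Qdc \<phi>_diff fun_eq_iff)
  note cocP = hom_cocycles_iff[OF R PE M] and cocQ = hom_cocycles_iff[OF R QE M']
  have "cohomology_map ?K' (hom_diff C Q) n (?h n) \<in> lin_isos R (cohomology ?K (hom_diff D P) n)
      (cohomology ?K' (hom_diff C Q) n)"
  proof (rule cohomology_map_iso[where h = ?h, OF hom_cochain_complex[OF R PE M]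
      hom_cochain_complex[OF R QE M'] lin_pull])
    show "hom_diff C Q m (?h m \<eta>) = ?h (Suc m) (hom_diff D P m \<eta>)" for m \<eta> by (rule pull_diff)
  next
    fix \<eta> assume coc: "\<eta> \<in> cocycles ?K (hom_diff D P) n"
      and cob: "?h n \<eta> \<in> coboundaries ?K' (hom_diff C Q) n"
    have hom: "\<eta> \<in> carrier (hom_module R D (trm P n) M)" using coc by (simp add: cocP)
    note \<eta> = hP[OF hom]
    have \<eta>d: "\<eta> x (diff P n x a) = \<zero>\<^bsub>mod_at M x\<^esub>" if "x \<in> Ob C"
        "a \<in> carrier (mod_at (trm P (Suc n)) x)" for x a
      using coc that by (simp add: cocP ob)
    note \<eta>c = lin_maps_closed[OF linP[OF \<eta>]]
    show "\<eta> \<in> coboundaries ?K (hom_diff D P) n"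
    proof (cases n)
      case 0
      have z: "\<eta> x (\<phi> 0 x b) = \<zero>\<^bsub>mod_at M x\<^esub>" if "x \<in> Ob C" "b \<in> carrier (mod_at (trm Q 0) x)" for x b
        using cob pull_carrier[OF \<eta>] that hom_coboundaries_0[OF QE M', of "?h 0 \<eta>"]
        by (simp add: 0 pull)
      have "\<eta> x a = \<zero>\<^bsub>mod_at M x\<^esub>" if x: "x \<in> Ob C" and a: "a \<in> carrier (mod_at (trm P 0) x)" for x a
      proof -
        interpret Mx: module R "mod_at M x" by (rule Mat[OF x])
        \<comment> \<open>Up to a boundary, on which \<eta> vanishes, a equals \<phi>b (\<psi> a),
          and this is \<phi> b for a representative b of \<psi> a.\<close>
        obtain b where b: "b \<in> carrier (mod_at (trm Q 0) x)" "\<psi> 0 x a = cv 0 x b"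
          using cv_cases[OF x \<psi>c[OF x a]] .
        have "\<eta> x (\<phi>b 0 x (\<psi> 0 x a) \<ominus>\<^bsub>mod_at (trm P 0) x\<^esub> a) = \<zero>\<^bsub>mod_at M x\<^esub>"
          using \<eta>d[OF x, of "k 0 x a"] kc[OF x a] k0[OF x a] by (simp add: 0)
        moreover have "\<eta> x (\<phi>b 0 x (\<psi> 0 x a) \<ominus>\<^bsub>mod_at (trm P 0) x\<^esub> a)
            = \<eta> x (\<phi>b 0 x (\<psi> 0 x a)) \<ominus>\<^bsub>mod_at M x\<^esub> \<eta> x a"
          using \<eta> by (intro lin_maps_diff[OF Pat[OF x] Mat[OF x] linP \<phi>bc[OF x \<psi>c[OF x a]] a]) (auto
              simp: 0 x)
        moreover have "\<eta> x (\<phi>b 0 x (\<psi> 0 x a)) = \<zero>\<^bsub>mod_at M x\<^esub>"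
          using b z[OF x b(1)] \<phi>b_cv[OF x b(1)] by simp
        ultimately show ?thesis
          using \<eta>c[OF x, of a] a Mx.M.minus_eq_zero_iff[of "\<zero>\<^bsub>mod_at M x\<^esub>" "\<eta> x a"] by (simp add: 0)
      qed
      then show ?thesis using hom hom_coboundaries_0[OF PE M, of \<eta>] by (simp add: 0 ob)
    next
      case (Suc m)
      obtain \<theta> where \<theta>: "\<theta> \<in> nat_trans R C (trm Q m) (res_module F M)"
        and e: "\<And>x b. x \<in> Ob C \<Longrightarrow> b \<in> carrier (mod_at (trm Q (Suc m)) x) \<Longrightarrow> \<eta> x (\<phi> (Suc m) x b)
            = \<theta> x (diff Q m x b)"
        using cob pull_carrier[OF \<eta>] hom_coboundaries_Suc[OF QE M', of "?h (Suc m) \<eta>" m] by (auto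
            simp: Suc pull)
      \<comment> \<open>Applying the cocycle \<eta> to the relation for k gives \<eta> a = \<eta>
        (\<phi>b (\<psi> a)) - \<eta> (k (d a)), and the first term is the adjunct of \<theta> at
        \<psi> (d a). Both terms are thus functions of d a, and \<xi> is their difference.\<close>
      define \<xi> where "\<xi> x a = ?bar m \<theta> x (\<psi> m x a) \<ominus>\<^bsub>mod_at M x\<^esub> \<eta> x (k m x a)" for x a
      have \<xi>: "\<xi> \<in> nat_trans R D (trm P m) M"
        unfolding \<xi>_def[abs_def]
        by (intro nat_trans_minus[OF M nat_trans_comp[OF \<psi> bar[OF \<theta>]] nat_trans_comp[OF k]]) (use \<eta>
            Suc in simp)
      have "\<eta> x a = \<xi> x (diff P m x a)" if x: "x \<in> Ob C" and a:
          "a \<in> carrier (mod_at (trm P (Suc m)) x)" for x a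
      proof -
        interpret Mx: module R "mod_at M x" by (rule Mat[OF x])
        interpret Px: module R "mod_at (trm P (Suc m)) x" by (rule Pat[OF x])
        have l\<eta>: "\<eta> x \<in> lin_maps R (mod_at (trm P (Suc m)) x) (mod_at M x)" using linP[OF _ x] \<eta> Suc
            by simp
        note D = lin_maps_diff[OF Pat[OF x] Mat[OF x] l\<eta>] and cl = lin_maps_closed[OF l\<eta>]
        obtain b where b: "b \<in> carrier (mod_at (trm Q (Suc m)) x)" "\<psi> (Suc m) x a = cv (Suc m) x b"
          using cv_cases[OF x \<psi>c[OF x a]] .
        have c: "\<phi>b (Suc m) x (\<psi> (Suc m) x a) \<in> carrier (mod_at (trm P (Suc m)) x)"
          "k m x (diff P m x a) \<in> carrier (mod_at (trm P (Suc m)) x)"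
          using \<phi>bc \<psi>c kc Pdc x a by auto
        have 1: "\<eta> x (\<phi>b (Suc m) x (\<psi> (Suc m) x a)) = ?bar m \<theta> x (\<psi> m x (diff P m x a))"
          using e[OF x b(1)] \<phi>b_cv[OF x b(1)] \<psi>S[OF x a] dK_cv[OF x b(1)] b(2) bar_cv[OF \<theta> x Qdc[OF
              x b(1)]] by simp
        have "\<zero>\<^bsub>mod_at M x\<^esub> = \<eta> x ((\<phi>b (Suc m) x (\<psi> (Suc m) x a) \<ominus>\<^bsub>mod_at (trm P (Suc m)) x\<^esub> a)
            \<ominus>\<^bsub>mod_at (trm P (Suc m)) x\<^esub> k m x (diff P m x a))"
          using \<eta>d[OF x, of "k (Suc m) x a"] kc[OF x a] kS[OF x a] by (simp add: Suc)
        also have "\<dots> = (\<eta> x (\<phi>b (Suc m) x (\<psi> (Suc m) x a)) \<ominus>\<^bsub>mod_at M x\<^esub> \<eta> x a) \<ominus>\<^bsub>mod_at M x\<^esub> \<eta> x (k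
            m x (diff P m x a))"
          using c a by (simp add: D)
        also have "\<dots> = (\<eta> x (\<phi>b (Suc m) x (\<psi> (Suc m) x a)) \<ominus>\<^bsub>mod_at M x\<^esub> \<eta> x (k m x (diff P m x a)))
            \<ominus>\<^bsub>mod_at M x\<^esub> \<eta> x a"
          using c a cl by (simp add: a_minus_def Mx.M.a_ac)
        finally have "\<zero>\<^bsub>mod_at M x\<^esub> = \<xi> x (diff P m x a) \<ominus>\<^bsub>mod_at M x\<^esub> \<eta> x a" by (simp add: \<xi>_def 1)
        moreover have "\<xi> x (diff P m x a) \<in> carrier (mod_at M x)"
          using lin_maps_closed[OF linP[OF \<xi> x] Pdc[OF x a]] .
        ultimately show ?thesis using cl[OF a] Mx.M.minus_eq_zero_iff by metis
      qed
      then show ?thesis using hom \<xi> hom_coboundaries_Suc[OF PE M, of \<eta> m] by (auto simp: Suc ob)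
    qed
  next
    fix \<theta> assume coc: "\<theta> \<in> cocycles ?K' (hom_diff C Q) n"
    have hom: "\<theta> \<in> carrier (hom_module R C (trm Q n) (res_module F M))" using coc by (simp add: cocQ)
    note \<theta> = hQ[OF hom]
    have \<theta>d: "\<theta> x (diff Q n x a) = \<zero>\<^bsub>mod_at M x\<^esub>" if "x \<in> Ob C"
        "a \<in> carrier (mod_at (trm Q (Suc n)) x)" for x a
      using coc that by (simp add: cocQ)
    have bd: "?bar n \<theta> x (dK n x U) = \<zero>\<^bsub>mod_at M x\<^esub>" if x: "x \<in> Ob C" and U:
        "U \<in> carrier (mod_at (KQ (Suc n)) x)" for x U
    proof -
      obtain b where b: "b \<in> carrier (mod_at (trm Q (Suc n)) x)" "U = cv (Suc n) x b"
        using cv_cases[OF x U] .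
      then show ?thesis using dK_cv[OF x b(1)] bar_cv[OF \<theta> x Qdc[OF x b(1)]] \<theta>d[OF x b(1)] by simp
    qed
    define \<eta>' where "\<eta>' x a = ?bar n \<theta> x (\<psi> n x a)" for x a
    have \<eta>': "\<eta>' \<in> nat_trans R D (trm P n) M"
      unfolding \<eta>'_def[abs_def] by (rule nat_trans_comp[OF \<psi> bar[OF \<theta>]])
    define \<eta> where "\<eta> = restrict_trans D (trm P n) \<eta>'"
    have \<eta>: "\<eta> \<in> carrier (hom_module R D (trm P n) M)"
      unfolding \<eta>_def by (rule restrict_trans_carrier[OF Pm M \<eta>'])
    have \<eta>e: "\<eta> x a = ?bar n \<theta> x (\<psi> n x a)" if "x \<in> Ob C" "a \<in> carrier (mod_at (trm P n) x)" for x a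
      using that by (simp add: \<eta>_def \<eta>'_def ob)
    have "\<eta> \<in> cocycles ?K (hom_diff D P) n"
      using \<eta> by (simp add: cocP ob \<eta>e Pdc bd \<psi>c flip: \<psi>S)
    moreover have "?h n \<eta> \<ominus>\<^bsub>?K' n\<^esub> \<theta> \<in> coboundaries ?K' (hom_diff C Q) n"
    proof -
      let ?d = "?h n \<eta> \<ominus>\<^bsub>hom_module R C (trm Q n) (res_module F M)\<^esub> \<theta>"
      have pc: "?h n \<eta> \<in> carrier (hom_module R C (trm Q n) (res_module F M))"
        by (rule pull_carrier[OF hP[OF \<eta>]])
      interpret H: module R "hom_module R C (trm Q n) (res_module F M)"
        by (rule module_hom_module[OF Qm M' R])
      have dc: "?d \<in> carrier (hom_module R C (trm Q n) (res_module F M))" using pc hom by simp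
      have ev: "?d x a = ?bar n \<theta> x (\<psi> n x (\<phi> n x a) \<ominus>\<^bsub>mod_at (KQ n) x\<^esub> cv n x a)"
        if x: "x \<in> Ob C" and a: "a \<in> carrier (mod_at (trm Q n) x)" for x a
      proof -
        have "?d x a = ?h n \<eta> x a \<ominus>\<^bsub>mod_at M x\<^esub> \<theta> x a"
          using hom_module_minus_eval[OF Qm M' R pc hom x a] by simp
        also have "?h n \<eta> x a = ?bar n \<theta> x (\<psi> n x (\<phi> n x a))"
          using x a by (simp add: pull \<eta>e \<phi>_closed)
        also have "\<theta> x a = ?bar n \<theta> x (cv n x a)" using bar_cv[OF \<theta> x a] by simp
        finally show ?thesis
          using lin_maps_diff[OF Kat[OF x] Mat[OF x] linK[OF bar[OF \<theta>] x] \<psi>c[OF x \<phi>_closed[OF x a]]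
              cvc[OF x a]] by simp
      qed
      show ?thesis
      proof (cases n)
        case 0
        have "?d x a = \<zero>\<^bsub>mod_at M x\<^esub>" if x: "x \<in> Ob C" and a: "a \<in> carrier (mod_at (trm Q 0) x)" for x a
          using ev[OF x, of a] a bd[OF x, of "l 0 x a"] lc[OF x a] unfolding 0 l0[OF x a] by simp
        then show ?thesis
          using hom_coboundaries_0[OF QE M', of ?d] dc by (simp add: 0 hom_complex_def)
      next
        case (Suc m)
        \<comment> \<open>The adjunct of the cocycle \<theta> is applied to \<psi> \<phi> - cv = d l
          + l d. It vanishes on d l, which leaves its composite with l d.\<close>
        define \<xi> where "\<xi> x a = ?bar (Suc m) \<theta> x (l m x a)" for x a
        have b: "?bar (Suc m) \<theta> \<in> nat_trans R D (KQ (Suc m)) M" using bar[OF \<theta>] Suc by simp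
        have \<xi>: "\<xi> \<in> nat_trans R C (trm Q m) (res_module F M)"
          unfolding \<xi>_def[abs_def] by (rule nat_trans_comp[OF l res_F_nat[OF b]])
        have "?d x a = \<xi> x (diff Q m x a)" if x: "x \<in> Ob C" and a:
            "a \<in> carrier (mod_at (trm Q (Suc m)) x)" for x a
        proof -
          interpret Mx: module R "mod_at M x" by (rule Mat[OF x])
          interpret Kx: module R "mod_at (KQ (Suc m)) x" by (rule Kat[OF x])
          let ?u = "\<psi> (Suc m) x (\<phi> (Suc m) x a) \<ominus>\<^bsub>mod_at (KQ (Suc m)) x\<^esub> cv (Suc m) x a"
          have u: "?u \<in> carrier (mod_at (KQ (Suc m)) x)"
            using \<psi>c \<phi>_closed cvc x a by simp
          have v: "l m x (diff Q m x a) \<in> carrier (mod_at (KQ (Suc m)) x)" using lc Qdc x a by simp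
          have "\<zero>\<^bsub>mod_at M x\<^esub> = ?bar (Suc m) \<theta> x (?u \<ominus>\<^bsub>mod_at (KQ (Suc m)) x\<^esub> l m x (diff Q m x a))"
            using bd[OF x, of "l (Suc m) x a"] lc[OF x a] lS[OF x a] by (simp add: Suc)
          also have "\<dots> = ?bar (Suc m) \<theta> x ?u \<ominus>\<^bsub>mod_at M x\<^esub> \<xi> x (diff Q m x a)"
            unfolding \<xi>_def by (rule lin_maps_diff[OF Kat[OF x] Mat[OF x] linK[OF b x] u v])
          finally have "?bar (Suc m) \<theta> x ?u = \<xi> x (diff Q m x a)"
            using Mx.M.minus_eq_zero_iff[OF lin_maps_closed[OF linK[OF b x] u] lin_maps_closed[OF
                linK[OF b x] v]]
            unfolding \<xi>_def by metis
          then show ?thesis using ev[OF x, of a] a unfolding Suc by simp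
        qed
        then show ?thesis
          using hom_coboundaries_Suc[OF QE M', of ?d m] dc \<xi> by (auto simp: Suc hom_complex_def)
      qed
    qed
    ultimately show "\<exists>z\<in>cocycles ?K (hom_diff D P) n. ?h n z \<ominus>\<^bsub>?K' n\<^esub> \<theta> \<in> coboundaries ?K' (hom_diff
        C Q) n"
      by blast
  qed
  then show ?thesis by (simp add: induced_map_def Ext_def)
qed

end

end

section \<open>Categories with a terminal object\<close>

text \<open>With t terminal, the constant module is represented by t, so an element e over t of
  augmentation 1 gives a natural section of the augmentation. Removing the resulting projection
  \<epsilon> from the identity leaves a null-homotopic map. The conclusion records positive degrees;
  in degree 0, d k is the identity minus \<epsilon>.\<close>

lemma contracting_homotopy:
  fixes R :: "'r ring" and E :: "('o, 'm) cat" and C :: "('p, 'n) cat"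
    and Q :: "('p, 'n, 'r, 'a, 'r) resolution"
  assumes R: "cring R" and E: "category E" and C: "category C" and J: "is_functor E C J"
    and rep: "sums_of_representables E C J"
    and Q: "projective_resolution R C (const_module R) Q"
    and t: "t \<in> Ob E" and \<tau>: "\<And>x. x \<in> Ob E \<Longrightarrow> \<tau> x \<in> Hom E x t"
    and \<tau>_nat: "\<And>x y f. x \<in> Ob E \<Longrightarrow> y \<in> Ob E \<Longrightarrow> f \<in> Hom E x y \<Longrightarrow> Cmp E (\<tau> y) f = \<tau> x"
  shows "\<exists>k. (\<forall>n. k n \<in> nat_trans R E (res_module J (trm Q n)) (res_module J (trm Q (Suc n)))) \<and>
    (\<forall>n. \<forall>x\<in>Ob E. \<forall>a\<in>carrier (mod_at (trm Q (Suc n)) (fun_ob J x)).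
       diff Q (Suc n) (fun_ob J x) (k (Suc n) x a) =
         a \<ominus>\<^bsub>mod_at (trm Q (Suc n)) (fun_ob J x)\<^esub> k n x (diff Q n (fun_ob J x) a))"
proof -
  interpret R: cring R by fact
  note cm = is_cat_module_const_module[OF R]
  note QE = projective_resolution_exact[OF Q cm]
  define Y where "Y = res_resolution J Q"
  have Y: "exact_resolution R E (const_module R) Y"
    unfolding Y_def using exact_resolution_res[OF J QE] by (simp add: res_const_module)
  interpret L: lifting_situation R E C J "const_module R" Q "const_module R" Y
    by (intro lifting_situation.intro R E C J rep Q cm Y)
  have trm: "trm Y n = res_module J (trm Q n)" and dif: "diff Y n x = diff Q n (fun_ob J x)"
    and aug: "aug Y x = aug Q (fun_ob J x)" for n x
    by (simp_all add: Y_def res_resolution_def)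
  have at: "mod_at (res_module J (trm Q n)) x = mod_at (trm Q n) (fun_ob J x)" for n x
    by (simp add: res_module_def)
  have cat: "carrier (mod_at (const_module R :: ('o, 'm, 'r, 'r) cat_module) x) = carrier R"
    "\<zero>\<^bsub>mod_at (const_module R :: ('o, 'm, 'r, 'r) cat_module) x\<^esub> = \<zero>\<^bsub>R\<^esub>"
    "mod_map (const_module R :: ('o, 'm, 'r, 'r) cat_module) x y f = (\<lambda>a. a)" for x y f
    by (simp_all add: const_module_def)
  note Y0 = exact_trm[OF Y, of 0] and Yat = cat_module_at[OF exact_trm[OF Y]]
  interpret Yt: module R "mod_at (trm Y 0) t" by (rule Yat[OF t])
  have "\<one>\<^bsub>R\<^esub> \<in> aug Y t ` carrier (mod_at (trm Y 0) t)"
    using exact_aug_surj[OF Y t] by (simp add: cat)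
  then obtain e where e: "e \<in> carrier (mod_at (trm Y 0) t)" "aug Y t e = \<one>\<^bsub>R\<^esub>" by auto
  \<comment> \<open>The augmentation followed by the section, which sends 1 at x to e moved along
    \<tau> x.\<close>
  define \<epsilon> where "\<epsilon> x a = mod_map (trm Y 0) x t (\<tau> x) (aug Y x a \<odot>\<^bsub>mod_at (trm Y 0) t\<^esub> e)" for x a
  have scal: "(\<lambda>r. r \<odot>\<^bsub>mod_at (trm Y 0) t\<^esub> e) \<in> lin_maps R (mod_at (const_module R) x) (mod_at (trm
      Y 0) t)" for x :: 'o
    using e(1) by (intro lin_mapsI) (auto simp: const_module_def Yt.smult_l_distr Yt.smult_assoc1)
  have augc: "aug Y x a \<in> carrier R" if "x \<in> Ob E" "a \<in> carrier (mod_at (trm Y 0) x)" for x a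
    using nat_trans_closed[OF exact_aug[OF Y] that] by (simp add: cat)
  have \<epsilon>: "\<epsilon> \<in> nat_trans R E (trm Y 0) (trm Y 0)"
  proof (rule nat_transI)
    fix x assume x: "x \<in> Ob E"
    show "\<epsilon> x \<in> lin_maps R (mod_at (trm Y 0) x) (mod_at (trm Y 0) x)"
      unfolding \<epsilon>_def[abs_def]
      using lin_maps_comp[OF lin_maps_comp[OF nat_trans_lin[OF exact_aug[OF Y] x] scal[of x]]
        cat_module_lin[OF Y0 x t \<tau>[OF x]]] .
  next
    fix x y f a assume h: "x \<in> Ob E" "y \<in> Ob E" "f \<in> Hom E x y" "a \<in> carrier (mod_at (trm Y 0) y)"
    have "aug Y x (mod_map (trm Y 0) x y f a) = aug Y y a"
      using nat_trans_nat[OF exact_aug[OF Y] h] by (simp add: cat)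
    then show "\<epsilon> x (mod_map (trm Y 0) x y f a) = mod_map (trm Y 0) x y f (\<epsilon> y a)"
      using cat_module_Cmp[OF Y0 h(1,2) t h(3) \<tau>[OF h(2)], of "aug Y y a \<odot>\<^bsub>mod_at (trm Y 0) t\<^esub> e"]
        \<tau>_nat[OF h(1-3)] augc[OF h(2,4)] e(1) by (simp add: \<epsilon>_def)
  qed
  have aug_\<epsilon>: "aug Y x (\<epsilon> x a) = aug Y x a" if x: "x \<in> Ob E" and a:
      "a \<in> carrier (mod_at (trm Y 0) x)" for x a
  proof -
    have "aug Y x (\<epsilon> x a) = aug Y t (aug Y x a \<odot>\<^bsub>mod_at (trm Y 0) t\<^esub> e)"
      unfolding \<epsilon>_def using nat_trans_nat[OF exact_aug[OF Y] x t \<tau>[OF x]] augc[OF x a] e(1)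
      by (simp add: cat)
    also have "\<dots> = aug Y x a \<odot>\<^bsub>mod_at (const_module R :: ('o, 'm, 'r, 'r) cat_module) t\<^esub> aug Y t e"
      by (rule lin_maps_smult[OF nat_trans_lin[OF exact_aug[OF Y] t] augc[OF x a] e(1)])
    also have "\<dots> = aug Y x a" using augc[OF x a] e(2) by (simp add: const_module_def)
    finally show ?thesis .
  qed
  have \<epsilon>c: "\<epsilon> x a \<in> carrier (mod_at (trm Y 0) x)" if "x \<in> Ob E" "a \<in> carrier (mod_at (trm Y 0) x)"
      for x a
    by (rule nat_trans_closed[OF \<epsilon> that])
  \<comment> \<open>The identity minus \<epsilon>, with \<epsilon> taken as zero in positive
    degrees. This is a chain map because \<epsilon> vanishes on boundaries.\<close>
  define g where "g n x a = (if n = 0 then a \<ominus>\<^bsub>mod_at (trm Y 0) x\<^esub> \<epsilon> x a else a)" for n :: nat and x a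
  have g: "g n \<in> nat_trans R E (res_module J (trm Q n)) (trm Y n)" for n
  proof (cases n)
    case 0
    have "(\<lambda>x a. a) \<in> nat_trans R E (trm Y 0) (trm Y 0)" by (simp add: nat_trans_def lin_maps_id)
    from nat_trans_minus[OF Y0 this \<epsilon>] show ?thesis by (simp add: g_def[abs_def] 0 trm)
  qed (simp add: g_def[abs_def] trm nat_trans_def lin_maps_id)
  have g0: "aug Y x (g 0 x a) = \<zero>\<^bsub>mod_at (const_module R :: ('o, 'm, 'r, 'r) cat_module) x\<^esub>"
    if x: "x \<in> Ob E" and a: "a \<in> carrier (mod_at (res_module J (trm Q 0)) x)" for x a
  proof -
    have cx: "module R (mod_at (const_module R :: ('o, 'm, 'r, 'r) cat_module) x)"
      by (rule cat_module_at[OF cm x])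
    have a: "a \<in> carrier (mod_at (trm Y 0) x)" using a by (simp add: trm)
    have "aug Y x (g 0 x a) = aug Y x a \<ominus>\<^bsub>mod_at (const_module R :: ('o, 'm, 'r, 'r) cat_module) x\<^esub>
        aug Y x (\<epsilon> x a)"
      using lin_maps_diff[OF Yat[OF x] cx nat_trans_lin[OF exact_aug[OF Y] x] a \<epsilon>c[OF x a]] by (simp
          add: g_def)
    then show ?thesis
      using aug_\<epsilon>[OF x a] abelian_group.minus_eq_zero_iff[OF module_ag[OF cx]] augc[OF x a] by (simp
          add: cat)
  qed
  have gS: "diff Y n x (g (Suc n) x a) = g n x (diff Q n (fun_ob J x) a)"
    if x: "x \<in> Ob E" and a: "a \<in> carrier (mod_at (res_module J (trm Q (Suc n))) x)" for n x a
  proof (cases n)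
    case 0
    interpret Yx: module R "mod_at (trm Y 0) x" by (rule Yat[OF x])
    have a: "a \<in> carrier (mod_at (trm Y (Suc 0)) x)" using a 0 by (simp add: trm)
    note d = exact_closed[OF Y x a]
    have "\<epsilon> x (diff Y 0 x a) = mod_map (trm Y 0) x t (\<tau> x) \<zero>\<^bsub>mod_at (trm Y 0) t\<^esub>"
      using exact_aug_diff[OF Y x a] e(1) by (simp add: \<epsilon>_def cat)
    also have "\<dots> = \<zero>\<^bsub>mod_at (trm Y 0) x\<^esub>"
      by (rule lin_maps_zero[OF Yat[OF t] Yat[OF x] cat_module_lin[OF Y0 x t \<tau>[OF x]]])
    finally have "g 0 x (diff Y 0 x a) = diff Y 0 x a \<ominus>\<^bsub>mod_at (trm Y 0) x\<^esub> \<zero>\<^bsub>mod_at (trm Y 0) x\<^esub>"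
      by (simp add: g_def)
    also have "\<dots> = diff Y 0 x a"
      using d by (metis a_minus_def Yx.M.l_zero Yx.M.r_neg Yx.M.r_zero Yx.M.a_inv_closed
          Yx.M.zero_closed)
    finally show ?thesis by (simp add: 0 g_def dif)
  qed (simp add: g_def dif)
  show ?thesis
    using L.homotopy_exists[OF g g0 gS] by (auto simp: trm dif at g_def)
qed

section \<open>Averaging\<close>

lemma lin_maps_finsum_pointwise:
  assumes "module R N" "finite A" "\<And>t. t \<in> A \<Longrightarrow> h t \<in> lin_maps R M N"
  shows "(\<lambda>x. \<Oplus>\<^bsub>N\<^esub>t\<in>A. h t x) \<in> lin_maps R M N"
proof -
  interpret module R N by fact
  show ?thesis
  proof (rule lin_mapsI)
    fix x y assume "x \<in> carrier M" "y \<in> carrier M"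
    then have c: "h t x \<in> carrier N" "h t y \<in> carrier N" if "t \<in> A" for t
      using that lin_maps_closed[OF assms(3)] by auto
    have "(\<Oplus>\<^bsub>N\<^esub>t\<in>A. h t (x \<oplus>\<^bsub>M\<^esub> y)) = (\<Oplus>\<^bsub>N\<^esub>t\<in>A. h t x \<oplus>\<^bsub>N\<^esub> h t y)"
      using c \<open>x \<in> carrier M\<close> \<open>y \<in> carrier M\<close> by (intro M.finsum_cong') (auto simp: lin_maps_add[OF
          assms(3)])
    then show "(\<Oplus>\<^bsub>N\<^esub>t\<in>A. h t (x \<oplus>\<^bsub>M\<^esub> y)) = (\<Oplus>\<^bsub>N\<^esub>t\<in>A. h t x) \<oplus>\<^bsub>N\<^esub> (\<Oplus>\<^bsub>N\<^esub>t\<in>A. h t y)"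
      using c by (simp add: M.finsum_addf Pi_iff)
  next
    fix r x assume "r \<in> carrier R" "x \<in> carrier M"
    then have c: "h t x \<in> carrier N" if "t \<in> A" for t
      using that lin_maps_closed[OF assms(3)] by auto
    have "(\<Oplus>\<^bsub>N\<^esub>t\<in>A. h t (r \<odot>\<^bsub>M\<^esub> x)) = (\<Oplus>\<^bsub>N\<^esub>t\<in>A. r \<odot>\<^bsub>N\<^esub> h t x)"
      using c \<open>x \<in> carrier M\<close> \<open>r \<in> carrier R\<close> by (intro M.finsum_cong') (auto simp:
          lin_maps_smult[OF assms(3)])
    then show "(\<Oplus>\<^bsub>N\<^esub>t\<in>A. h t (r \<odot>\<^bsub>M\<^esub> x)) = r \<odot>\<^bsub>N\<^esub> (\<Oplus>\<^bsub>N\<^esub>t\<in>A. h t x)"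
      using c \<open>r \<in> carrier R\<close> assms(2) by (simp add: finsum_smult_ldistr Pi_iff)
  qed (use assms(3) lin_maps_closed[OF assms(3)] in \<open>auto intro!: M.finsum_closed\<close>)
qed

context full_functor begin

text \<open>The \<open>\<alpha> U\<close> are the actions of inverses of coset representatives \<open>U\<close> of a Sylow
  subgroup; \<open>k\<close> is equivariant under that subgroup only, but its sum over the cosets is invariant
  modulo the fiber span.\<close>

lemma average_homotopy:
  assumes R: "cring R" and QE: "exact_resolution R C (const_module R) Q" and x: "x \<in> Ob C"
    and A: "finite A" and r: "r \<in> carrier R" "(\<Oplus>\<^bsub>R\<^esub>U\<in>A. r) = \<one>\<^bsub>R\<^esub>"
    and k: "\<And>n. k n \<in> lin_maps R (mod_at (trm Q n) x) (mod_at (trm Q (Suc n)) x)"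
    and kd: "\<And>n a. a \<in> carrier (mod_at (trm Q (Suc n)) x) \<Longrightarrow>
       diff Q (Suc n) x (k (Suc n) a) = a \<ominus>\<^bsub>mod_at (trm Q (Suc n)) x\<^esub> k n (diff Q n x a)"
    and \<alpha>: "\<And>U. U \<in> A \<Longrightarrow> \<alpha> U \<in> Hom C x x"
      "\<And>U. U \<in> A \<Longrightarrow> fun_mor F x x (\<alpha> U) = Idn D x"
    and inv: "\<And>n y f f' a. y \<in> Ob C \<Longrightarrow> f \<in> Hom C x y \<Longrightarrow> f' \<in> Hom C x y \<Longrightarrow>
       fun_mor F x y f = fun_mor F x y f' \<Longrightarrow> a \<in> carrier (mod_at (trm Q n) y) \<Longrightarrow>
      (\<Oplus>\<^bsub>mod_at (kan_module C F (trm Q (Suc n))) x\<^esub>U\<in>A. coinv C F (trm Q (Suc n)) x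
          (k n (mod_map (trm Q n) x x (\<alpha> U) (mod_map (trm Q n) x y f a)))) =
      (\<Oplus>\<^bsub>mod_at (kan_module C F (trm Q (Suc n))) x\<^esub>U\<in>A. coinv C F (trm Q (Suc n)) x
          (k n (mod_map (trm Q n) x x (\<alpha> U) (mod_map (trm Q n) x y f' a))))"
    and z: "z \<in> carrier (mod_at (trm Q (Suc n)) x)" and dz: "diff Q n x z \<in> fiber_span C F (trm Q n) x"
  shows "\<exists>w\<in>carrier (mod_at (trm Q (Suc (Suc n))) x).
        z \<ominus>\<^bsub>mod_at (trm Q (Suc n)) x\<^esub> diff Q (Suc n) x w \<in> fiber_span C F (trm Q (Suc n)) x"
proof -
  note Qm = exact_trm[OF QE] and Qat = cat_module_at[OF exact_trm[OF QE] x]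
  let ?Q = "\<lambda>n. mod_at (trm Q n) x" and ?K = "\<lambda>n. mod_at (kan_module C F (trm Q n)) x"
  let ?\<pi> = "\<lambda>n. coinv C F (trm Q n) x" and ?a = "\<lambda>n U. mod_map (trm Q n) x x (\<alpha> U)"
  note Kat = module_kan[OF Qm x] and pl = coinv_lin[OF Qm x] and pc = coinv_closed[OF Qm x]
  have al: "?a m U \<in> lin_maps R (?Q m) (?Q m)" if "U \<in> A" for m U
    by (rule cat_module_lin[OF Qm x x \<alpha>(1)[OF that]])
  have kl: "(\<lambda>a. k m (?a m U a)) \<in> lin_maps R (?Q m) (?Q (Suc m))" if "U \<in> A" for m U
    by (rule lin_maps_comp[OF al[OF that] k])
  \<comment> \<open>An equivariant average would also translate back by the representative after
    applying k. Modulo the fiber span that translation is trivial (\<open>\<pi>\<alpha>\<close>), so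
    it is omitted.\<close>
  define T where "T m a = (\<Oplus>\<^bsub>?Q (Suc m)\<^esub>U\<in>A. k m (?a m U a))" for m a
  have Tl: "T m \<in> lin_maps R (?Q m) (?Q (Suc m))" for m
    unfolding T_def[abs_def] by (rule lin_maps_finsum_pointwise[OF Qat A kl])
  have \<pi>T: "?\<pi> (Suc m) (T m a) = (\<Oplus>\<^bsub>?K (Suc m)\<^esub>U\<in>A. ?\<pi> (Suc m) (k m (?a m U a)))"
    if "a \<in> carrier (?Q m)" for m a
    unfolding T_def using that lin_maps_closed[OF kl] by (intro lin_maps_finsum[OF Qat Kat pl A]) auto
  have \<pi>\<alpha>: "?\<pi> m (?a m U a) = ?\<pi> m a" if "U \<in> A" "a \<in> carrier (?Q m)" for m U a
    using coinv_fiber[OF Qm x x \<alpha>(1)[OF that(1)] category_Idn[OF C x]] that \<alpha>(2) functor_Idn'[OF x]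
      cat_module_Idn[OF Qm x] by simp
  interpret Q1: module R "?Q (Suc n)" by (rule Qat)
  interpret K1: module R "?K (Suc n)" by (rule Kat)
  note dl = nat_trans_lin[OF exact_diff[OF QE] x]
  note dc = lin_maps_closed[OF dl]
  \<comment> \<open>Modulo the fiber span, d (T z) is the sum over A of copies of z, minus T (d z),
    and the latter vanishes. The scalar r turns the sum of copies back into z.\<close>
  define w where "w = r \<odot>\<^bsub>?Q (Suc (Suc n))\<^esub> T (Suc n) z"
  have w: "w \<in> carrier (?Q (Suc (Suc n)))"
    unfolding w_def using lin_maps_closed[OF Tl z] module.smult_closed[OF Qat r(1)] by blast
  have "diff Q (Suc n) x (T (Suc n) z) = (\<Oplus>\<^bsub>?Q (Suc n)\<^esub>U\<in>A. diff Q (Suc n) x (k (Suc n) (?a (Suc n)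
      U z)))"
    unfolding T_def using z lin_maps_closed[OF kl] by (intro lin_maps_finsum[OF Qat Qat dl A]) auto
  then have "?\<pi> (Suc n) (diff Q (Suc n) x (T (Suc n) z)) =
      (\<Oplus>\<^bsub>?K (Suc n)\<^esub>U\<in>A. ?\<pi> (Suc n) (diff Q (Suc n) x (k (Suc n) (?a (Suc n) U z))))"
    using z lin_maps_closed[OF kl] dc by (simp add: lin_maps_finsum[OF Qat Kat pl A])
  also have "\<dots> = (\<Oplus>\<^bsub>?K (Suc n)\<^esub>U\<in>A. ?\<pi> (Suc n) z \<oplus>\<^bsub>?K (Suc n)\<^esub> (\<ominus>\<^bsub>?K (Suc n)\<^esub> ?\<pi> (Suc n) (k n (?a n
      U (diff Q n x z)))))"
  proof (rule K1.M.finsum_cong')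
    fix U assume U: "U \<in> A"
    note az = lin_maps_closed[OF al[OF U] z]
    have e: "diff Q n x (?a (Suc n) U z) = ?a n U (diff Q n x z)"
      by (rule nat_trans_nat[OF exact_diff[OF QE] x x \<alpha>(1)[OF U] z])
    have "?\<pi> (Suc n) (diff Q (Suc n) x (k (Suc n) (?a (Suc n) U z))) =
        ?\<pi> (Suc n) (?a (Suc n) U z) \<ominus>\<^bsub>?K (Suc n)\<^esub> ?\<pi> (Suc n) (k n (?a n U (diff Q n x z)))"
      using kd[OF az] lin_maps_diff[OF Qat Kat pl az lin_maps_closed[OF kl[OF U] dc[OF z]]] by (simp
          add: e)
    then show "?\<pi> (Suc n) (diff Q (Suc n) x (k (Suc n) (?a (Suc n) U z))) =
      ?\<pi> (Suc n) z \<oplus>\<^bsub>?K (Suc n)\<^esub> (\<ominus>\<^bsub>?K (Suc n)\<^esub> ?\<pi> (Suc n) (k n (?a n U (diff Q n x z))))"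
      by (simp add: \<pi>\<alpha>[OF U z] a_minus_def)
  qed (use z dc lin_maps_closed[OF kl] pc in auto)
  also have "\<dots> = (\<Oplus>\<^bsub>?K (Suc n)\<^esub>U\<in>A. ?\<pi> (Suc n) z) \<oplus>\<^bsub>?K (Suc n)\<^esub> (\<Oplus>\<^bsub>?K (Suc n)\<^esub>U\<in>A. \<ominus>\<^bsub>?K (Suc n)\<^esub> ?\<pi>
      (Suc n) (k n (?a n U (diff Q n x z))))"
    using z dc lin_maps_closed[OF kl] pc by (intro K1.M.finsum_addf) auto
  also have "(\<Oplus>\<^bsub>?K (Suc n)\<^esub>U\<in>A. \<ominus>\<^bsub>?K (Suc n)\<^esub> ?\<pi> (Suc n) (k n (?a n U (diff Q n x z))))
      = \<ominus>\<^bsub>?K (Suc n)\<^esub> ?\<pi> (Suc n) (T n (diff Q n x z))"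
  proof -
    have "(\<lambda>u. \<ominus>\<^bsub>?K (Suc n)\<^esub> u) \<in> lin_maps R (?K (Suc n)) (?K (Suc n))"
      by (rule lin_mapsI) (auto simp: K1.M.minus_add K1.smult_r_minus)
    from lin_maps_finsum[OF Kat Kat this A, of "\<lambda>U. ?\<pi> (Suc n) (k n (?a n U (diff Q n x z)))"]
    show ?thesis using z dc lin_maps_closed[OF kl] pc by (simp add: \<pi>T)
  qed
  \<comment> \<open>By \<open>inv\<close>, the class of T takes equal values on actions of morphisms
    with equal image, so it kills the fiber span, where d z lies.\<close>
  also have "?\<pi> (Suc n) (T n (diff Q n x z)) = \<zero>\<^bsub>?K (Suc n)\<^esub>"
  proof -
    have "?\<pi> (Suc n) (T n (mod_map (trm Q n) x y f a)) = ?\<pi> (Suc n) (T n (mod_map (trm Q n) x y f' a))"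
      if "y \<in> Ob C" "f \<in> Hom C x y" "f' \<in> Hom C x y" "fun_mor F x y f = fun_mor F x y f'"
        "a \<in> carrier (mod_at (trm Q n) y)" for y f f' a
      using inv[OF that] that cat_module_closed[OF Qm x that(1)] by (simp add: \<pi>T)
    then show ?thesis
      using fiber_span_kernel[OF Qm Kat x lin_maps_comp[OF Tl pl] _ dz] by blast
  qed
  finally have 1: "?\<pi> (Suc n) (diff Q (Suc n) x (T (Suc n) z)) = (\<Oplus>\<^bsub>?K (Suc n)\<^esub>U\<in>A. ?\<pi> (Suc n) z)"
    using pc[OF z] K1.M.r_neg[OF K1.M.zero_closed] by simp
  have sum: "(\<Oplus>\<^bsub>?K (Suc n)\<^esub>U\<in>B. r \<odot>\<^bsub>?K (Suc n)\<^esub> ?\<pi> (Suc n) z) = (\<Oplus>\<^bsub>R\<^esub>U\<in>B. r) \<odot>\<^bsub>?K (Suc n)\<^esub> ?\<pi> (Suc n) z"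
    if "finite B" for B
    using that by induction (auto simp: r pc[OF z] K1.smult_l_distr)
  have "?\<pi> (Suc n) (diff Q (Suc n) x w) = r \<odot>\<^bsub>?K (Suc n)\<^esub> ?\<pi> (Suc n) (diff Q (Suc n) x (T (Suc n) z))"
    unfolding w_def using lin_maps_smult[OF lin_maps_comp[OF dl pl] r(1) lin_maps_closed[OF Tl z]] .
  also have "\<dots> = ?\<pi> (Suc n) z"
    unfolding 1 using sum[OF A] r pc[OF z] by (simp add: K1.finsum_smult_ldistr[OF A r(1)])
  finally have "z \<ominus>\<^bsub>?Q (Suc n)\<^esub> diff Q (Suc n) x w \<in> fiber_span C F (trm Q (Suc n)) x"
    using coinv_eq_iff[OF Qm x z dc[OF w]] by simp
  then show ?thesis using w by blast
qed

end

section \<open>Overgroups of \<open>H\<close> in a product with a subgroup of the centralizer\<close>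

context group begin

lemma transporter_iff:
  "H \<subseteq> carrier G \<Longrightarrow> g \<in> transporter G H K \<longleftrightarrow> g \<in> carrier G \<and> (\<forall>x\<in>H. g \<otimes> x \<otimes> inv g \<in> K)"
  unfolding transporter_def l_coset_def r_coset_def by auto

lemma rcos_eq_iff:
  assumes "subgroup K G" "a \<in> carrier G" "b \<in> carrier G"
  shows "K #> a = K #> b \<longleftrightarrow> a \<in> K #> b"
  using assms repr_independence[of a K b] rcos_self[of a K] by metis

lemma centralizer_transporter:
  assumes "subgroup H G" "c \<in> centralizer G H"
  shows "c \<in> transporter G H H"
proof -
  have H: "H \<subseteq> carrier G" using assms(1) subgroup.subset by auto
  have c: "c \<in> carrier G" using assms(2) by (simp add: centralizer_def)
  have "c \<otimes> x \<otimes> inv c \<in> H" if x: "x \<in> H" for x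
  proof -
    have "c \<otimes> x = x \<otimes> c" using assms(2) x by (simp add: centralizer_def)
    then have "c \<otimes> x \<otimes> inv c = x" using c x H by (simp add: m_assoc subset_iff)
    then show ?thesis using x by simp
  qed
  then show ?thesis using c by (simp add: transporter_iff[OF H])
qed

text \<open>Elements of H and S commute, so multiplication is a homomorphism from the direct product
  of H and S onto HS. Hence |HS| divides |H| |S|, a power of p. The last conclusion, that HS
  normalizes H, makes H lie in the representing groups found below.\<close>

lemma p_subgroup_mult_centralizing:
  assumes p: "prime p" and H: "p_subgroup p G H" and S: "p_subgroup p G S" and SC: "S \<subseteq> centralizer G H"
  shows "p_subgroup p G (H <#> S)" "H \<subseteq> H <#> S" "S \<subseteq> H <#> S" "H <#> S \<subseteq> transporter G H H"
proof -
  have Hs: "subgroup H G" and Ss: "subgroup S G" using H S by (auto simp: p_subgroup_def)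
  have Hc: "H \<subseteq> carrier G" and Sc: "S \<subseteq> carrier G" using Hs Ss subgroup.subset by auto
  have comm: "s \<otimes> h = h \<otimes> s" if "s \<in> S" "h \<in> H" for s h
    using SC that by (auto simp: centralizer_def)
  have swap: "(h \<otimes> s) \<otimes> (h' \<otimes> s') = (h \<otimes> h') \<otimes> (s \<otimes> s')"
    if "h \<in> H" "s \<in> S" "h' \<in> H" "s' \<in> S" for h s h' s'
  proof -
    have c: "h \<in> carrier G" "s \<in> carrier G" "h' \<in> carrier G" "s' \<in> carrier G" using that Hc Sc by auto
    have "(h \<otimes> s) \<otimes> (h' \<otimes> s') = h \<otimes> (s \<otimes> h') \<otimes> s'" using c by (simp add: m_assoc)
    also have "\<dots> = h \<otimes> (h' \<otimes> s) \<otimes> s'" using comm that by simp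
    finally show ?thesis using c by (simp add: m_assoc)
  qed
  have K: "subgroup (H <#> S) G"
  proof (rule subgroupI)
    show "H <#> S \<subseteq> carrier G" using Hc Sc by (rule set_mult_closed)
    show "H <#> S \<noteq> {}"
      using subgroup.one_closed[OF Hs] subgroup.one_closed[OF Ss] by (auto simp: set_mult_def)
  next
    fix k assume "k \<in> H <#> S"
    then obtain h s where h: "h \<in> H" "s \<in> S" "k = h \<otimes> s" by (auto simp: set_mult_def)
    then have "inv k = inv h \<otimes> inv s"
      using Hc Sc comm[of "inv s" "inv h"] subgroup.m_inv_closed[OF Hs] subgroup.m_inv_closed[OF Ss]
      by (simp add: inv_mult_group subset_iff)
    then show "inv k \<in> H <#> S"
      using h subgroup.m_inv_closed[OF Hs] subgroup.m_inv_closed[OF Ss] by (auto simp: set_mult_def)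
  next
    fix k k' assume "k \<in> H <#> S" "k' \<in> H <#> S"
    then obtain h s h' s' where h: "h \<in> H" "s \<in> S" "k = h \<otimes> s" "h' \<in> H" "s' \<in> S" "k' = h' \<otimes> s'"
      by (auto simp: set_mult_def)
    then show "k \<otimes> k' \<in> H <#> S"
      using swap[OF h(1,2,4,5)] subgroup.m_closed[OF Hs h(1,4)] subgroup.m_closed[OF Ss h(2,5)]
      by (auto simp: set_mult_def)
  qed
  let ?GH = "G\<lparr>carrier := H\<rparr>" and ?GS = "G\<lparr>carrier := S\<rparr>" and ?GK = "G\<lparr>carrier := H <#> S\<rparr>"
  let ?f = "\<lambda>(h, s). h \<otimes> s"
  have gH: "group ?GH" and gS: "group ?GS" and gK: "group ?GK"
    using Hs Ss K subgroup.subgroup_is_group is_group by auto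
  have g: "group (?GH \<times>\<times> ?GS)" using gH gS by (rule DirProd_group)
  have im: "?f ` carrier (?GH \<times>\<times> ?GS) = carrier ?GK" by (force simp: set_mult_def DirProd_def)
  have hom: "?f \<in> hom (?GH \<times>\<times> ?GS) ?GK"
    by (rule homI) (auto simp: DirProd_def set_mult_def intro: swap[symmetric])
  interpret f: group_hom "?GH \<times>\<times> ?GS" ?GK ?f
    using g gK hom by (simp add: group_hom_def group_hom_axioms_def)
  let ?N = "kernel (?GH \<times>\<times> ?GS) ?GK ?f"
  have "card (carrier ((?GH \<times>\<times> ?GS) Mod ?N)) = card (H <#> S)"
    using f.FactGroup_iso_set[OF im] by (auto simp: iso_def dest: bij_betw_same_card)
  then have "card (H <#> S) * card ?N = order (?GH \<times>\<times> ?GS)"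
    using group.lagrange[OF g f.subgroup_kernel] by (simp add: FactGroup_def)
  then have "card H * card S = card (H <#> S) * card ?N"
    by (simp add: order_def card_cartesian_product)
  then have "card (H <#> S) dvd card H * card S" by (rule dvdI)
  moreover obtain a b where "card H = p ^ a" "card S = p ^ b" using H S by (auto simp: p_subgroup_def)
  ultimately have "card (H <#> S) dvd p ^ (a + b)" by (simp add: power_add)
  then obtain i where "card (H <#> S) = p ^ i" using divides_primepow_nat[OF p] by blast
  with K show "p_subgroup p G (H <#> S)" by (auto simp: p_subgroup_def)
  show "H \<subseteq> H <#> S"
  proof
    fix h assume h: "h \<in> H"
    then have "h = h \<otimes> \<one>" using Hc by auto
    then show "h \<in> H <#> S" using h subgroup.one_closed[OF Ss] unfolding set_mult_def by blast
  qed
  show "S \<subseteq> H <#> S"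
  proof
    fix s assume s: "s \<in> S"
    then have "s = \<one> \<otimes> s" using Sc by auto
    then show "s \<in> H <#> S" using s subgroup.one_closed[OF Hs] unfolding set_mult_def by blast
  qed
  show "H <#> S \<subseteq> transporter G H H"
  proof
    fix k assume "k \<in> H <#> S"
    then obtain h s where h: "h \<in> H" "s \<in> S" "k = h \<otimes> s" by (auto simp: set_mult_def)
    have c: "h \<in> carrier G" using h Hc by auto
    have "h \<in> transporter G H H"
      unfolding transporter_iff[OF Hc]
      using h c subgroup.m_closed[OF Hs] subgroup.m_inv_closed[OF Hs] by auto
    then show "k \<in> transporter G H H"
      using transporter_mult[OF centralizer_transporter[OF Hs] _ Hc Hc, of s h] SC h by auto
  qed
qed

lemma p_subgroup_subgroup:
  assumes p: "prime p" and K: "p_subgroup p G K" and L: "subgroup L G" "L \<subseteq> K"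
  shows "p_subgroup p G L"
proof -
  have Ks: "subgroup K G" using K by (simp add: p_subgroup_def)
  interpret GK: group "G\<lparr>carrier := K\<rparr>" using subgroup.subgroup_is_group[OF Ks is_group] .
  have "card L dvd card K"
    using GK.lagrange[OF subgroup_incl[OF L(1) Ks L(2)]] by (simp add: order_def) (metis dvd_triv_right)
  then show ?thesis using K L(1) divides_primepow_nat[OF p] by (auto simp: p_subgroup_def)
qed

section \<open>The category of groups between H and K\<close>

context
  fixes K H :: "'a set" and \<C> :: "'a set set"
  assumes K: "subgroup K G" and H: "H \<subseteq> K" and norm: "K \<subseteq> transporter G H H"
    and sub: "\<And>X. X \<in> \<C> \<Longrightarrow> subgroup X G"
    and over: "\<And>L. subgroup L G \<Longrightarrow> H \<subseteq> L \<Longrightarrow> L \<subseteq> K \<Longrightarrow> L \<in> \<C>"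
begin

definition between :: "('a set, 'a set) cat" where
  "between = orbit_category (G\<lparr>carrier := K\<rparr>) {L. subgroup L G \<and> H \<subseteq> L \<and> L \<subseteq> K}"

lemma between_Ob: "L \<in> Ob between \<longleftrightarrow> subgroup L G \<and> H \<subseteq> L \<and> L \<subseteq> K"
  by (simp add: between_def orbit_category_def)

lemma between_Idn: "Idn between L = L" and between_Cmp: "Cmp between V U = V <#> U"
  by (simp_all add: between_def orbit_category_def set_mult_def)

lemma between_Hom: "Hom between L L' = {L' #> g | g. g \<in> K \<and> g \<in> transporter G L L'}"
proof -
  have "g \<in> transporter (G\<lparr>carrier := K\<rparr>) L L' \<longleftrightarrow> g \<in> K \<and> g \<in> transporter G L L'" for g
    using m_inv_consistent[OF K, of g] subgroup.subset[OF K]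
    by (auto simp: transporter_def l_coset_def r_coset_def)
  then show ?thesis by (auto simp: between_def orbit_category_def r_coset_def)
qed

lemma category_between: "category between"
proof -
  interpret GK: group "G\<lparr>carrier := K\<rparr>" using subgroup.subgroup_is_group[OF K is_group] .
  show ?thesis unfolding between_def
    by (rule GK.category_orbit_category) (use subgroup_incl K in auto)
qed

lemma orbit_category_sel: "Ob (orbit_category G \<C>) = \<C>"
  "Hom (orbit_category G \<C>) L X = {X #> g | g. g \<in> transporter G L X}"
  "Idn (orbit_category G \<C>) L = L" "Cmp (orbit_category G \<C>) V U = V <#> U"
  by (simp_all add: orbit_category_def)

lemma is_functor_between: "is_functor between (orbit_category G \<C>) id_functor"
  unfolding is_functor_def
  by (auto simp: between_Ob between_Idn between_Cmp between_Hom orbit_category_sel over)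

text \<open>The summands of \<open>Hom (-) X\<close> are indexed by the double cosets \<open>X g K\<close>: a morphism \<open>X \<gamma> k\<close> with
  \<open>k\<close> in \<open>K\<close> factors through the intersection of \<open>K\<close> with \<open>\<gamma>\<^sup>-\<^sup>1 X \<gamma>\<close>, where \<open>\<gamma>\<close> is a fixed
  representative of the double coset.\<close>

lemma sums_of_representables_between: "sums_of_representables between (orbit_category G \<C>) id_functor"
proof -
  have Kc: "K \<subseteq> carrier G" using K subgroup.subset by auto
  have Hc: "H \<subseteq> carrier G" using H Kc by auto
  \<comment> \<open>Depends only on the set f K, that is on the double coset, and so stays the same
    when f is composed with a morphism of \<open>between\<close>.\<close>
  define \<gamma> where "\<gamma> f = (SOME g. g \<in> f <#> K)" for f
  define Y where "Y X f = {k \<in> K. \<gamma> f \<otimes> k \<otimes> inv (\<gamma> f) \<in> X}" for X f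
  \<comment> \<open>The coset Y k for any k in K with f = X \<gamma> k (\<open>\<iota>_eq\<close>),
    described as a set so that no choice of k enters.\<close>
  define \<iota> where "\<iota> f = {k \<in> K. \<gamma> f \<otimes> k \<in> f}" for f
  have main: "\<exists>k\<in>K. \<gamma> f \<in> carrier G \<and> f = X #> (\<gamma> f \<otimes> k) \<and> k \<in> transporter G L (Y X f) \<and>
      subgroup (Y X f) G \<and> H \<subseteq> Y X f"
    if X: "X \<in> \<C>" and L: "subgroup L G" "H \<subseteq> L" "L \<subseteq> K" and f: "f = X #> g" "g \<in> transporter G L X"
        for X L f g
  proof -
    note Xs = sub[OF X]
    have Xc: "X \<subseteq> carrier G" and Lc: "L \<subseteq> carrier G"
      using subgroup.subset[OF Xs] subgroup.subset[OF L(1)] by auto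
    have gc: "g \<in> carrier G" using f(2) by (simp add: transporter_def)
    have "g \<in> f" using rcos_self[OF gc Xs] f by simp
    then have "g \<otimes> \<one> \<in> f <#> K" using subgroup.one_closed[OF K] unfolding set_mult_def by blast
    then have "\<gamma> f \<in> f <#> K" unfolding \<gamma>_def by (rule someI)
    then obtain x k0 where \<gamma>: "x \<in> X" "k0 \<in> K" "\<gamma> f = x \<otimes> g \<otimes> k0"
      by (auto simp: set_mult_def r_coset_def f(1))
    have c: "x \<in> carrier G" "k0 \<in> carrier G" "\<gamma> f \<in> carrier G" using \<gamma> Xc Kc gc by auto
    \<comment> \<open>Since \<gamma> = x g k0 with x in X, the coset f = X g equals X \<gamma>
      k0^-1, so k0^-1 is the element of K sought.\<close>
    let ?k = "inv k0"
    have k: "?k \<in> K" using subgroup.m_inv_closed[OF K \<gamma>(2)] .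
    have gk: "\<gamma> f \<otimes> ?k = x \<otimes> g" using c gc \<gamma>(3) by (simp add: m_assoc)
    have "x \<otimes> g \<in> X #> g" using \<gamma>(1) by (auto simp: r_coset_def)
    then have "X #> (x \<otimes> g) = X #> g" using rcos_eq_iff[OF Xs, of "x \<otimes> g" g] gc c by simp
    then have fk: "f = X #> (\<gamma> f \<otimes> ?k)" unfolding gk by (simp add: f(1))
    have conj: "(x \<otimes> g) \<otimes> l \<otimes> inv (x \<otimes> g) \<in> X" if l: "l \<in> L" for l
    proof -
      have lc: "l \<in> carrier G" using l Lc by auto
      have "g \<otimes> l \<otimes> inv g \<in> X" using transporterD(2)[OF f(2) l Lc] .
      then have "x \<otimes> (g \<otimes> l \<otimes> inv g) \<otimes> inv x \<in> X"
        using \<gamma>(1) subgroup.m_closed[OF Xs] subgroup.m_inv_closed[OF Xs] by auto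
      then show ?thesis using c gc lc by (simp add: m_assoc inv_mult_group)
    qed
    have Ysub: "subgroup (Y X f) G"
    proof (rule subgroupI)
      show "Y X f \<subseteq> carrier G" using Kc by (auto simp: Y_def)
      have "\<one> \<in> Y X f" using subgroup.one_closed[OF K] subgroup.one_closed[OF Xs] c by (simp add: Y_def)
      then show "Y X f \<noteq> {}" by auto
    next
      fix a assume a: "a \<in> Y X f"
      then have ac: "a \<in> carrier G" using Kc by (auto simp: Y_def)
      have "inv (\<gamma> f \<otimes> a \<otimes> inv (\<gamma> f)) \<in> X" using a subgroup.m_inv_closed[OF Xs] by (simp add: Y_def)
      moreover have "inv (\<gamma> f \<otimes> a \<otimes> inv (\<gamma> f)) = \<gamma> f \<otimes> inv a \<otimes> inv (\<gamma> f)"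
        using ac c by (simp add: inv_mult_group m_assoc)
      ultimately show "inv a \<in> Y X f" using a subgroup.m_inv_closed[OF K] by (simp add: Y_def)
    next
      fix a b assume a: "a \<in> Y X f" and b: "b \<in> Y X f"
      then have ac: "a \<in> carrier G" "b \<in> carrier G" using Kc by (auto simp: Y_def)
      have "(\<gamma> f \<otimes> a \<otimes> inv (\<gamma> f)) \<otimes> (\<gamma> f \<otimes> b \<otimes> inv (\<gamma> f)) \<in> X"
        using a b subgroup.m_closed[OF Xs] by (simp add: Y_def)
      moreover have "(\<gamma> f \<otimes> a \<otimes> inv (\<gamma> f)) \<otimes> (\<gamma> f \<otimes> b \<otimes> inv (\<gamma> f)) = \<gamma> f \<otimes> (a \<otimes> b) \<otimes> inv (\<gamma> f)"
        using ac c by (simp add: m_assoc flip: m_assoc[of "inv (\<gamma> f)" "\<gamma> f"])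
      ultimately show "a \<otimes> b \<in> Y X f" using a b subgroup.m_closed[OF K] by (simp add: Y_def)
    qed
    have kY: "?k \<otimes> l \<otimes> inv ?k \<in> Y X f" if l: "l \<in> L" for l
    proof -
      have lc: "l \<in> carrier G" "l \<in> K" using l Lc L by auto
      have "\<gamma> f \<otimes> (?k \<otimes> l \<otimes> inv ?k) \<otimes> inv (\<gamma> f) = (\<gamma> f \<otimes> ?k) \<otimes> l \<otimes> inv (\<gamma> f \<otimes> ?k)"
        using c lc by (simp add: m_assoc inv_mult_group)
      then show ?thesis
        using conj[OF l] k lc subgroup.m_closed[OF K] subgroup.m_inv_closed[OF K] unfolding gk by
            (auto simp: Y_def)
    qed
    \<comment> \<open>Here K has to normalize H: conjugation by k0 keeps h in H, hence in L, and
      \<open>kY\<close> conjugates it back into Y.\<close>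
    have "H \<subseteq> Y X f"
    proof
      fix h assume h: "h \<in> H"
      have "k0 \<in> transporter G H H" using norm \<gamma>(2) by auto
      then have "k0 \<otimes> h \<otimes> inv k0 \<in> H" using transporterD(2) h Hc by blast
      then have "k0 \<otimes> h \<otimes> inv k0 \<in> L" using L by auto
      from kY[OF this] show "h \<in> Y X f"
        using c h Hc by (simp add: m_assoc subset_iff flip: m_assoc[of "inv k0" k0])
    qed
    moreover have "?k \<in> transporter G L (Y X f)" using kY k Kc by (auto simp: transporter_iff[OF Lc])
    ultimately show ?thesis using k fk Ysub c by blast
  qed
  have \<iota>_eq: "\<iota> f = Y X f #> k"
    if X: "X \<in> \<C>" and k: "k \<in> K" "\<gamma> f \<in> carrier G" "f = X #> (\<gamma> f \<otimes> k)" for X f k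
  proof -
    have kc: "k \<in> carrier G" using k Kc by auto
    have Xc: "X \<subseteq> carrier G" using sub[OF X] subgroup.subset by auto
    show ?thesis
    proof (intro equalityI subsetI)
      fix u assume "u \<in> \<iota> f"
      then have u: "u \<in> K" "\<gamma> f \<otimes> u \<in> f" by (auto simp: \<iota>_def)
      then have uc: "u \<in> carrier G" using Kc by auto
      obtain x where x: "x \<in> X" "\<gamma> f \<otimes> u = x \<otimes> (\<gamma> f \<otimes> k)" using u(2) k(3) by (auto simp: r_coset_def)
      have xc: "x \<in> carrier G" using x Xc by auto
      have "\<gamma> f \<otimes> (u \<otimes> inv k) \<otimes> inv (\<gamma> f) = (\<gamma> f \<otimes> u) \<otimes> inv k \<otimes> inv (\<gamma> f)"
        using uc kc k(2) by (simp add: m_assoc)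
      also have "\<dots> = x" unfolding x(2) using xc kc k(2)
        by (simp add: m_assoc)
      finally have "u \<otimes> inv k \<in> Y X f"
        using x u k subgroup.m_closed[OF K] subgroup.m_inv_closed[OF K] by (simp add: Y_def)
      moreover have "u = (u \<otimes> inv k) \<otimes> k" using uc kc by (simp add: m_assoc)
      ultimately show "u \<in> Y X f #> k" unfolding r_coset_def by blast
    next
      fix u assume "u \<in> Y X f #> k"
      then obtain y where y: "y \<in> Y X f" "u = y \<otimes> k" by (auto simp: r_coset_def)
      then have yc: "y \<in> carrier G" "y \<in> K" "\<gamma> f \<otimes> y \<otimes> inv (\<gamma> f) \<in> X" using Kc by (auto simp: Y_def)
      have "\<gamma> f \<otimes> u = (\<gamma> f \<otimes> y \<otimes> inv (\<gamma> f)) \<otimes> (\<gamma> f \<otimes> k)"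
        using y yc kc k(2) by (simp add: m_assoc flip: m_assoc[of "inv (\<gamma> f)" "\<gamma> f"])
      then have "\<gamma> f \<otimes> u \<in> f" using yc k(3) unfolding r_coset_def by blast
      then show "u \<in> \<iota> f" using y yc k subgroup.m_closed[OF K] by (simp add: \<iota>_def)
    qed
  qed
  have YK: "Y X f \<subseteq> K" for X f by (auto simp: Y_def)
  have \<gamma>Y: "\<gamma> f \<in> transporter G (Y X f) X" if "\<gamma> f \<in> carrier G" for X f
    using that Kc YK by (subst transporter_iff) (auto simp: Y_def)
  have "representable_decomposition between (orbit_category G \<C>) id_functor
      (\<lambda>X L f. Y X f) (\<lambda>X L f. X #> \<gamma> f) (\<lambda>X L f. \<iota> f)"
    unfolding representable_decomposition_def orbit_category_sel(1)
  proof (intro ballI)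
    fix X L f assume X: "X \<in> \<C>" and L: "L \<in> Ob between" and
        "f \<in> Hom (orbit_category G \<C>) (fun_ob id_functor L) X"
    then obtain g where f: "f = X #> g" "g \<in> transporter G L X" by (auto simp: orbit_category_sel)
    have L: "subgroup L G" "H \<subseteq> L" "L \<subseteq> K" using L by (auto simp: between_Ob)
    obtain k where k: "k \<in> K" "\<gamma> f \<in> carrier G" "f = X #> (\<gamma> f \<otimes> k)" "k \<in> transporter G L (Y X f)"
      and Y: "subgroup (Y X f) G" "H \<subseteq> Y X f"
      using main[OF X L f] by blast
    note \<iota>k = \<iota>_eq[OF X k(1-3)]
    have "Y X f \<in> Ob between" using Y YK by (simp add: between_Ob)
    moreover have "X #> \<gamma> f \<in> Hom (orbit_category G \<C>) (fun_ob id_functor (Y X f)) X"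
      using \<gamma>Y[OF k(2)] by (auto simp: orbit_category_sel)
    moreover have "\<iota> f \<in> Hom between L (Y X f)" using \<iota>k k by (auto simp: between_Hom)
    moreover have "(X #> \<gamma> f) <#> \<iota> f = f"
      unfolding \<iota>k using orbit_comp[OF L(1) Y(1) sub[OF X] k(4) \<gamma>Y[OF k(2)]] k(3) by simp
    moreover have "Y X (f <#> g') = Y X f \<and> X #> \<gamma> (f <#> g') = X #> \<gamma> f \<and> \<iota> (f <#> g') = \<iota> f <#> g'"
      if L': "L' \<in> Ob between" and g': "g' \<in> Hom between L' L" for L' g'
    proof -
      have L's: "subgroup L' G" using L' by (simp add: between_Ob)
      obtain k' where k': "g' = L #> k'" "k' \<in> K" "k' \<in> transporter G L' L" using g' by (auto simp:
          between_Hom)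
      have gc: "g \<in> carrier G" "k' \<in> carrier G" "k \<in> carrier G" using f(2) k'(2) k(1) Kc by (auto
          simp: transporter_def)
      have Xc: "X \<subseteq> carrier G" using sub[OF X] subgroup.subset by auto
      have fg: "f <#> g' = X #> (g \<otimes> k')"
        unfolding f(1) k'(1) using orbit_comp[OF L's L(1) sub[OF X] k'(3) f(2)] by simp
      \<comment> \<open>The morphism g' is represented by an element k' of K, so the double coset
        does not change, and neither do \<gamma> and Y.\<close>
      have "(f <#> g') <#> K = f <#> K"
      proof (intro equalityI subsetI)
        fix u assume "u \<in> (f <#> g') <#> K"
        then obtain x l where u: "x \<in> X" "l \<in> K" "u = (x \<otimes> (g \<otimes> k')) \<otimes> l"
          unfolding fg by (auto simp: set_mult_def r_coset_def)
        then have "u = (x \<otimes> g) \<otimes> (k' \<otimes> l)" using gc Xc Kc by (simp add: m_assoc subset_iff)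
        moreover have "x \<otimes> g \<in> f" unfolding f(1) r_coset_def using u(1) by blast
        moreover have "k' \<otimes> l \<in> K" using u(2) subgroup.m_closed[OF K k'(2)] by blast
        ultimately show "u \<in> f <#> K" unfolding set_mult_def by blast
      next
        fix u assume "u \<in> f <#> K"
        then obtain x l where u: "x \<in> X" "l \<in> K" "u = (x \<otimes> g) \<otimes> l"
          unfolding f(1) by (auto simp: set_mult_def r_coset_def)
        then have "u = (x \<otimes> (g \<otimes> k')) \<otimes> (inv k' \<otimes> l)"
          using gc Xc Kc by (simp add: m_assoc subset_iff flip: m_assoc[of k' "inv k'"])
        moreover have "x \<otimes> (g \<otimes> k') \<in> f <#> g'" unfolding fg r_coset_def using u(1) by blast
        moreover have "inv k' \<otimes> l \<in> K"
          using u(2) subgroup.m_closed[OF K subgroup.m_inv_closed[OF K k'(2)]] by blast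
        ultimately show "u \<in> (f <#> g') <#> K" unfolding set_mult_def[of _ _ K] by blast
      qed
      then have \<gamma>: "\<gamma> (f <#> g') = \<gamma> f" by (simp add: \<gamma>_def)
      then have Y': "Y X (f <#> g') = Y X f" by (simp add: Y_def)
      have "f <#> g' = X #> (\<gamma> f \<otimes> (k \<otimes> k'))"
      proof -
        have "g \<in> X #> (\<gamma> f \<otimes> k)" using rcos_self[OF gc(1) sub[OF X]] f(1) k(3) by simp
        then have "X #> (\<gamma> f \<otimes> k) #> k' = X #> g #> k'" using f(1) k(3) by simp
        then show ?thesis using fg gc k(2) Xc by (simp add: coset_mult_assoc m_assoc)
      qed
      then have "\<iota> (f <#> g') = Y X f #> (k \<otimes> k')"
        using \<iota>_eq[OF X, of "k \<otimes> k'" "f <#> g'"] \<gamma> Y' k(2) subgroup.m_closed[OF K k(1) k'(2)] by simp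
      also have "\<dots> = \<iota> f <#> g'"
        unfolding \<iota>k k'(1) using orbit_comp[OF L's L(1) Y(1) k'(3) k(4)] by simp
      finally show ?thesis using \<gamma> Y' by simp
    qed
    ultimately show "Y X f \<in> Ob between \<and> X #> \<gamma> f \<in> Hom (orbit_category G \<C>) (fun_ob id_functor (Y
        X f)) X \<and>
        \<iota> f \<in> Hom between L (Y X f) \<and>
        Cmp (orbit_category G \<C>) (X #> \<gamma> f) (fun_mor id_functor L (Y X f) (\<iota> f)) = f \<and>
        (\<forall>L'\<in>Ob between. \<forall>g\<in>Hom between L' L.
           Y X (Cmp (orbit_category G \<C>) f (fun_mor id_functor L' L g)) = Y X f \<and>
           X #> \<gamma> (Cmp (orbit_category G \<C>) f (fun_mor id_functor L' L g)) = X #> \<gamma> f \<and>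
           \<iota> (Cmp (orbit_category G \<C>) f (fun_mor id_functor L' L g)) = Cmp between (\<iota> f) g)"
      by (simp add: orbit_category_sel between_Cmp)
  qed
  then show ?thesis unfolding sums_of_representables_def by blast
qed

text \<open>Morphisms into K are cosets K g with g in K, so K itself is the only one.\<close>

lemma between_terminal:
  shows "K \<in> Ob between" "L \<in> Ob between \<Longrightarrow> K \<in> Hom between L K"
    "L \<in> Ob between \<Longrightarrow> f \<in> Hom between L' L \<Longrightarrow> Cmp between K f = K"
proof -
  have Kc: "K \<subseteq> carrier G" using K subgroup.subset by auto
  show "K \<in> Ob between" using K H by (simp add: between_Ob)
  show "K \<in> Hom between L K" if "L \<in> Ob between"
  proof -
    have L: "L \<subseteq> K" "L \<subseteq> carrier G" using that Kc by (auto simp: between_Ob)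
    have "\<one> \<in> transporter G L K" using L by (auto simp: transporter_iff[OF L(2)] subset_iff)
    moreover have "K = K #> \<one>" using Kc by simp
    ultimately show ?thesis unfolding between_Hom using subgroup.one_closed[OF K] by blast
  qed
  show "Cmp between K f = K" if L: "L \<in> Ob between" and f: "f \<in> Hom between L' L"
  proof -
    obtain g where g: "f = L #> g" "g \<in> K" using f by (auto simp: between_Hom)
    have Ls: "subgroup L G" "L \<subseteq> K" using L by (auto simp: between_Ob)
    have "K <#> (L #> g) = K"
    proof (intro equalityI subsetI)
      fix u assume "u \<in> K <#> (L #> g)"
      then obtain k l where "k \<in> K" "l \<in> L" "u = k \<otimes> (l \<otimes> g)" by (auto simp: set_mult_def r_coset_def)
      then show "u \<in> K" using g Ls subgroup.m_closed[OF K] by auto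
    next
      fix u assume u: "u \<in> K"
      have "u = (u \<otimes> inv g) \<otimes> (\<one> \<otimes> g)" using u g Kc by (simp add: m_assoc subset_iff)
      moreover have "u \<otimes> inv g \<in> K" using u g subgroup.m_closed[OF K] subgroup.m_inv_closed[OF K] by
          auto
      ultimately show "u \<in> K <#> (L #> g)"
        using subgroup.one_closed[OF Ls(1)] unfolding set_mult_def r_coset_def by blast
    qed
    then show ?thesis by (simp add: between_Cmp g)
  qed
qed

end

end

section \<open>The projection to the fusion orbit category\<close>

lemma finsum_localization_at:
  assumes "finite A" "r \<in> carrier (localization_at p)" "prime p"
  shows "(\<Oplus>\<^bsub>localization_at p\<^esub>U\<in>A. r) = of_nat (card A) * r"
proof -
  interpret cring "localization_at p" by (rule cring_localization_at[OF assms(3)])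
  have sel: "\<zero>\<^bsub>localization_at p\<^esub> = 0" "x \<oplus>\<^bsub>localization_at p\<^esub> y = x + y" for x y
    by (simp_all add: localization_at_def)
  show ?thesis using assms(1)
    by induction (simp_all add: sel assms(2) algebra_simps)
qed

lemma inverse_in_localization_at:
  assumes "\<not> p dvd m"
  shows "1 / of_nat m \<in> carrier (localization_at p)"
proof -
  have "\<not> int p dvd int m" using assms by simp
  moreover have "1 / of_nat m = (of_int 1 / of_int (int m) :: rat)" by simp
  ultimately show ?thesis unfolding localization_at_def partial_object.simps by blast
qed

context group begin

text \<open>Sylow's theorem inside C for the full power of p dividing |C|, which may be 1; the
  number of cosets is the cofactor. The cosets are written as an image because they will index the
  averaging sum.\<close>

lemma sylow_subgroup_of_subgroup:
  assumes fin: "finite (carrier G)" and p: "prime p" and C: "subgroup C G"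
  obtains S where "p_subgroup p G S" "S \<subseteq> C" "\<not> p dvd card ((\<lambda>c. S #> c) ` C)"
proof -
  interpret GC: group "G\<lparr>carrier := C\<rparr>" using subgroup.subgroup_is_group[OF C is_group] .
  have fC: "finite C" using fin subgroup.subset[OF C] finite_subset by auto
  have "card C \<noteq> 0" using fC subgroup.one_closed[OF C] by auto
  moreover have "\<not> is_unit p" using p by auto
  ultimately obtain m where m: "card C = p ^ multiplicity p (card C) * m" "\<not> p dvd m"
    by (rule multiplicity_decompose')
  let ?a = "multiplicity p (card C)"
  obtain S where S: "subgroup S (G\<lparr>carrier := C\<rparr>)" "card S = p ^ ?a"
    using sylow_thm[OF p GC.is_group, of ?a m] m fC by (auto simp: order_def)
  have SC: "S \<subseteq> C" using subgroup.subset[OF S(1)] by simp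
  have "rcosets\<^bsub>G\<lparr>carrier := C\<rparr>\<^esub> S = (\<lambda>c. S #> c) ` C"
    by (auto simp: RCOSETS_def r_coset_def)
  then have "card ((\<lambda>c. S #> c) ` C) * p ^ ?a = p ^ ?a * m"
    using GC.lagrange[OF S(1)] S(2) m(1) by (simp add: order_def)
  then have "card ((\<lambda>c. S #> c) ` C) = m" using p by (auto dest: prime_gt_0_nat)
  then show ?thesis
    using that[of S] S(2) incl_subgroup[OF C S(1)] SC m(2) by (auto simp: p_subgroup_def)
qed

text \<open>In terms of \<open>pr\<close>: the automorphism H c with c centralizing H goes to the
  identity of H.\<close>

lemma mult_centralizer_absorb:
  assumes "H \<subseteq> carrier G" "c \<in> centralizer G H"
  shows "(H #> c) <#> centralizer G H = H <#> centralizer G H"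
proof -
  have C: "subgroup (centralizer G H) G" by (rule subgroup_centralizer[OF assms(1)])
  have c: "c \<in> carrier G" using assms(2) centralizer_subset by auto
  have "c <# centralizer G H = centralizer G H"
    using coset_join3[OF c C assms(2)] .
  then show ?thesis
    using rcos_assoc_lcos[OF assms(1) centralizer_subset c] by simp
qed

text \<open>Equality of the double cosets gives g' = x g c with x in X and c centralizing H, whence
  X g' = X g c. So the generators of the fiber span are the differences of an element and its
  translate by the centralizer, the usual relations of coinvariants.\<close>

lemma fusion_eq_imp_centralizer:
  assumes H: "subgroup H G" and X: "subgroup X G"
    and g: "g \<in> transporter G H X" "g' \<in> transporter G H X"
    and eq: "(X #> g) <#> centralizer G H = (X #> g') <#> centralizer G H"
  obtains c where "c \<in> centralizer G H" "X #> g' = (X #> g) <#> (H #> c)"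
proof -
  have Hc: "H \<subseteq> carrier G" and Xc: "X \<subseteq> carrier G" using H X subgroup.subset by auto
  have gc: "g \<in> carrier G" "g' \<in> carrier G" using g by (auto simp: transporter_def)
  have C: "subgroup (centralizer G H) G" by (rule subgroup_centralizer[OF Hc])
  have "g' \<otimes> \<one> \<in> (X #> g') <#> centralizer G H"
    using rcos_self[OF gc(2) X] subgroup.one_closed[OF C] unfolding set_mult_def by blast
  then obtain x c where c: "x \<in> X" "c \<in> centralizer G H" "g' = (x \<otimes> g) \<otimes> c"
    using gc unfolding eq[symmetric] by (auto simp: set_mult_def r_coset_def)
  have cc: "c \<in> carrier G" "x \<in> carrier G" using c centralizer_subset Xc by auto
  have "g' = x \<otimes> (g \<otimes> c)" using c(3) cc gc by (simp add: m_assoc)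
  then have "g' \<in> X #> (g \<otimes> c)" using c(1) by (auto simp: r_coset_def)
  then have "X #> g' = X #> (g \<otimes> c)" using rcos_eq_iff[OF X gc(2)] gc cc by simp
  also have "\<dots> = (X #> g) <#> (H #> c)"
    using orbit_comp[OF H H X centralizer_transporter[OF H c(2)] g(1)] by simp
  finally show ?thesis using that c(2) by blast
qed

lemma full_functor_pr:
  assumes sub: "\<And>H. H \<in> \<C> \<Longrightarrow> subgroup H G"
  shows "full_functor (orbit_category G \<C>) (fusion_orbit_category G \<C>) (pr G)"
proof (rule full_functor.intro[OF category_orbit_category[OF sub] category_fusion_orbit_category[OF sub]
      is_functor_pr[OF sub]])
  fix H K g assume "g \<in> Hom (fusion_orbit_category G \<C>) H K"
  then show "\<exists>f\<in>Hom (orbit_category G \<C>) H K. fun_mor (pr G) H K f = g"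
    by (auto simp: fusion_orbit_category_def orbit_category_def pr_def)
qed (simp_all add: pr_def orbit_category_def fusion_orbit_category_def)

text \<open>Provides the assumption \<open>acyclic\<close> of \<open>exact_kan_extension\<close>.
  Closure under overgroups enters through \<open>KC\<close>, which puts the groups between H and K
  into the collection.\<close>

lemma pr_acyclic:
  fixes Q :: "('a set, 'a set, rat, 'c, rat) resolution"
  assumes fin: "finite (carrier G)" and p: "prime p" and coll: "p_collection p G \<C>"
    and over: "closed_under_p_overgroups p G \<C>"
    and Q: "projective_resolution (localization_at p) (orbit_category G \<C>) (const_module
        (localization_at p)) Q"
    and H: "H \<in> Ob (orbit_category G \<C>)" and z: "z \<in> carrier (mod_at (trm Q (Suc n)) H)"
    and dz: "diff Q n H z \<in> fiber_span (orbit_category G \<C>) (pr G) (trm Q n) H"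
  shows "\<exists>w\<in>carrier (mod_at (trm Q (Suc (Suc n))) H).
        z \<ominus>\<^bsub>mod_at (trm Q (Suc n)) H\<^esub> diff Q (Suc n) H w
          \<in> fiber_span (orbit_category G \<C>) (pr G) (trm Q (Suc n)) H"
proof -
  let ?R = "localization_at p" and ?O = "orbit_category G \<C>" and ?Z = "centralizer G H"
  have R: "cring ?R" by (rule cring_localization_at[OF p])
  have psub: "p_subgroup p G L" if "L \<in> \<C>" for L using coll that by (simp add: p_collection_def)
  have sub: "subgroup L G" if "L \<in> \<C>" for L using psub[OF that] by (simp add: p_subgroup_def)
  interpret full_functor ?O "fusion_orbit_category G \<C>" "pr G" by (rule full_functor_pr[OF sub])
  note QE = projective_resolution_exact[OF Q is_cat_module_const_module[OF R]]
  note Qm = exact_trm[OF QE]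
  have HC: "H \<in> \<C>" using H by (simp add: orbit_category_def)
  note Hs = sub[OF HC]
  have Hc: "H \<subseteq> carrier G" using subgroup.subset[OF Hs] .
  have Zs: "subgroup ?Z G" by (rule subgroup_centralizer[OF Hc])
  have Zc: "?Z \<subseteq> carrier G" by (rule centralizer_subset)
  obtain S where S: "p_subgroup p G S" "S \<subseteq> ?Z" "\<not> p dvd card ((\<lambda>c. S #> c) ` ?Z)"
    using sylow_subgroup_of_subgroup[OF fin p Zs] .
  have Ss: "subgroup S G" using S(1) by (simp add: p_subgroup_def)
  have Sc: "S \<subseteq> carrier G" using subgroup.subset[OF Ss] .
  define K where "K = H <#> S"
  note pK = p_subgroup_mult_centralizing[OF p psub[OF HC] S(1,2), folded K_def]
  have Ks: "subgroup K G" using pK(1) by (simp add: p_subgroup_def)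
  have KC: "L \<in> \<C>" if L: "subgroup L G" "H \<subseteq> L" "L \<subseteq> K" for L
    using p_subgroup_subgroup[OF p pK(1) L(1,3)] HC L(2) over
    by (auto simp: closed_under_p_overgroups_def)
  note KH = Ks pK(2,4) sub KC
  let ?E = "between K H"
  have HE: "H \<in> Ob ?E" using Hs pK(2) by (simp add: between_Ob[OF KH])
  have "\<exists>k. (\<forall>n. k n \<in> nat_trans ?R ?E (trm Q n) (trm Q (Suc n))) \<and>
    (\<forall>n. \<forall>L\<in>Ob ?E. \<forall>a\<in>carrier (mod_at (trm Q (Suc n)) L).
       diff Q (Suc n) L (k (Suc n) L a) = a \<ominus>\<^bsub>mod_at (trm Q (Suc n)) L\<^esub> k n L (diff Q n L a))"
    using contracting_homotopy[where t = K and \<tau> = "\<lambda>_. K", OF R category_between[OF KH] C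
        is_functor_between[OF KH] sums_of_representables_between[OF KH] Q]
      between_terminal[OF KH] by simp
  then obtain k where k: "\<And>n. k n \<in> nat_trans ?R ?E (trm Q n) (trm Q (Suc n))"
    and kd: "\<And>n a. a \<in> carrier (mod_at (trm Q (Suc n)) H) \<Longrightarrow>
       diff Q (Suc n) H (k (Suc n) H a) = a \<ominus>\<^bsub>mod_at (trm Q (Suc n)) H\<^esub> k n H (diff Q n H a)"
    using HE by blast
  note kl = nat_trans_lin[OF k HE]
  \<comment> \<open>A right action, as \<open>act_mult\<close> shows, because modules over a
    category are contravariant.\<close>
  define act where "act m c = mod_map (trm Q m) H H (H #> c)" for m c
  have hom: "H #> c \<in> Hom ?O H H" if "c \<in> ?Z" for c
    using centralizer_transporter[OF Hs that] by (auto simp: orbit_category_def)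
  have actl: "act m c \<in> lin_maps ?R (mod_at (trm Q m) H) (mod_at (trm Q m) H)" if "c \<in> ?Z" for m c
    unfolding act_def by (rule cat_module_lin[OF Qm H H hom[OF that]])
  note actc = lin_maps_closed[OF actl]
  have act_mult: "act m (c \<otimes> c') a = act m c' (act m c a)"
    if "c \<in> ?Z" "c' \<in> ?Z" "a \<in> carrier (mod_at (trm Q m) H)" for m c c' a
    using cat_module_Cmp[OF Qm H H H hom[OF that(2)] hom[OF that(1)] that(3)]
      orbit_comp[OF Hs Hs Hs centralizer_transporter[OF Hs that(2)] centralizer_transporter[OF Hs
          that(1)]]
    by (simp add: act_def orbit_category_def)
  have k_act: "k m H (act m s a) = act (Suc m) s (k m H a)"
    if "s \<in> S" "a \<in> carrier (mod_at (trm Q m) H)" for m s a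
  proof -
    have "H #> s \<in> Hom ?E H H"
      using that(1) pK(3) S(2) centralizer_transporter[OF Hs, of s] by (auto simp: between_Hom[OF KH])
    from nat_trans_nat[OF k HE HE this that(2)] show ?thesis by (simp add: act_def)
  qed
  have pr_c: "fun_mor (pr G) H H (H #> c) = Idn (fusion_orbit_category G \<C>) H" if "c \<in> ?Z" for c
    using mult_centralizer_absorb[OF Hc that] by (simp add: pr_def fusion_orbit_category_def)
  let ?\<pi> = "\<lambda>m. coinv ?O (pr G) (trm Q m) H"
  have \<pi>_act: "?\<pi> m (act m c a) = ?\<pi> m a" if "c \<in> ?Z" "a \<in> carrier (mod_at (trm Q m) H)" for m c a
    using coinv_fiber[OF Qm H H hom[OF that(1)] category_Idn[OF C H] _ that(2)]
      pr_c[OF that(1)] functor_Idn'[OF H] cat_module_Idn[OF Qm H that(2)] by (simp add: act_def)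
  let ?A = "(\<lambda>c. S #> c) ` ?Z"
  define rep where "rep U = (SOME c. c \<in> ?Z \<and> U = S #> c)" for U
  have rep: "rep U \<in> ?Z" "U = S #> rep U" if "U \<in> ?A" for U
  proof -
    obtain c where "c \<in> ?Z \<and> U = S #> c" using \<open>U \<in> ?A\<close> by auto
    then have "rep U \<in> ?Z \<and> U = S #> rep U" unfolding rep_def by (rule someI)
    then show "rep U \<in> ?Z" "U = S #> rep U" by auto
  qed
  have rep_inv: "inv (rep U) \<in> ?Z" if "U \<in> ?A" for U
    using subgroup.m_inv_closed[OF Zs rep(1)[OF that]] .
  have fA: "finite ?A" using fin Zc finite_subset by blast
  let ?r = "1 / of_nat (card ?A) :: rat"
  have r: "?r \<in> carrier ?R" by (rule inverse_in_localization_at[OF S(3)])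
  have "card ?A \<noteq> 0" using S(3) by (metis dvd_0_right)
  then have r1: "(\<Oplus>\<^bsub>?R\<^esub>U\<in>?A. ?r) = \<one>\<^bsub>?R\<^esub>"
    unfolding finsum_localization_at[OF fA r p] by (simp add: localization_at_def)
  show ?thesis
  proof (rule average_homotopy[where k = "\<lambda>n. k n H" and \<alpha> = "\<lambda>U. H #> inv (rep U)",
        OF R QE H fA r r1 kl kd hom[OF rep_inv] pr_c[OF rep_inv] _ z dz])
    fix m X f f' a assume X: "X \<in> Ob ?O" and f: "f \<in> Hom ?O H X" "f' \<in> Hom ?O H X"
      and ff: "fun_mor (pr G) H X f = fun_mor (pr G) H X f'" and a: "a \<in> carrier (mod_at (trm Q m) X)"
    have Xs: "subgroup X G" using X sub by (simp add: orbit_category_def)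
    obtain g g' where g: "f = X #> g" "g \<in> transporter G H X" "f' = X #> g'" "g' \<in> transporter G H X"
      using f by (auto simp: orbit_category_def)
    obtain c where c: "c \<in> ?Z" "f' = f <#> (H #> c)"
      using fusion_eq_imp_centralizer[OF Hs Xs g(2,4)] ff by (auto simp: g(1,3) pr_def)
    define b where "b = mod_map (trm Q m) H X f a"
    have b: "b \<in> carrier (mod_at (trm Q m) H)"
      unfolding b_def by (rule cat_module_closed[OF Qm H X f(1) a])
    have b': "mod_map (trm Q m) H X f' a = act m c b"
      using cat_module_Cmp[OF Qm H H X hom[OF c(1)] f(1) a] c(2)
      by (simp add: act_def b_def orbit_category_def)
    let ?KM = "mod_at (kan_module ?O (pr G) (trm Q (Suc m))) H"
    interpret KM: module ?R ?KM by (rule module_kan[OF Qm H])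
    \<comment> \<open>The summand belonging to the coset S d. In a right action the inverse of s d
      acts by d^-1 first and s^-1 last; the latter passes through k and becomes trivial in the
      coinvariants, so any representative of S d gives the same value.\<close>
    define \<Psi> where "\<Psi> d = ?\<pi> (Suc m) (k m H (act m (inv d) b))" for d
    have \<Psi>c: "\<Psi> d \<in> carrier ?KM" if "d \<in> ?Z" for d
      unfolding \<Psi>_def
      using coinv_closed[OF Qm H lin_maps_closed[OF kl actc[OF subgroup.m_inv_closed[OF Zs that] b]]] .
    have \<Psi>S: "\<Psi> (s \<otimes> d) = \<Psi> d" if s: "s \<in> S" and d: "d \<in> ?Z" for s d
    proof -
      have sZ: "s \<in> ?Z" using s S(2) by auto
      note i = subgroup.m_inv_closed[OF Ss s] and iZ = subgroup.m_inv_closed[OF Zs sZ]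
        and dZ = subgroup.m_inv_closed[OF Zs d]
      have "act m (inv (s \<otimes> d)) b = act m (inv s) (act m (inv d) b)"
        using s d Sc Zc act_mult[OF dZ iZ b] by (simp add: inv_mult_group subset_iff)
      then show ?thesis
        unfolding \<Psi>_def
        using k_act[OF i actc[OF dZ b]] \<pi>_act[OF iZ lin_maps_closed[OF kl actc[OF dZ b]]] by simp
    qed
    have \<Psi>_eq: "\<Psi> d = \<Psi> (rep (S #> d))" if d: "d \<in> ?Z" for d
    proof -
      have U: "S #> d \<in> ?A" using d by auto
      have "d \<in> S #> rep (S #> d)" using rcos_self[of d S] Ss d Zc rep(2)[OF U] by auto
      then obtain s where "s \<in> S" "d = s \<otimes> rep (S #> d)" by (auto simp: r_coset_def)
      then show ?thesis using \<Psi>S rep(1)[OF U] by metis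
    qed
    have cZ: "inv c \<in> ?Z" "inv c \<in> carrier G" "c \<in> carrier G" using subgroup.m_inv_closed[OF Zs
        c(1)] c(1) Zc by auto
    \<comment> \<open>Acting by c first amounts to replacing the representative d by d c^-1. The sum
      for f' is thus the sum for f with the cosets permuted by right translation.\<close>
    let ?h = "\<lambda>U. U #> inv c"
    have hS: "?h (S #> d) = S #> (d \<otimes> inv c)" if "d \<in> ?Z" for d
      using coset_mult_assoc[OF Sc, of d "inv c"] that cZ Zc by auto
    have preimage: "S #> (d \<otimes> c) \<in> ?A" "?h (S #> (d \<otimes> c)) = S #> d" if "d \<in> ?Z" for d
      using hS[of "d \<otimes> c"] subgroup.m_closed[OF Zs that c(1)] that cZ(3) Zc by (auto simp: m_assoc
          subset_iff)
    have hA: "?h ` ?A = ?A"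
    proof (intro equalityI subsetI)
      fix U assume "U \<in> ?h ` ?A"
      then show "U \<in> ?A" using hS subgroup.m_closed[OF Zs _ cZ(1)] by auto
    next
      fix U assume "U \<in> ?A"
      then obtain d where "d \<in> ?Z" "U = S #> d" by auto
      then show "U \<in> ?h ` ?A" using preimage[of d] by (metis imageI)
    qed
    have inj: "inj_on ?h ?A" using hA fA by (metis eq_card_imp_inj_on)
    have "(\<Oplus>\<^bsub>?KM\<^esub>U\<in>?A. \<Psi> (rep (?h U))) = (\<Oplus>\<^bsub>?KM\<^esub>U\<in>?A. \<Psi> (rep U))"
      using KM.M.finsum_reindex[OF _ inj, of "\<lambda>U. \<Psi> (rep U)"] \<Psi>c rep(1) by (simp add: hA Pi_iff)
    moreover have "(\<Oplus>\<^bsub>?KM\<^esub>U\<in>?A. ?\<pi> (Suc m) (k m H (act m (inv (rep U)) (act m c b))))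
        = (\<Oplus>\<^bsub>?KM\<^esub>U\<in>?A. \<Psi> (rep (?h U)))"
    proof (rule KM.M.finsum_cong')
      fix U assume U: "U \<in> ?A"
      note d = rep(1)[OF U]
      have dc: "rep U \<otimes> inv c \<in> ?Z" using subgroup.m_closed[OF Zs d cZ(1)] .
      have "act m (inv (rep U)) (act m c b) = act m (inv (rep U \<otimes> inv c)) b"
        using act_mult[OF c(1) rep_inv[OF U] b] d Zc cZ by (simp add: inv_mult_group subset_iff)
      then have "?\<pi> (Suc m) (k m H (act m (inv (rep U)) (act m c b))) = \<Psi> (rep U \<otimes> inv c)" by (simp
          add: \<Psi>_def)
      also have "\<dots> = \<Psi> (rep (?h U))" using \<Psi>_eq[OF dc] hS[OF d] rep(2)[OF U] by simp
      finally show "?\<pi> (Suc m) (k m H (act m (inv (rep U)) (act m c b))) = \<Psi> (rep (?h U))" .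
    next
      show "(\<lambda>U. \<Psi> (rep (?h U))) \<in> ?A \<rightarrow> carrier ?KM"
      proof (rule Pi_I)
        fix U assume "U \<in> ?A"
        then have "?h U \<in> ?A" using hA by blast
        then show "\<Psi> (rep (?h U)) \<in> carrier ?KM" by (intro \<Psi>c rep(1))
      qed
    qed simp
    ultimately show "(\<Oplus>\<^bsub>?KM\<^esub>U\<in>?A. ?\<pi> (Suc m) (k m H (mod_map (trm Q m) H H (H #> inv (rep U))
        (mod_map (trm Q m) H X f a)))) =
      (\<Oplus>\<^bsub>?KM\<^esub>U\<in>?A. ?\<pi> (Suc m) (k m H (mod_map (trm Q m) H H (H #> inv (rep U)) (mod_map (trm Q m) H
          X f' a))))"
      unfolding b' b_def[symmetric] act_def[symmetric] by (simp add: \<Psi>_def)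
  qed
qed

end

theorem theorem1p10:
  fixes G :: "('g, 'z) monoid_scheme"
    and p :: nat
    and \<C> :: "'g set set"
    and M :: "('g set, 'g set, rat, 'a) cat_module"
    and P :: "('g set, 'g set, rat, 'b, rat) resolution"
    and Q :: "('g set, 'g set, rat, 'c, rat) resolution"
  assumes "group G"
    and "finite (carrier G)"
    and "prime p"
    and "p_collection p G \<C>"
    and "closed_under_p_overgroups p G \<C>"
    and "is_cat_module (localization_at p) (fusion_orbit_category G \<C>) M"
    and "projective_resolution (localization_at p) (fusion_orbit_category G \<C>)
           (const_module (localization_at p)) P"
    and "projective_resolution (localization_at p) (orbit_category G \<C>)
           (const_module (localization_at p)) Q"
  shows "(\<exists>\<phi>. comparison_map (localization_at p) (orbit_category G \<C>) (pr G) P Q \<phi>) \<and>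
         (\<forall>\<phi>. comparison_map (localization_at p) (orbit_category G \<C>) (pr G) P Q \<phi> \<longrightarrow>
            (\<forall>n. induced_map (localization_at p) (orbit_category G \<C>) (pr G) Q \<phi> M n
                   \<in> lin_isos (localization_at p)
                       (Ext (localization_at p) (fusion_orbit_category G \<C>) P M n)
                       (Ext (localization_at p) (orbit_category G \<C>) Q
                          (res_module (pr G) M) n)))"
proof -
  interpret group G by fact
  have sub: "subgroup H G" if "H \<in> \<C>" for H
    using assms(4) that by (simp add: p_collection_def p_subgroup_def)
  interpret exact_kan_extension "orbit_category G \<C>" "fusion_orbit_category G \<C>" "pr G" "localization_at p" P Q
    by (intro exact_kan_extension.intro exact_kan_extension_axioms.intro full_functor_pr sub
        cring_localization_at pr_acyclic[OF assms(2-5,8)] assms)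
  show ?thesis using comparison_map_exists induced_map_iso[OF _ assms(6)] by blast
qed

end
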